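(* Assume hypotheses (A1)–(A6) and (A9) listed in the context hold, and $d\ge2$. For $\epsilon>0$ let $(u^\epsilon,m^\epsilon)$ be a solution of the regularized system described in the context. Then for every $1\le r<\frac{d(1+\mu)}{d(1+\mu)-2}$, $\|m^\epsilon\|_{L^\infty(0,T;L^r(\mathbb{T}^d))}$ is bounded uniformly in $\epsilon$.
   Context: $\mathbb{T}^d$ is the $d$-dimensional flat torus, $T>0$ fixed. Data: $H:\mathbb{T}^d\times\mathbb{R}^d\to\mathbb{R}$, $g:[0,\infty)\to\mathbb{R}$, $u_T,m_0:\mathbb{T}^d\to\mathbb{R}$. Hypotheses: (A1) $H$ is $C^\infty$; $p\mapsto H(x,p)$ strictly convex; $\lim_{|p|\to\infty}H(x,p)/|p|=+\infty$; $H\ge1$. (A2) $g$ non-negative and increasing; $u_T,m_0\in C^\infty(\mathbb{T}^d)$, $m_0\ge0$, $\int m_0=1$. (A3) With $\hat L(x,p)=D_pH(x,p)\cdot p-H(x,p)$, there are $c,C>0$ with $\hat L\ge cH-C$. (A4) $g(z)=z^\alpha$, $\alpha>0$. (A5) $|D_xH|,|D^2_{xx}H|\le CH+C$, and for every symmetric matrix $M$ and $\delta>0$ there is $C_\delta$ with $\operatorname{tr}(D^2_{px}H M)\le\delta\operatorname{tr}(D^2_{pp}HM^2)+C_\delta H$. (A6) $m_0\ge\kappa_0>0$ for a constant $\kappa_0$. (A9) For a constant $\mu$ with $0<\mu<1$: $|D^2_{xp}H|^2\le CH^{\frac{2+2\mu}{2+\mu}}$ and, for every symmetric $M$, $|D^2_{pp}HM|^2\le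 CH^{\frac{\mu}{2+\mu}}\operatorname{tr}(D^2_{pp}HMM)$. Regularized system: $\eta_\epsilon$ is a standard symmetric mollifying kernel and $g_\epsilon(m)=\eta_\epsilon*g(\eta_\epsilon*m)$. A solution is a pair of smooth functions $u^\epsilon,m^\epsilon$ on $\mathbb{T}^d\times[0,T]$ with $-u^\epsilon_t+H(x,Du^\epsilon)=\Delta u^\epsilon+g_\epsilon(m^\epsilon)$, $m^\epsilon_t-\operatorname{div}(D_pH(x,Du^\epsilon)m^\epsilon)=\Delta m^\epsilon$, $u^\epsilon(x,T)=u_T(x)$, $m^\epsilon(x,0)=m_0(x)$. *)

theory Defs
  imports "HOL-Analysis.Analysis"
begin

definition dderiv :: "('a::real_normed_vector \<Rightarrow> real) \<Rightarrow> 'a \<Rightarrow> 'a \<Rightarrow> real" where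
  "dderiv f v x = deriv (\<lambda>s. f (x + s *\<^sub>R v)) 0"

coinductive smooth_fun :: "('a::real_normed_vector \<Rightarrow> real) \<Rightarrow> bool" where
  "(\<forall>x. f differentiable (at x)) \<Longrightarrow> (\<forall>v. smooth_fun (dderiv f v)) \<Longrightarrow> smooth_fun f"

definition strictly_convex :: "('a::real_vector \<Rightarrow> real) \<Rightarrow> bool" where
  "strictly_convex f \<longleftrightarrow>
     (\<forall>x y. x \<noteq> y \<longrightarrow> (\<forall>s::real. 0 < s \<and> s < 1 \<longrightarrow>
        f ((1 - s) *\<^sub>R x + s *\<^sub>R y) < (1 - s) * f x + s * f y))"

section \<open>The flat torus as Z^d-periodic functions on R^d\<close>

definition Zd_periodic :: "(real^'d \<Rightarrow> 'b) \<Rightarrow> bool" where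
  "Zd_periodic f \<longleftrightarrow> (\<forall>x k. (\<forall>i. k $ i \<in> \<int>) \<longrightarrow> f (x + k) = f x)"

definition torus_integral :: "(real^'d \<Rightarrow> real) \<Rightarrow> real" where
  "torus_integral f = integral (cbox 0 1) f"

definition DpH :: "(real^'d \<Rightarrow> real^'d \<Rightarrow> real) \<Rightarrow> real^'d \<Rightarrow> real^'d \<Rightarrow> real^'d" where
  "DpH H x p = (\<chi> i. dderiv (H x) (axis i 1) p)"

definition DxH :: "(real^'d \<Rightarrow> real^'d \<Rightarrow> real) \<Rightarrow> real^'d \<Rightarrow> real^'d \<Rightarrow> real^'d" where
  "DxH H x p = (\<chi> i. dderiv (\<lambda>y. H y p) (axis i 1) x)"

definition DppH :: "(real^'d \<Rightarrow> real^'d \<Rightarrow> real) \<Rightarrow> real^'d \<Rightarrow> real^'d \<Rightarrow> real^'d^'d" where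
  "DppH H x p = (\<chi> i j. dderiv (\<lambda>q. dderiv (H x) (axis j 1) q) (axis i 1) p)"

definition DxxH :: "(real^'d \<Rightarrow> real^'d \<Rightarrow> real) \<Rightarrow> real^'d \<Rightarrow> real^'d \<Rightarrow> real^'d^'d" where
  "DxxH H x p = (\<chi> i j. dderiv (\<lambda>y. dderiv (\<lambda>z. H z p) (axis j 1) y) (axis i 1) x)"

definition DpxH :: "(real^'d \<Rightarrow> real^'d \<Rightarrow> real) \<Rightarrow> real^'d \<Rightarrow> real^'d \<Rightarrow> real^'d^'d" where
  "DpxH H x p = (\<chi> i j. dderiv (\<lambda>q. dderiv (\<lambda>y. H y q) (axis j 1) x) (axis i 1) p)"

definition DxpH :: "(real^'d \<Rightarrow> real^'d \<Rightarrow> real) \<Rightarrow> real^'d \<Rightarrow> real^'d \<Rightarrow> real^'d^'d" where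
  "DxpH H x p = (\<chi> i j. dderiv (\<lambda>y. dderiv (H y) (axis j 1) p) (axis i 1) x)"

definition grad_x :: "((real^'d) \<times> real \<Rightarrow> real) \<Rightarrow> real^'d \<Rightarrow> real \<Rightarrow> real^'d" where
  "grad_x w x t = (\<chi> i. dderiv w (axis i 1, 0) (x, t))"

definition lap_x :: "((real^'d) \<times> real \<Rightarrow> real) \<Rightarrow> real^'d \<Rightarrow> real \<Rightarrow> real" where
  "lap_x w x t = (\<Sum>i\<in>UNIV. dderiv (dderiv w (axis i 1, 0)) (axis i 1, 0) (x, t))"

definition dt :: "((real^'d) \<times> real \<Rightarrow> real) \<Rightarrow> real^'d \<Rightarrow> real \<Rightarrow> real" where
  "dt w x t = dderiv w (0, 1) (x, t)"

definition div_x :: "((real^'d) \<times> real \<Rightarrow> real^'d) \<Rightarrow> real^'d \<Rightarrow> real \<Rightarrow> real" where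
  "div_x F x t = (\<Sum>i\<in>UNIV. dderiv (\<lambda>z. F z $ i) (axis i 1, 0) (x, t))"

definition mollifier_kernel :: "(real^'d \<Rightarrow> real) \<Rightarrow> bool" where
  "mollifier_kernel \<eta> \<longleftrightarrow> smooth_fun \<eta> \<and> (\<forall>y. 0 \<le> \<eta> y) \<and> (\<forall>y. 1 \<le> norm y \<longrightarrow> \<eta> y = 0)
     \<and> (\<eta> has_integral 1) UNIV \<and> (\<forall>y. \<eta> (- y) = \<eta> y)"

definition moll :: "(real^'d \<Rightarrow> real) \<Rightarrow> real \<Rightarrow> real^'d \<Rightarrow> real" where
  "moll \<eta> \<epsilon> y = inverse \<epsilon> ^ CARD('d) * \<eta> (inverse \<epsilon> *\<^sub>R y)"

text \<open>Convolution of a kernel on R^d with a periodic function (= convolution on the torus).\<close>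
definition conv :: "(real^'d \<Rightarrow> real) \<Rightarrow> (real^'d \<Rightarrow> real) \<Rightarrow> real^'d \<Rightarrow> real" where
  "conv k f x = integral UNIV (\<lambda>y. k y * f (x - y))"

definition g_eps :: "(real^'d \<Rightarrow> real) \<Rightarrow> real \<Rightarrow> real \<Rightarrow> (real^'d \<Rightarrow> real) \<Rightarrow> real^'d \<Rightarrow> real" where
  "g_eps \<eta> \<alpha> \<epsilon> f = conv (moll \<eta> \<epsilon>) (\<lambda>y. (conv (moll \<eta> \<epsilon>) f y) powr \<alpha>)"

definition reg_MFG_solution ::
  "(real^'d \<Rightarrow> real^'d \<Rightarrow> real) \<Rightarrow> (real^'d \<Rightarrow> real) \<Rightarrow> real \<Rightarrow> real \<Rightarrow>
   (real^'d \<Rightarrow> real) \<Rightarrow> (real^'d \<Rightarrow> real) \<Rightarrow> real \<Rightarrow>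
   ((real^'d) \<times> real \<Rightarrow> real) \<Rightarrow> ((real^'d) \<times> real \<Rightarrow> real) \<Rightarrow> bool" where
  "reg_MFG_solution H \<eta> \<alpha> T uT m0 \<epsilon> u m \<longleftrightarrow>
     smooth_fun u \<and> smooth_fun m \<and>
     (\<forall>t. Zd_periodic (\<lambda>x. u (x, t))) \<and> (\<forall>t. Zd_periodic (\<lambda>x. m (x, t))) \<and>
     (\<forall>x. \<forall>t\<in>{0..T}.
        - dt u x t + H x (grad_x u x t) = lap_x u x t + g_eps \<eta> \<alpha> \<epsilon> (\<lambda>y. m (y, t)) x) \<and>
     (\<forall>x. \<forall>t\<in>{0..T}.
        dt m x t - div_x (\<lambda>(y, s). m (y, s) *\<^sub>R DpH H y (grad_x u y s)) x t = lap_x m x t) \<and>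
     (\<forall>x. u (x, T) = uT x) \<and> (\<forall>x. m (x, 0) = m0 x)"

end

theory Submission
  imports Defs
begin

text \<open>Write \<open>X = tr (D\<^sup>2\<^sub>p\<^sub>p H (D\<^sup>2u)\<^sup>2) \<ge> 0\<close> and \<open>z = \<eta>\<^sub>\<epsilon> * m\<close>.  Testing the Hamilton-Jacobi equation
  with \<open>m\<close> and with \<open>m\<^sub>0 \<ge> \<kappa>\<^sub>0\<close> bounds \<open>\<integral>\<integral> H m\<close>: superlinearity absorbs \<open>Du \<cdot> Dm\<^sub>0\<close> into
  \<open>\<kappa>\<^sub>0 H\<close>, and by symmetry of the kernel \<open>\<integral> g\<^sub>\<epsilon>(m) (M - m/2) = \<integral> z\<^sup>\<alpha> (M - z/2)\<close> is bounded above.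
  Testing its Laplacian with \<open>m\<close> bounds \<open>\<integral>\<integral> X m\<close>, since the coupling has a sign by monotonicity.
  Hypothesis (A9) gives \<open>|div D\<^sub>p H| \<le> K (H + X)^((1+\<mu>)/(2+\<mu>))\<close>, so in the evolution of
  \<open>\<integral> m\<^sup>r\<close> Young's inequality leaves \<open>\<integral>\<integral> m^(1+(r-1)(2+\<mu>))\<close>.  The range of \<open>r\<close> is exactly the one
  in which a Gagliardo-Nirenberg inequality with an arbitrarily small loss bounds this by a power of
  \<open>sup\<^sub>t \<integral> m\<^sup>r + \<integral>\<integral> |D m^(r/2)|\<^sup>2\<close> small enough to be absorbed.  The loss makes an elementary proof possible:
  compare a function with its averages over cubes of side \<open>2^(-j)\<close>.\<close>

section \<open>Smooth functions\<close>

text \<open>Uniformity in \<epsilon> comes from using nothing about the coupling except that the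
  kernel is even, nonnegative and of mass one and that z^\<alpha> is increasing; no norm or
  derivative of the coupling is estimated. The exponents fit together as follows. Put \<theta> =
  (1+\<mu>)/(2+\<mu>). Young's inequality splits m^r (H+X)^\<theta> into l m (H+X) and
  l^(-(1+\<mu>)) m^(1+(r-1)(2+\<mu>)). Applied to m^(r/2), the interpolation inequality reaches the
  exponent r + r\<kappa>/d for each \<kappa> < 2, and 1+(r-1)(2+\<mu>) < r + 2r/d is the same as r
  (d(1+\<mu>)-2) < d(1+\<mu>). Its right-hand side is at most quadratic in the unknown Z, because d
  \<ge> 2 makes \<kappa>/d < 1. With l of order Z the quadratic term becomes Z^(1-\<mu>), which is
  sublinear since \<mu> > 0. Noninteger powers of m are differentiated throughout, so strict
  positivity of m has to be proved beforehand, by a maximum principle.\<close>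

lemma smooth_fun_differentiable: "smooth_fun f \<Longrightarrow> f differentiable (at x)"
  by (auto elim: smooth_fun.cases)

lemma smooth_fun_dderiv: "smooth_fun f \<Longrightarrow> smooth_fun (dderiv f v)"
  by (auto elim: smooth_fun.cases)

lemma smooth_continuous_on: "smooth_fun f \<Longrightarrow> continuous_on S f"
  by (meson continuous_at_imp_continuous_on differentiable_imp_continuous_within smooth_fun_differentiable)

text \<open>\<open>dderiv\<close> rests on the one-variable \<open>deriv\<close>, a choice operator
  that carries no information where no derivative exists. A Frechet derivative pins its value down,
  and the calculus rules below are derived from this.\<close>

lemma dderiv_eqI:
  assumes D: "(f has_derivative D) (at x)"
  shows "dderiv f v x = D v"
proof -
  have "((\<lambda>s::real. f (x + s *\<^sub>R v)) has_derivative (\<lambda>s. D (s *\<^sub>R v))) (at 0)"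
    by (rule has_derivative_compose[where f="\<lambda>s::real. x + s *\<^sub>R v" and g=f])
      (auto intro!: derivative_eq_intros D)
  then have "((\<lambda>s::real. f (x + s *\<^sub>R v)) has_field_derivative D v) (at 0)"
    using linear_scale[OF has_derivative_linear[OF D]]
    by (simp add: has_field_derivative_def mult_commute_abs)
  then show ?thesis unfolding dderiv_def by (rule DERIV_imp_deriv)
qed

lemma differentiable_has_dderiv:
  "f differentiable (at x) \<Longrightarrow> (f has_derivative (\<lambda>v. dderiv f v x)) (at x)"
  unfolding differentiable_def by (metis (no_types, lifting) dderiv_eqI ext has_derivative_eq_rhs)

lemma smooth_fun_has_derivative: "smooth_fun f \<Longrightarrow> (f has_derivative (\<lambda>v. dderiv f v x)) (at x)"
  by (intro differentiable_has_dderiv smooth_fun_differentiable)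

lemma smooth_fun_DERIV_line:
  assumes "smooth_fun f"
  shows "((\<lambda>s. f (x + s *\<^sub>R v)) has_real_derivative dderiv f v (x + s *\<^sub>R v)) (at s)"
proof -
  have "((\<lambda>s::real. f (x + s *\<^sub>R v)) has_derivative (\<lambda>h. dderiv f (h *\<^sub>R v) (x + s *\<^sub>R v))) (at s)"
    by (rule has_derivative_compose[where f="\<lambda>s::real. x + s *\<^sub>R v" and g=f])
      (auto intro!: derivative_eq_intros smooth_fun_has_derivative assms)
  moreover have "dderiv f (h *\<^sub>R v) (x + s *\<^sub>R v) = h * dderiv f v (x + s *\<^sub>R v)" for h
    using linear_scale[OF has_derivative_linear[OF smooth_fun_has_derivative[OF assms, of "x + s *\<^sub>R v"]]]
    by simp
  ultimately show ?thesis
    by (simp add: has_field_derivative_def mult_commute_abs)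
qed

lemma linear_dderiv: "smooth_fun f \<Longrightarrow> linear (\<lambda>v. dderiv f v x)"
  by (rule has_derivative_linear[OF smooth_fun_has_derivative])

text \<open>Finite-order version of the coinductive \<open>smooth_fun\<close>. Closure under
  products and compositions is awkward by coinduction, because the derivative of a product is a sum
  of products and leaves the candidate relation; by induction on the order it is direct.\<close>

primrec Ck :: "nat \<Rightarrow> ('a::real_normed_vector \<Rightarrow> real) \<Rightarrow> bool" where
  "Ck 0 f \<longleftrightarrow> continuous_on UNIV f"
| "Ck (Suc n) f \<longleftrightarrow> (\<forall>x. f differentiable (at x)) \<and> (\<forall>v. Ck n (dderiv f v))"

lemma smooth_fun_iff_Ck: "smooth_fun f \<longleftrightarrow> (\<forall>n. Ck n f)"
proof
  have "smooth_fun f \<Longrightarrow> Ck n f" for n and f :: "'a \<Rightarrow> real"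
    by (induction n arbitrary: f)
      (auto simp: smooth_continuous_on smooth_fun_differentiable smooth_fun_dderiv)
  then show "smooth_fun f \<Longrightarrow> \<forall>n. Ck n f" by blast
  show "\<forall>n. Ck n f \<Longrightarrow> smooth_fun f"
  proof (coinduction arbitrary: f)
    case smooth_fun
    then have "Ck (Suc n) f" for n by blast
    then show ?case by auto
  qed
qed

lemma Ck_continuous: "Ck n f \<Longrightarrow> continuous_on UNIV f"
  by (cases n) (auto simp: continuous_at_imp_continuous_on differentiable_imp_continuous_within)

lemma Ck_SucD: "Ck (Suc n) f \<Longrightarrow> Ck n f"
proof (induction n arbitrary: f)
  case 0
  then show ?case using Ck_continuous[of "Suc 0" f] by simp
qed auto

lemma Ck_const: "Ck n (\<lambda>x. c)"
proof (induction n arbitrary: c)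
  case (Suc n)
  have "dderiv (\<lambda>x::'a. c) v = (\<lambda>x. 0)" for v
    by (rule ext, rule dderiv_eqI) (auto intro: has_derivative_const)
  with Suc show ?case by simp
qed simp

lemma dderiv_add:
  "f differentiable (at x) \<Longrightarrow> g differentiable (at x) \<Longrightarrow>
   dderiv (\<lambda>x. f x + g x) v x = dderiv f v x + dderiv g v x"
  by (rule dderiv_eqI[THEN trans])
    (auto intro!: has_derivative_add differentiable_has_dderiv)

lemma dderiv_mult:
  "f differentiable (at x) \<Longrightarrow> g differentiable (at x) \<Longrightarrow>
   dderiv (\<lambda>x. f x * g x) v x = f x * dderiv g v x + dderiv f v x * g x"
  by (rule dderiv_eqI[THEN trans])
    (auto intro!: has_derivative_mult differentiable_has_dderiv)

lemma Ck_add: "Ck n f \<Longrightarrow> Ck n g \<Longrightarrow> Ck n (\<lambda>x. f x + g x)"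
proof (induction n arbitrary: f g)
  case (Suc n)
  then have "dderiv (\<lambda>x. f x + g x) v = (\<lambda>x. dderiv f v x + dderiv g v x)" for v
    by (auto simp: dderiv_add)
  with Suc show ?case by simp
qed (auto intro: continuous_intros)

lemma Ck_mult: "Ck n f \<Longrightarrow> Ck n g \<Longrightarrow> Ck n (\<lambda>x. f x * g x)"
proof (induction n arbitrary: f g)
  case (Suc n)
  then have "dderiv (\<lambda>x. f x * g x) v = (\<lambda>x. f x * dderiv g v x + dderiv f v x * g x)" for v
    by (auto simp: dderiv_mult)
  moreover have "Ck n f" "Ck n g" using Suc.prems Ck_SucD by blast+
  ultimately show ?case using Suc by (simp add: Ck_add)
qed (auto intro: continuous_intros)

lemma Ck_sum: "(\<And>i. i \<in> A \<Longrightarrow> Ck n (f i)) \<Longrightarrow> Ck n (\<lambda>x. \<Sum>i\<in>A. f i x)"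
  by (induction A rule: infinite_finite_induct) (auto intro: Ck_const Ck_add)

text \<open>Chain rule in coordinates: a derivative of the composite is a finite sum of derivatives
  of the components of \<open>g\<close> times partial derivatives of \<open>F\<close> composed with
  the same \<open>g\<close>. Hence only \<open>F\<close> varies in the induction, and
  \<open>g\<close> merely drops one order.\<close>

lemma Ck_compose:
  fixes g :: "'a::real_normed_vector \<Rightarrow> 'b::euclidean_space"
  assumes "Ck n F" "\<And>b. b \<in> Basis \<Longrightarrow> Ck n (\<lambda>x. g x \<bullet> b)"
  shows "Ck n (\<lambda>x. F (g x))"
  using assms
proof (induction n arbitrary: F)
  case 0
  then have "continuous_on UNIV g"
    by (subst continuous_on_componentwise) auto
  with 0 show ?case by (auto intro: continuous_on_compose2)
next
  case (Suc n)
  have g: "(g has_derivative (\<lambda>v. \<Sum>b\<in>Basis. dderiv (\<lambda>x. g x \<bullet> b) v x *\<^sub>R b)) (at x)" for x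
    using Suc.prems(2)
    by (subst has_derivative_componentwise_within) (auto intro: differentiable_has_dderiv)
  have F: "(F has_derivative (\<lambda>v. dderiv F v x)) (at x)" for x
    using Suc.prems(1) by (auto intro: differentiable_has_dderiv)
  have FG: "((\<lambda>x. F (g x)) has_derivative
       (\<lambda>v. dderiv F (\<Sum>b\<in>Basis. dderiv (\<lambda>x. g x \<bullet> b) v x *\<^sub>R b) (g x))) (at x)" for x
    by (rule has_derivative_compose[OF g F])
  have *: "dderiv F (\<Sum>b\<in>Basis. dderiv (\<lambda>x. g x \<bullet> b) v x *\<^sub>R b) (g x) =
     (\<Sum>b\<in>Basis. dderiv (\<lambda>x. g x \<bullet> b) v x * dderiv F b (g x))" for v x
    using linear_sum[OF has_derivative_linear[OF F[of "g x"]], of "\<lambda>b. dderiv (\<lambda>x. g x \<bullet> b) v x *\<^sub>R b" Basis]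
      linear_scale[OF has_derivative_linear[OF F[of "g x"]]] by simp
  have "dderiv (\<lambda>x. F (g x)) v = (\<lambda>x. \<Sum>b\<in>Basis. dderiv (\<lambda>x. g x \<bullet> b) v x * dderiv F b (g x))" for v
    by (rule ext) (rule trans[OF dderiv_eqI[OF FG] *])
  moreover have "Ck n (\<lambda>x. \<Sum>b\<in>Basis. dderiv (\<lambda>x. g x \<bullet> b) v x * dderiv F b (g x))" for v
  proof (intro Ck_sum Ck_mult)
    fix b :: 'b assume b: "b \<in> Basis"
    show "Ck n (dderiv (\<lambda>x. g x \<bullet> b) v)" using Suc.prems(2)[OF b] by simp
    show "Ck n (\<lambda>x. dderiv F b (g x))"
    proof (rule Suc.IH[of "dderiv F b"])
      show "Ck n (dderiv F b)" using Suc.prems(1) by simp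
      show "Ck n (\<lambda>x. g x \<bullet> c)" if "c \<in> Basis" for c using Suc.prems(2)[OF that] by (rule Ck_SucD)
    qed
  qed
  ultimately have "Ck n (dderiv (\<lambda>x. F (g x)) v)" for v by presburger
  moreover have "(\<lambda>x. F (g x)) differentiable (at x)" for x
    using FG unfolding differentiable_def by blast
  ultimately show ?case by simp
qed

lemma dderiv_powr:
  assumes "f differentiable (at x)" "f x > 0"
  shows "dderiv (\<lambda>x. f x powr a) v x = a * (f x powr (a - 1) * dderiv f v x)"
    and "(\<lambda>x. f x powr a) differentiable (at x)"
proof -
  have "((\<lambda>x. f x powr a) has_derivative (\<lambda>v. dderiv f v x * (a * f x powr (a - 1)))) (at x)"
    by (rule has_derivative_compose[where f=f and g="\<lambda>z. z powr a",
          OF differentiable_has_dderiv[OF assms(1)],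
          OF has_real_derivative_powr[OF assms(2), unfolded has_field_derivative_def, THEN has_derivative_eq_rhs]])
       (simp add: mult.commute fun_eq_iff)
  then show "dderiv (\<lambda>x. f x powr a) v x = a * (f x powr (a - 1) * dderiv f v x)"
    "(\<lambda>x. f x powr a) differentiable (at x)"
    by (auto simp: differentiable_def dderiv_eqI)
qed

lemma Ck_powr: "Ck n f \<Longrightarrow> (\<And>x. f x > 0) \<Longrightarrow> Ck n (\<lambda>x. f x powr a)"
proof (induction n arbitrary: a)
  case 0
  then show ?case by (auto intro!: continuous_intros simp: less_imp_neq[symmetric])
next
  case (Suc n)
  then have "dderiv (\<lambda>x. f x powr a) v = (\<lambda>x. a * (f x powr (a - 1) * dderiv f v x))" for v
    by (auto simp: dderiv_powr)
  moreover have "Ck n f" using Suc.prems Ck_SucD by blast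
  ultimately show ?case using Suc by (auto intro!: Ck_mult Ck_const dderiv_powr)
qed

lemma Ck_linear:
  assumes "bounded_linear f"
  shows "Ck n f"
proof (cases n)
  case 0
  then show ?thesis using assms by (simp add: linear_continuous_on)
next
  case (Suc m)
  have "(f has_derivative f) (at x)" for x using assms by (rule bounded_linear_imp_has_derivative)
  then have "dderiv f v = (\<lambda>x. f v)" for v by (auto intro: dderiv_eqI)
  then show ?thesis using Suc assms by (auto simp: Ck_const bounded_linear_imp_differentiable)
qed

section \<open>Closure properties of smooth functions and the second-derivative test\<close>

lemma smooth_fun_const: "smooth_fun (\<lambda>x. c)"
  by (simp add: smooth_fun_iff_Ck Ck_const)

lemma smooth_fun_add: "smooth_fun f \<Longrightarrow> smooth_fun g \<Longrightarrow> smooth_fun (\<lambda>x. f x + g x)"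
  by (simp add: smooth_fun_iff_Ck Ck_add)

lemma smooth_fun_mult: "smooth_fun f \<Longrightarrow> smooth_fun g \<Longrightarrow> smooth_fun (\<lambda>x. f x * g x)"
  by (simp add: smooth_fun_iff_Ck Ck_mult)

lemma smooth_fun_minus: "smooth_fun f \<Longrightarrow> smooth_fun (\<lambda>x. - f x)"
  using smooth_fun_mult[OF smooth_fun_const[of "-1"], of f] by simp

lemma smooth_fun_diff: "smooth_fun f \<Longrightarrow> smooth_fun g \<Longrightarrow> smooth_fun (\<lambda>x. f x - g x)"
  using smooth_fun_add[of f, OF _ smooth_fun_minus[of g]] by simp

lemma smooth_fun_sum: "(\<And>i. i \<in> A \<Longrightarrow> smooth_fun (f i)) \<Longrightarrow> smooth_fun (\<lambda>x. \<Sum>i\<in>A. f i x)"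
  by (simp add: smooth_fun_iff_Ck Ck_sum)

lemma smooth_fun_compose:
  fixes g :: "'a::real_normed_vector \<Rightarrow> 'b::euclidean_space"
  shows "smooth_fun F \<Longrightarrow> (\<And>b. b \<in> Basis \<Longrightarrow> smooth_fun (\<lambda>x. g x \<bullet> b)) \<Longrightarrow> smooth_fun (\<lambda>x. F (g x))"
  by (simp add: smooth_fun_iff_Ck Ck_compose)

lemma smooth_fun_powr: "smooth_fun f \<Longrightarrow> (\<And>x. f x > 0) \<Longrightarrow> smooth_fun (\<lambda>x. f x powr a)"
  by (simp add: smooth_fun_iff_Ck Ck_powr)

lemma smooth_fun_linear: "bounded_linear f \<Longrightarrow> smooth_fun f"
  by (simp add: smooth_fun_iff_Ck Ck_linear)

text \<open>Differentiating \<open>f (x + t w + s v) - f (x + s v) = \<integral>\<^sub>0\<^sup>t \<partial>\<^sub>w f\<close> in \<open>s\<close> under the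
  integral and then in \<open>t\<close> exchanges the two derivatives.\<close>

lemma dderiv_commute:
  fixes f :: "'a::real_normed_vector \<Rightarrow> real"
  assumes "smooth_fun f"
  shows "dderiv (dderiv f v) w x = dderiv (dderiv f w) v x"
proof -
  let ?D = "dderiv (dderiv f w) v"
  have sm: "smooth_fun (dderiv f w)" "smooth_fun ?D" "smooth_fun (dderiv f v)"
    using assms by (auto intro: smooth_fun_dderiv)
  have F: "f (x + s *\<^sub>R v + t *\<^sub>R w) - f (x + s *\<^sub>R v) =
     integral {0..t} (\<lambda>\<tau>. dderiv f w (x + s *\<^sub>R v + \<tau> *\<^sub>R w))" if "t \<ge> 0" for s t
  proof -
    have "((\<lambda>\<tau>. dderiv f w (x + s *\<^sub>R v + \<tau> *\<^sub>R w)) has_integral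
      (f (x + s *\<^sub>R v + t *\<^sub>R w) - f (x + s *\<^sub>R v + 0 *\<^sub>R w))) {0..t}"
      by (rule fundamental_theorem_of_calculus[OF that])
        (auto intro: has_field_derivative_at_within[OF smooth_fun_DERIV_line[OF assms]]
            simp: has_real_derivative_iff_has_vector_derivative[symmetric])
    then show ?thesis by (simp add: integral_unique)
  qed
  have D: "dderiv f v (x + t *\<^sub>R w) - dderiv f v x = integral {0..t} (\<lambda>\<tau>. ?D (x + \<tau> *\<^sub>R w))"
    if "t \<ge> 0" for t
  proof -
    have "((\<lambda>s. integral (cbox 0 t) (\<lambda>\<tau>. dderiv f w (x + s *\<^sub>R v + \<tau> *\<^sub>R w)))
      has_field_derivative integral (cbox 0 t) (\<lambda>\<tau>. ?D (x + 0 *\<^sub>R v + \<tau> *\<^sub>R w))) (at 0 within UNIV)"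
    proof (rule leibniz_rule_field_derivative)
      show "((\<lambda>s. dderiv f w (x + s *\<^sub>R v + \<tau> *\<^sub>R w)) has_real_derivative
          ?D (x + s *\<^sub>R v + \<tau> *\<^sub>R w)) (at s within UNIV)" for s \<tau>
        using smooth_fun_DERIV_line[OF sm(1), of "x + \<tau> *\<^sub>R w" v s] by (simp add: algebra_simps)
      show "(\<lambda>\<tau>. dderiv f w (x + s *\<^sub>R v + \<tau> *\<^sub>R w)) integrable_on cbox 0 t" for s
        by (intro integrable_continuous continuous_on_compose2[OF smooth_continuous_on[OF sm(1), of UNIV]]
            continuous_intros) auto
      show "continuous_on (UNIV \<times> cbox 0 t) (\<lambda>(s, \<tau>). ?D (x + s *\<^sub>R v + \<tau> *\<^sub>R w))"
        unfolding split_def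
        by (intro continuous_on_compose2[OF smooth_continuous_on[OF sm(2), of UNIV]]
            continuous_intros) auto
    qed auto
    moreover have "((\<lambda>s. integral (cbox 0 t) (\<lambda>\<tau>. dderiv f w (x + s *\<^sub>R v + \<tau> *\<^sub>R w)))
      has_field_derivative dderiv f v (x + t *\<^sub>R w) - dderiv f v x) (at 0)"
    proof -
      have "((\<lambda>s. f (x + t *\<^sub>R w + s *\<^sub>R v) - f (x + s *\<^sub>R v)) has_field_derivative
        dderiv f v (x + t *\<^sub>R w + 0 *\<^sub>R v) - dderiv f v (x + 0 *\<^sub>R v)) (at 0)"
        by (intro DERIV_diff smooth_fun_DERIV_line assms)
      then show ?thesis using F[OF that] by (simp add: algebra_simps)
    qed
    ultimately show ?thesis using DERIV_unique by fastforce
  qed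
  \<comment> \<open>The integral formula is available for t \<ge> 0 only, so both derivatives at 0
    are taken within {0..1}; derivatives are still unique there.\<close>
  have cont: "continuous_on {0..1} (\<lambda>\<tau>. ?D (x + \<tau> *\<^sub>R w))"
    by (intro continuous_on_compose2[OF smooth_continuous_on[OF sm(2), of UNIV]]
            continuous_intros) auto
  have "((\<lambda>t. integral {0..t} (\<lambda>\<tau>. ?D (x + \<tau> *\<^sub>R w))) has_real_derivative ?D (x + 0 *\<^sub>R w)) (at 0 within {0..1})"
    by (rule integral_has_real_derivative[OF cont]) auto
  then have "((\<lambda>t. integral {0..t} (\<lambda>\<tau>. ?D (x + \<tau> *\<^sub>R w))) has_real_derivative ?D x) (at 0 within {0..1})"
    by simp
  then have 1: "((\<lambda>t. dderiv f v (x + t *\<^sub>R w) - dderiv f v x) has_real_derivative ?D x) (at 0 within {0..1})"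
    by (rule has_field_derivative_transform_within[where d=1]) (simp_all add: D)
  have "((\<lambda>t. dderiv f v (x + t *\<^sub>R w) - dderiv f v x) has_real_derivative
      dderiv (dderiv f v) w (x + 0 *\<^sub>R w) - 0) (at 0 within {0..1})"
    by (intro DERIV_diff DERIV_const has_field_derivative_at_within[OF smooth_fun_DERIV_line] sm)
  then have 2: "((\<lambda>t. dderiv f v (x + t *\<^sub>R w) - dderiv f v x) has_real_derivative
      dderiv (dderiv f v) w x) (at 0 within {0..1})"
    by simp
  have "at (0::real) within {0..1} \<noteq> bot"
    by (simp add: trivial_limit_within)
  then show ?thesis using has_field_derivative_unique[OF 2 1] by simp
qed

text \<open>If the second derivative at the minimum were negative, \<open>f'\<close> would be
  negative just to the right of 0, and the mean value theorem would give a value below f(0). It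
  serves three times: for the sign of the coupling, for the maximum principle and for the Hessian of
  a convex function.\<close>

lemma
  fixes f :: "real \<Rightarrow> real"
  assumes "\<And>s. (f has_real_derivative f' s) (at s)" "(f' has_real_derivative L) (at 0)"
    and "\<And>s. f 0 \<le> f s"
  shows second_derivative_at_min_nonneg: "L \<ge> 0" and derivative_at_min_eq_0: "f' 0 = 0"
proof -
  show f0: "f' 0 = 0"
    using DERIV_local_min[OF assms(1)[of 0], of 1] assms(3) by auto
  show "L \<ge> 0"
  proof (rule ccontr)
    assume "\<not> L \<ge> 0"
    then obtain d where d: "d > 0" "\<And>h. 0 < h \<Longrightarrow> h < d \<Longrightarrow> f' h < f' 0"
      using DERIV_neg_dec_right[OF assms(2)] by force
    have "\<exists>z. 0 < z \<and> z < d/2 \<and> f (d/2) - f 0 = (d/2 - 0) * f' z"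
      by (rule MVT2) (use d assms(1) in auto)
    then obtain z where z: "0 < z" "z < d/2" "f (d/2) - f 0 = (d/2) * f' z" by auto
    have "f' z < 0" using d(2)[of z] z f0 by linarith
    then have "(d/2) * f' z < 0" using d(1) by (simp add: mult_pos_neg)
    then show False using z assms(3)[of "d/2"] by linarith
  qed
qed

section \<open>Integration over the torus\<close>

lemma Zd_periodic_add: "Zd_periodic f \<Longrightarrow> (\<And>i. k $ i \<in> \<int>) \<Longrightarrow> f (x + k) = f x"
  by (auto simp: Zd_periodic_def)

lemma Zd_periodic_compose: "Zd_periodic f \<Longrightarrow> Zd_periodic (\<lambda>x. g (f x))"
  and Zd_periodic_compose2: "Zd_periodic f \<Longrightarrow> Zd_periodic f2 \<Longrightarrow> Zd_periodic (\<lambda>x. h (f x) (f2 x))"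
  by (auto simp: Zd_periodic_def)

lemma Zd_periodic_dderiv: "Zd_periodic f \<Longrightarrow> Zd_periodic (dderiv f v)"
proof -
  assume "Zd_periodic f"
  then have "f ((x + k) + s *\<^sub>R v) = f (x + s *\<^sub>R v)" if "\<forall>i. k $ i \<in> \<int>" for x k s
    using that unfolding Zd_periodic_def by (metis add.commute add.left_commute)
  then show ?thesis unfolding Zd_periodic_def dderiv_def by simp
qed

lemma Zd_periodic_translate: "Zd_periodic f \<Longrightarrow> Zd_periodic (\<lambda>x. f (x + v))"
  unfolding Zd_periodic_def by (metis add.commute add.left_commute)

lemma fundamental_domain:
  fixes x :: "real^'d"
  obtains y k where "y \<in> cbox 0 1" "\<And>i. k $ i \<in> \<int>" "x = y + k"
proof
  show "(\<chi> i. frac (x $ i)) \<in> cbox 0 (1::real^'d)"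
    by (auto simp: mem_box_cart frac_ge_0 less_imp_le[OF frac_lt_1])
  show "(\<chi> i. of_int \<lfloor>x $ i\<rfloor>) $ i \<in> \<int>" for i :: 'd by simp
  show "x = (\<chi> i. frac (x $ i)) + (\<chi> i. of_int \<lfloor>x $ i\<rfloor>)"
    by (simp add: vec_eq_iff frac_def)
qed

lemma Zd_periodic_bounded:
  fixes f :: "real^'d \<Rightarrow> real"
  assumes "Zd_periodic f" "continuous_on UNIV f"
  obtains B where "B > 0" "\<And>x. \<bar>f x\<bar> \<le> B"
proof -
  have "bounded (f ` cbox 0 1)"
    by (intro compact_imp_bounded compact_continuous_image continuous_on_subset[OF assms(2)]) auto
  then obtain B where B: "B > 0" "\<And>x. x \<in> cbox 0 1 \<Longrightarrow> \<bar>f x\<bar> \<le> B"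
    by (auto simp: bounded_pos)
  have "\<bar>f x\<bar> \<le> B" for x
    by (rule fundamental_domain[of x]) (use B Zd_periodic_add[OF assms(1)] in auto)
  with B that show thesis by blast
qed

lemma torus_integrable: "continuous_on UNIV f \<Longrightarrow> f integrable_on cbox 0 1"
  for f :: "real^'d \<Rightarrow> real"
  by (meson continuous_on_subset integrable_continuous subset_UNIV)

lemma torus_integral_add: "continuous_on UNIV f \<Longrightarrow> continuous_on UNIV g \<Longrightarrow>
    torus_integral (\<lambda>x. f x + g x) = torus_integral f + torus_integral g"
  and torus_integral_diff: "continuous_on UNIV f \<Longrightarrow> continuous_on UNIV g \<Longrightarrow>
    torus_integral (\<lambda>x. f x - g x) = torus_integral f - torus_integral g"
  and torus_integral_mono: "continuous_on UNIV f \<Longrightarrow> continuous_on UNIV g \<Longrightarrow>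
    (\<And>x. f x \<le> g x) \<Longrightarrow> torus_integral f \<le> torus_integral g"
  unfolding torus_integral_def
  by (auto intro!: integral_add integral_diff integral_le torus_integrable)

lemma torus_integral_cmult: "torus_integral (\<lambda>x. c * f x) = c * torus_integral f"
  and torus_integral_minus: "torus_integral (\<lambda>x. - f x) = - torus_integral f"
  unfolding torus_integral_def by auto

lemma torus_integral_const: "torus_integral (\<lambda>x::real^'d. c) = c"
proof -
  have "cbox 0 (1::real^'d) \<noteq> {}" by (auto simp: interval_ne_empty_cart)
  then show ?thesis unfolding torus_integral_def by (simp add: content_cbox_cart)
qed

lemma torus_integral_nonneg: "continuous_on UNIV f \<Longrightarrow> (\<And>x. f x \<ge> 0) \<Longrightarrow> torus_integral f \<ge> 0"
  using torus_integral_mono[of "\<lambda>x. 0" f] by (simp add: torus_integral_const)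

lemma torus_integral_sum:
  "(\<And>i. i \<in> A \<Longrightarrow> continuous_on UNIV (f i)) \<Longrightarrow>
    torus_integral (\<lambda>x. \<Sum>i\<in>A. f i x) = (\<Sum>i\<in>A. torus_integral (f i))"
proof (induction A rule: infinite_finite_induct)
  case (insert i A)
  then have "torus_integral (\<lambda>x. f i x + (\<Sum>i\<in>A. f i x)) = torus_integral (f i) + torus_integral (\<lambda>x. \<Sum>i\<in>A. f i x)"
    by (intro torus_integral_add continuous_on_sum) auto
  with insert show ?case by simp
qed (auto simp: torus_integral_const)

text \<open>The slab \<open>0 \<le> x\<^sub>i \<le> 1 + s\<close> is cut at \<open>x\<^sub>i = 1\<close> and at \<open>x\<^sub>i = s\<close>; the two short pieces are
  integer translates of each other.\<close>

lemma torus_integral_translate_axis_unit: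
  fixes f :: "real^'d \<Rightarrow> real"
  assumes per: "Zd_periodic f" and cont: "continuous_on UNIV f" and s: "0 \<le> s" "s \<le> 1"
  shows "torus_integral (\<lambda>x. f (x + s *\<^sub>R axis i 1)) = torus_integral f"
proof -
  let ?e = "axis i 1 :: real^'d"
  let ?B = "cbox 0 (1 + s *\<^sub>R ?e)"
  have intg: "f integrable_on cbox a b" for a b
    by (intro integrable_continuous continuous_on_subset[OF cont]) auto
  have e: "?e \<in> Basis" by (simp add: axis_in_Basis_iff)
  have split: "integral ?B f =
     integral (?B \<inter> {x. x \<bullet> ?e \<le> c}) f +
     integral (?B \<inter> {x. x \<bullet> ?e \<ge> c}) f" for c
    by (rule integral_split[OF intg e])
  have comp: "(c + r *\<^sub>R ?e) $ j = c $ j + (if j = i then r else 0)" "?e $ j = (if j = i then 1 else 0)"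
    for c :: "real^'d" and r j by (auto simp: axis_def)
  have iff: "x \<in> cbox (0 + r *\<^sub>R ?e) (1 + q *\<^sub>R ?e) \<longleftrightarrow> (\<forall>j. j \<noteq> i \<longrightarrow> 0 \<le> x $ j \<and> x $ j \<le> 1) \<and> r \<le> x $ i \<and> x $ i \<le> 1 + q"
    for x r q unfolding mem_box_cart comp by auto
  have e1[simp]: "1 + (s - 1) *\<^sub>R ?e + ?e = 1 + s *\<^sub>R ?e" by (simp add: algebra_simps)
  have inner: "x \<bullet> ?e = x $ i" for x by (simp add: inner_axis)
  have zero: "x \<in> cbox 0 (1 + q *\<^sub>R ?e) \<longleftrightarrow> x \<in> cbox (0 + 0 *\<^sub>R ?e) (1 + q *\<^sub>R ?e)"
    "x \<in> cbox 0 1 \<longleftrightarrow> x \<in> cbox (0 + 0 *\<^sub>R ?e) (1 + 0 *\<^sub>R ?e)"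
    "x \<in> cbox ?e (1 + q *\<^sub>R ?e) \<longleftrightarrow> x \<in> cbox (0 + 1 *\<^sub>R ?e) (1 + q *\<^sub>R ?e)" for x q by simp_all
  have eq1: "?B \<inter> {x. x \<bullet> ?e \<le> 1} = cbox 0 1"
    unfolding set_eq_iff Int_iff mem_Collect_eq inner zero iff using s by auto
  have eq2: "?B \<inter> {x. x \<bullet> ?e \<ge> 1} = cbox (0 + ?e) (1 + (s - 1) *\<^sub>R ?e + ?e)"
    unfolding set_eq_iff Int_iff mem_Collect_eq inner add_0 e1 zero iff[unfolded add_0]
    using s by auto
  have eq3: "?B \<inter> {x. x \<bullet> ?e \<le> s} = cbox 0 (1 + (s - 1) *\<^sub>R ?e)"
    unfolding set_eq_iff Int_iff mem_Collect_eq inner zero iff using s by auto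
  have eq4: "?B \<inter> {x. x \<bullet> ?e \<ge> s} = cbox (0 + s *\<^sub>R ?e) (1 + s *\<^sub>R ?e)"
    unfolding set_eq_iff Int_iff mem_Collect_eq inner iff zero(1) using s by auto
  have f1: "f (x + ?e) = f x" for x
    by (rule Zd_periodic_add[OF per]) (auto simp: axis_def)
  have "integral (cbox (0 + ?e) (1 + (s - 1) *\<^sub>R ?e + ?e)) f = integral (cbox 0 (1 + (s - 1) *\<^sub>R ?e)) f"
    using integral_shift_cbox_plus[of 0 "1 + (s - 1) *\<^sub>R ?e" f ?e] by (simp add: f1 o_def add.commute[of ?e])
  moreover have "integral (cbox (0 + s *\<^sub>R ?e) (1 + s *\<^sub>R ?e)) f = torus_integral (\<lambda>x. f (x + s *\<^sub>R ?e))"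
    using integral_shift_cbox_plus[of 0 1 f "s *\<^sub>R ?e"] by (simp add: torus_integral_def o_def add.commute[of "s *\<^sub>R ?e"])
  ultimately show ?thesis
    using split[of 1] split[of s] unfolding eq1 eq2 eq3 eq4 by (simp add: torus_integral_def)
qed

text \<open>A translation is a composition of translations along the axes, and on an axis the
  integer part of the shift disappears by periodicity, so shifts between 0 and 1 along one axis
  suffice.\<close>

lemma torus_integral_translate:
  fixes f :: "real^'d \<Rightarrow> real"
  assumes per: "Zd_periodic f" and cont: "continuous_on UNIV f"
  shows "torus_integral (\<lambda>x. f (x + v)) = torus_integral f"
proof -
  have ax: "torus_integral (\<lambda>x. g (x + s *\<^sub>R axis i 1)) = torus_integral g"
    if "Zd_periodic g" "continuous_on UNIV g" for g :: "real^'d \<Rightarrow> real" and s i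
  proof -
    have "g (x + s *\<^sub>R axis i 1) = g (x + frac s *\<^sub>R axis i 1)" for x
    proof -
      have "g (x + frac s *\<^sub>R axis i 1 + of_int \<lfloor>s\<rfloor> *\<^sub>R axis i 1) = g (x + frac s *\<^sub>R axis i 1)"
        by (rule Zd_periodic_add[OF that(1)]) (auto simp: axis_def)
      then show ?thesis by (simp add: frac_def algebra_simps)
    qed
    then show ?thesis
      using torus_integral_translate_axis_unit[OF that, of "frac s" i]
      by (simp add: frac_ge_0 less_imp_le[OF frac_lt_1])
  qed
  have "torus_integral (\<lambda>x. f (x + (\<Sum>i\<in>A. (v $ i) *\<^sub>R axis i 1))) = torus_integral f" for A :: "'d set"
  proof (induction A rule: infinite_finite_induct)
    case (insert j A)
    let ?g = "\<lambda>x. f (x + (\<Sum>i\<in>A. (v $ i) *\<^sub>R axis i 1))"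
    have "torus_integral (\<lambda>x. ?g (x + (v $ j) *\<^sub>R axis j 1)) = torus_integral ?g"
      by (rule ax) (auto intro!: Zd_periodic_translate per continuous_on_compose2[OF cont] continuous_intros)
    with insert show ?case by (simp add: algebra_simps)
  qed auto
  from this[of UNIV] show ?thesis
    by (simp add: basis_expansion[of v, unfolded scalar_mult_eq_scaleR])
qed

section \<open>Parameter integrals and integration by parts\<close>

lemma DERIV_torus_integral:
  fixes f :: "real \<Rightarrow> real^'d \<Rightarrow> real"
  assumes "\<And>s x. s \<in> U \<Longrightarrow> ((\<lambda>s. f s x) has_real_derivative f' s x) (at s within U)"
    and "\<And>s. s \<in> U \<Longrightarrow> continuous_on UNIV (f s)"
    and "continuous_on (U \<times> UNIV) (\<lambda>(s, x). f' s x)" and "convex U" "s0 \<in> U"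
  shows "((\<lambda>s. torus_integral (f s)) has_real_derivative torus_integral (f' s0)) (at s0 within U)"
  unfolding torus_integral_def
  using assms by (intro leibniz_rule_field_derivative)
    (auto intro: torus_integrable continuous_on_subset)

lemma continuous_on_torus_integral:
  fixes f :: "'c::topological_space \<Rightarrow> real^'d \<Rightarrow> real"
  assumes "continuous_on (U \<times> UNIV) (\<lambda>(s, x). f s x)"
  shows "continuous_on U (\<lambda>s. torus_integral (f s))"
  unfolding torus_integral_def
  by (rule integral_continuous_on_param, rule continuous_on_subset[OF assms]) auto

text \<open>This is the derivative at s = 0 of the integral of f(x + s v), which does not depend on
  s. No iterated integrals and no boundary terms occur.\<close>

lemma torus_integral_dderiv:
  fixes f :: "real^'d \<Rightarrow> real"
  assumes "smooth_fun f" "Zd_periodic f"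
  shows "torus_integral (dderiv f v) = 0"
proof -
  have "((\<lambda>s. torus_integral (\<lambda>x. f (x + s *\<^sub>R v))) has_real_derivative
     torus_integral (\<lambda>x. dderiv f v (x + 0 *\<^sub>R v))) (at 0 within UNIV)"
  proof (rule DERIV_torus_integral)
    show "continuous_on (UNIV \<times> UNIV) (\<lambda>(s, x). dderiv f v (x + s *\<^sub>R v))"
      unfolding split_def
      by (intro continuous_on_compose2[OF smooth_continuous_on[of "dderiv f v" UNIV]] continuous_intros
          smooth_fun_dderiv assms) auto
    show "continuous_on UNIV (\<lambda>x. f (x + s *\<^sub>R v))" for s
      by (intro continuous_on_compose2[OF smooth_continuous_on[of f UNIV]] continuous_intros assms) auto
  qed (use smooth_fun_DERIV_line[OF assms(1)] in auto)
  moreover have "torus_integral (\<lambda>x. f (x + s *\<^sub>R v)) = torus_integral f" for s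
    by (rule torus_integral_translate[OF assms(2) smooth_continuous_on[OF assms(1)]])
  ultimately have "((\<lambda>s. torus_integral f) has_real_derivative torus_integral (dderiv f v)) (at 0)"
    by simp
  then show ?thesis using DERIV_unique[OF _ DERIV_const] by blast
qed

lemma torus_integral_by_parts:
  fixes f g :: "real^'d \<Rightarrow> real"
  assumes "smooth_fun f" "Zd_periodic f" "smooth_fun g" "Zd_periodic g"
  shows "torus_integral (\<lambda>x. f x * dderiv g v x) = - torus_integral (\<lambda>x. dderiv f v x * g x)"
proof -
  have "dderiv (\<lambda>x. f x * g x) v = (\<lambda>x. f x * dderiv g v x + dderiv f v x * g x)"
    using assms by (auto simp: dderiv_mult smooth_fun_differentiable)
  then have "0 = torus_integral (\<lambda>x. f x * dderiv g v x + dderiv f v x * g x)"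
    using torus_integral_dderiv[of "\<lambda>x. f x * g x" v] assms smooth_fun_mult Zd_periodic_compose2 by metis
  also have "\<dots> = torus_integral (\<lambda>x. f x * dderiv g v x) + torus_integral (\<lambda>x. dderiv f v x * g x)"
    by (intro torus_integral_add smooth_continuous_on smooth_fun_mult smooth_fun_dderiv assms)
  finally show ?thesis by simp
qed

section \<open>Convolution\<close>

lemma conv_eq_integral_cbox:
  fixes k f :: "real^'d \<Rightarrow> real"
  assumes "\<And>y. y \<notin> cbox (-a) a \<Longrightarrow> k y = 0"
  shows "conv k f x = integral (cbox (-a) a) (\<lambda>y. k y * f (x - y))"
proof -
  have "(\<lambda>y. k y * f (x - y)) = (\<lambda>y. if y \<in> cbox (-a) a then k y * f (x - y) else 0)"
    using assms by auto
  then show ?thesis unfolding conv_def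
    using integral_restrict_UNIV[of "cbox (-a) a" "\<lambda>y. k y * f (x - y)"] by simp
qed

lemma Zd_periodic_conv: "Zd_periodic f \<Longrightarrow> Zd_periodic (conv k f)"
proof -
  assume "Zd_periodic f"
  then have "f (x + k' - y) = f (x - y)" if "\<forall>i. k' $ i \<in> \<int>" for x k' y
    using that unfolding Zd_periodic_def by (metis add_diff_eq diff_add_eq)
  then show ?thesis unfolding Zd_periodic_def conv_def by simp
qed

lemma conv_translate: "conv k (\<lambda>x. f (x + v)) x = conv k f (x + v)"
  unfolding conv_def by (simp add: algebra_simps)

text \<open>Support in a compact box turns convolutions into integrals of continuous functions over
  a box, where integrals can be swapped and parameter integrals are continuous. The box is not
  compared with the period cell, so that every \<epsilon> > 0 is covered.\<close>

locale even_kernel =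
  fixes k :: "real^'d \<Rightarrow> real" and a :: "real^'d"
  assumes kernel_continuous: "continuous_on UNIV k"
    and kernel_support: "\<And>y. y \<notin> cbox (-a) a \<Longrightarrow> k y = 0"
    and kernel_even: "\<And>y. k (- y) = k y"
    and kernel_nonneg: "\<And>y. k y \<ge> 0"
    and kernel_mass: "(k has_integral 1) (cbox (-a) a)"
begin

lemma conv_box: "conv k f x = integral (cbox (-a) a) (\<lambda>y. k y * f (x - y))"
  by (rule conv_eq_integral_cbox) (rule kernel_support)

lemma continuous_on_conv:
  assumes "continuous_on UNIV f" shows "continuous_on S (conv k f)"
proof -
  have "continuous_on S (\<lambda>x. integral (cbox (-a) a) (\<lambda>y. k y * f (x - y)))"
    by (rule integral_continuous_on_param)
      (auto simp: split_def intro!: continuous_intros continuous_on_compose2[OF assms]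
         continuous_on_compose2[OF kernel_continuous])
  then show ?thesis by (simp add: conv_box[abs_def])
qed

lemma kernel_mult_integrable:
  assumes "continuous_on UNIV f"
  shows "(\<lambda>y. k y * f (x - y)) integrable_on cbox (-a) a"
  by (intro integrable_continuous continuous_on_mult continuous_on_subset[OF kernel_continuous]
      continuous_on_compose2[OF assms] continuous_intros) auto

lemma conv_mono:
  assumes "continuous_on UNIV f" "continuous_on UNIV g" "\<And>x. f x \<le> g x"
  shows "conv k f x \<le> conv k g x"
  unfolding conv_box
  by (intro integral_le kernel_mult_integrable assms mult_left_mono kernel_nonneg)

lemma conv_const: "conv k (\<lambda>x. c) x = c"
  unfolding conv_box using integral_unique[OF kernel_mass] by simp

lemma conv_nonneg: "continuous_on UNIV f \<Longrightarrow> (\<And>x. f x \<ge> 0) \<Longrightarrow> conv k f x \<ge> 0"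
  using conv_mono[of "\<lambda>x. 0" f x] by (simp add: conv_const)

lemma conv_linear:
  assumes "continuous_on UNIV f" "continuous_on UNIV g"
  shows "conv k (\<lambda>x. f x - c * g x) x = conv k f x - c * conv k g x"
proof -
  have "integral (cbox (-a) a) (\<lambda>y. k y * f (x - y) - c * (k y * g (x - y))) =
    conv k f x - c * conv k g x"
    unfolding conv_box by (subst integral_diff) (auto intro!: kernel_mult_integrable assms integrable_on_mult_right)
  then show ?thesis unfolding conv_box by (simp add: algebra_simps)
qed

text \<open>Swap the integrals, translate x by y in the inner one, and swap back; evenness of
  \<open>k\<close> turns the resulting integral of k(y) \<psi>(x + y) into a convolution
  again.\<close>

lemma torus_integral_conv_adjoint:
  assumes F: "Zd_periodic F" "continuous_on UNIV F" and \<psi>: "Zd_periodic \<psi>" "continuous_on UNIV \<psi>"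
  shows "torus_integral (\<lambda>x. conv k F x * \<psi> x) = torus_integral (\<lambda>x. F x * conv k \<psi> x)"
proof -
  let ?K = "cbox (-a) a"
  have refl: "conv k \<psi> x = integral ?K (\<lambda>y. k y * \<psi> (x + y))" for x
    using integral_reflect[of a "-a" "\<lambda>y. k y * \<psi> (x + y)"] by (simp add: conv_box kernel_even)
  note [continuous_intros] = continuous_on_compose2[OF F(2), of _ "\<lambda>z. fst z - snd z"]
    continuous_on_compose2[OF F(2), of _ fst]
    continuous_on_compose2[OF \<psi>(2), of _ fst] continuous_on_compose2[OF \<psi>(2), of _ "\<lambda>z. fst z + snd z"]
    continuous_on_compose2[OF kernel_continuous, of _ snd]
  have "torus_integral (\<lambda>x. conv k F x * \<psi> x) =
     integral (cbox 0 1) (\<lambda>x. integral ?K (\<lambda>y. k y * F (x - y) * \<psi> x))"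
    unfolding torus_integral_def conv_box by simp
  also have "\<dots> = integral ?K (\<lambda>y. integral (cbox 0 1) (\<lambda>x. k y * F (x - y) * \<psi> x))"
    by (rule integral_swap_continuous) (auto simp: split_def intro!: continuous_intros)
  also have "\<dots> = integral ?K (\<lambda>y. integral (cbox 0 1) (\<lambda>x. F x * (k y * \<psi> (x + y))))"
  proof (rule integral_cong)
    fix y
    have "torus_integral (\<lambda>x. k y * F ((x + y) - y) * \<psi> (x + y)) = torus_integral (\<lambda>x. k y * F (x - y) * \<psi> x)"
      using Zd_periodic_translate[OF F(1), of "-y"] \<psi>(1)
      by (intro torus_integral_translate) (auto simp: Zd_periodic_def
           intro!: continuous_intros continuous_on_compose2[OF F(2)] \<psi>(2))
    then show "integral (cbox 0 1) (\<lambda>x. k y * F (x - y) * \<psi> x) = integral (cbox 0 1) (\<lambda>x. F x * (k y * \<psi> (x + y)))"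
      by (simp add: torus_integral_def algebra_simps)
  qed
  also have "\<dots> = integral (cbox 0 1) (\<lambda>x. integral ?K (\<lambda>y. F x * (k y * \<psi> (x + y))))"
    by (rule integral_swap_continuous[symmetric]) (auto simp: split_def intro!: continuous_intros)
  also have "\<dots> = torus_integral (\<lambda>x. F x * conv k \<psi> x)"
    unfolding torus_integral_def refl by simp
  finally show ?thesis .
qed

text \<open>\<open>h \<mapsto> \<integral> G (m(x + h e) + m(x - h e))\<close> is maximal at \<open>h = 0\<close>: by adjointness its increment is
  \<open>- \<integral> (F(z(x)) - F(z(x + h e))) (z(x) - z(x + h e))\<close> with \<open>z = k * m\<close>.\<close>

lemma torus_integral_conv_second_derivative_nonpos:
  assumes m: "smooth_fun m" "Zd_periodic m" "\<And>x. m x \<ge> 0"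
    and F: "continuous_on {0..} F" "mono_on {0..} (F :: real \<Rightarrow> real)"
  defines "G \<equiv> conv k (\<lambda>x. F (conv k m x))"
  shows "torus_integral (\<lambda>x. G x * dderiv (dderiv m e) e x) \<le> 0"
proof -
  have mc: "continuous_on UNIV m" using m(1) by (rule smooth_continuous_on)
  define z where "z = conv k m"
  define f where "f = (\<lambda>x. F (z x))"
  have zc: "continuous_on UNIV z" unfolding z_def by (rule continuous_on_conv[OF mc])
  have zp: "Zd_periodic z" unfolding z_def by (rule Zd_periodic_conv[OF m(2)])
  have z0: "z x \<ge> 0" for x unfolding z_def by (rule conv_nonneg[OF mc m(3)])
  have fc: "continuous_on UNIV f"
    unfolding f_def by (rule continuous_on_compose2[OF F(1) zc]) (use z0 in auto)
  have fp: "Zd_periodic f" unfolding f_def by (rule Zd_periodic_compose[OF zp])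
  have Gf: "G = conv k f" unfolding G_def f_def z_def ..
  have Gc: "continuous_on UNIV G" unfolding Gf by (rule continuous_on_conv[OF fc])
  have shift: "continuous_on UNIV (\<lambda>x. g (x + v))" if "continuous_on UNIV g" for g :: "real^'d \<Rightarrow> real" and v
    by (intro continuous_on_compose2[OF that] continuous_intros) auto
  have G_shift: "torus_integral (\<lambda>x. G x * m (x + v)) = torus_integral (\<lambda>x. f x * z (x + v))" for v
    using torus_integral_conv_adjoint[OF fp fc Zd_periodic_translate[OF m(2), of v] shift[OF mc, of v]]
    unfolding Gf z_def conv_translate .
  have move: "torus_integral (\<lambda>x. f (x + v) * z (x + v - w)) = torus_integral (\<lambda>x. f x * z (x - w))" for v w
    using torus_integral_translate[of "\<lambda>x. f x * z (x - w)" v]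
      Zd_periodic_compose2[OF fp Zd_periodic_translate[OF zp, of "-w"], of "(*)"]
      continuous_on_mult[OF fc shift[OF zc, of "-w"]] by simp
  \<comment> \<open>The shifts act on \<open>m\<close> alone, so \<open>F\<close> is never
    differentiated; for z^\<alpha> with \<alpha> < 1 it has no derivative at 0. The minus sign turns
    the maximum at s = 0 into a minimum.\<close>
  define \<phi> where "\<phi> s = - (torus_integral (\<lambda>x. G x * m (x + s *\<^sub>R e)) + torus_integral (\<lambda>x. G x * m (x - s *\<^sub>R e)))" for s
  have "\<phi> 0 \<le> \<phi> s" for s
  proof -
    let ?v = "s *\<^sub>R e"
    have "0 \<le> torus_integral (\<lambda>x. (f x - f (x + ?v)) * (z x - z (x + ?v)))"
    proof (rule torus_integral_nonneg)
      show "0 \<le> (f x - f (x + ?v)) * (z x - z (x + ?v))" for x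
        using mono_onD[OF F(2), of "z x" "z (x + ?v)"] mono_onD[OF F(2), of "z (x + ?v)" "z x"] z0
        by (cases "z x \<le> z (x + ?v)") (auto simp: f_def zero_le_mult_iff)
    qed (intro continuous_intros shift fc zc)
    also have "\<dots> = torus_integral (\<lambda>x. ((f x * z x - f x * z (x + ?v)) + f (x + ?v) * z (x + ?v)) - f (x + ?v) * z x)"
      by (simp add: algebra_simps)
    also have "\<dots> = torus_integral (\<lambda>x. f x * z x) - torus_integral (\<lambda>x. f x * z (x + ?v))
       + torus_integral (\<lambda>x. f (x + ?v) * z (x + ?v)) - torus_integral (\<lambda>x. f (x + ?v) * z x)"
      by (subst torus_integral_diff torus_integral_add; (intro continuous_intros shift fc zc)?)+ (rule refl)
    also have "torus_integral (\<lambda>x. f (x + ?v) * z (x + ?v)) = torus_integral (\<lambda>x. f x * z x)"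
      using move[of ?v 0] by simp
    also have "torus_integral (\<lambda>x. f (x + ?v) * z x) = torus_integral (\<lambda>x. f x * z (x - ?v))"
      using move[of ?v ?v] by simp
    finally show ?thesis
      using G_shift[of 0] G_shift[of ?v] G_shift[of "- ?v"] unfolding \<phi>_def by simp
  qed
  moreover define \<phi>' where "\<phi>' s = - (torus_integral (\<lambda>x. G x * dderiv m e (x + s *\<^sub>R e))
      - torus_integral (\<lambda>x. G x * dderiv m e (x - s *\<^sub>R e)))" for s
  have DER: "((\<lambda>s. torus_integral (\<lambda>x. G x * h (x + (c * s) *\<^sub>R e))) has_real_derivative
      torus_integral (\<lambda>x. G x * (c * dderiv h e (x + (c * s) *\<^sub>R e)))) (at s)"
    if h: "smooth_fun h" for h s c
  proof (rule DERIV_torus_integral)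
    have "((\<lambda>s. h (x + (c * s) *\<^sub>R e)) has_real_derivative dderiv h e (x + (c * s) *\<^sub>R e) * (c * 1)) (at s)" for x s
      by (rule DERIV_chain2[OF smooth_fun_DERIV_line[OF h]])
        (auto intro!: derivative_eq_intros)
    then show "((\<lambda>s. G x * h (x + (c * s) *\<^sub>R e)) has_real_derivative G x * (c * dderiv h e (x + (c * s) *\<^sub>R e))) (at s)" for x s
      by (intro DERIV_cmult) (simp only: mult_1_right mult.commute[of "dderiv h e (x + (c * s) *\<^sub>R e)" c for x s])
    show "continuous_on (UNIV \<times> UNIV) (\<lambda>(s, x). G x * (c * dderiv h e (x + (c * s) *\<^sub>R e)))"
      unfolding split_def
      by (intro continuous_intros continuous_on_compose2[OF Gc]
          continuous_on_compose2[OF smooth_continuous_on[OF smooth_fun_dderiv[OF h], of UNIV]]) auto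
    show "continuous_on UNIV (\<lambda>x. G x * h (x + (c * s) *\<^sub>R e))" for s
      by (intro continuous_intros Gc shift smooth_continuous_on h)
  qed auto
  have "(\<phi> has_real_derivative \<phi>' s) (at s)" for s
    using DERIV_minus[OF DERIV_add[OF DER[OF m(1), where c=1 and s=s] DER[OF m(1), where c="-1" and s=s]]]
    unfolding \<phi>_def \<phi>'_def by (simp add: torus_integral_minus)
  moreover have "(\<phi>' has_real_derivative - (2 * torus_integral (\<lambda>x. G x * dderiv (dderiv m e) e x))) (at 0)"
    using DERIV_minus[OF DERIV_diff[OF DER[OF smooth_fun_dderiv[OF m(1), of e], where c=1 and s=0]
          DER[OF smooth_fun_dderiv[OF m(1), of e], where c="-1" and s=0]]]
    unfolding \<phi>'_def by (simp add: torus_integral_minus)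
  ultimately have "- (2 * torus_integral (\<lambda>x. G x * dderiv (dderiv m e) e x)) \<ge> 0"
    using second_derivative_at_min_nonneg by blast
  then show ?thesis by simp
qed

end

text \<open>The cube [-1,1]^d contains the unit ball, outside which the kernel vanishes; scaling by
  \<epsilon> gives the box and preserves the mass.\<close>

lemma even_kernel_moll:
  fixes \<eta> :: "real^'d \<Rightarrow> real"
  assumes "mollifier_kernel \<eta>" "\<epsilon> > 0"
  shows "even_kernel (moll \<eta> \<epsilon>) (\<epsilon> *\<^sub>R 1)"
proof
  note eta = assms(1)[unfolded mollifier_kernel_def]
  have sub: "norm y \<ge> 1" if "y \<notin> cbox (-1) 1" for y :: "real^'d"
  proof -
    have "\<exists>i. \<bar>y $ i\<bar> > 1"
    proof (rule ccontr)
      assume "\<nexists>i. \<bar>y $ i\<bar> > 1"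
      then have "- 1 \<le> y $ i \<and> y $ i \<le> 1" for i by (metis abs_le_iff linorder_not_less minus_le_iff)
      then show False using that by (simp add: mem_box_cart)
    qed
    then obtain i where "\<bar>y $ i\<bar> > 1" ..
    then show ?thesis using component_le_norm_cart[of y i] by linarith
  qed
  show "continuous_on UNIV (moll \<eta> \<epsilon>)"
    unfolding moll_def
    by (intro continuous_intros continuous_on_compose2[OF smooth_continuous_on[of \<eta> UNIV]]) (use eta in auto)
  show "moll \<eta> \<epsilon> y = 0" if "y \<notin> cbox (- (\<epsilon> *\<^sub>R 1)) (\<epsilon> *\<^sub>R 1)" for y
  proof -
    have "inverse \<epsilon> *\<^sub>R y \<notin> cbox (-1) 1"
      using that \<open>\<epsilon> > 0\<close> by (auto simp: mem_box_cart field_simps)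
    then have "\<eta> (inverse \<epsilon> *\<^sub>R y) = 0" using eta sub by blast
    then show ?thesis by (simp add: moll_def)
  qed
  show "moll \<eta> \<epsilon> (- y) = moll \<eta> \<epsilon> y" for y using eta by (simp add: moll_def)
  show "moll \<eta> \<epsilon> y \<ge> 0" for y using eta \<open>\<epsilon> > 0\<close> by (simp add: moll_def)
  have "(\<lambda>y. if y \<in> cbox (-1) 1 then \<eta> y else 0) = \<eta>"
    using eta sub by auto
  then have "(\<eta> has_integral 1) (cbox (-1) 1)"
    using has_integral_restrict_UNIV[of "cbox (-1) 1" \<eta> 1] eta by simp
  from has_integral_affinity'[OF this, of "inverse \<epsilon>" 0] \<open>\<epsilon> > 0\<close>
  have "((\<lambda>x. \<eta> (inverse \<epsilon> *\<^sub>R x)) has_integral \<epsilon> ^ CARD('d)) (cbox (- (\<epsilon> *\<^sub>R 1)) (\<epsilon> *\<^sub>R 1))"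
    by (simp add: power_inverse)
  from has_integral_mult_right[OF this, of "inverse \<epsilon> ^ CARD('d)"]
  show "(moll \<eta> \<epsilon> has_integral 1) (cbox (- (\<epsilon> *\<^sub>R 1)) (\<epsilon> *\<^sub>R 1))"
    using \<open>\<epsilon> > 0\<close> by (simp add: moll_def[abs_def] power_inverse)
qed

section \<open>A Gagliardo--Nirenberg inequality on the torus\<close>

text \<open>The variance of \<open>g\<close> is nonnegative. The form for a general box of content
  one serves both the unit cell and the parameter interval of a segment.\<close>

lemma integral_power2_le:
  fixes g :: "'a::euclidean_space \<Rightarrow> real"
  assumes g: "continuous_on (cbox a b) g" and c: "integral (cbox a b) (\<lambda>x. 1) = (1::real)"
  shows "(integral (cbox a b) g)\<^sup>2 \<le> integral (cbox a b) (\<lambda>x. (g x)\<^sup>2)"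
proof -
  let ?m = "integral (cbox a b) g"
  have i: "(\<lambda>x. (g x)\<^sup>2) integrable_on cbox a b" "(\<lambda>x. 2 * ?m * g x) integrable_on cbox a b"
     "(\<lambda>x. ?m\<^sup>2 * 1) integrable_on cbox a b"
    by (intro integrable_continuous continuous_intros g)+
  have "0 \<le> integral (cbox a b) (\<lambda>x. (g x - ?m)\<^sup>2)"
    by (intro integral_nonneg integrable_continuous continuous_intros g) auto
  also have "\<dots> = integral (cbox a b) (\<lambda>x. ((g x)\<^sup>2 - 2 * ?m * g x) + ?m\<^sup>2 * 1)"
    by (simp add: power2_diff algebra_simps)
  also have "\<dots> = integral (cbox a b) (\<lambda>x. (g x)\<^sup>2) - 2 * ?m * ?m + ?m\<^sup>2 * 1"
    by (subst integral_add[OF integrable_diff[OF i(1,2)] i(3)], subst integral_diff[OF i(1,2)],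
        subst integral_mult_right, subst integral_mult_right, subst c) (rule refl)
  finally show ?thesis by (simp add: power2_eq_square)
qed

lemma torus_integral_power2_le:
  fixes g :: "real^'d \<Rightarrow> real"
  assumes "continuous_on UNIV g"
  shows "(torus_integral g)\<^sup>2 \<le> torus_integral (\<lambda>x. (g x)\<^sup>2)"
  unfolding torus_integral_def
  using torus_integral_const[of 1, where 'd='d]
  by (intro integral_power2_le continuous_on_subset[OF assms]) (auto simp: torus_integral_def)

lemma torus_integral_swap:
  fixes f :: "real^'d \<Rightarrow> real^'e \<Rightarrow> real"
  assumes "continuous_on UNIV (\<lambda>(x, y). f x y)"
  shows "torus_integral (\<lambda>x. torus_integral (f x)) = torus_integral (\<lambda>y. torus_integral (\<lambda>x. f x y))"
  unfolding torus_integral_def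
  by (rule integral_swap_continuous) (rule continuous_on_subset[OF assms], simp)

lemma axis_basis_sum: "(\<Sum>i\<in>UNIV. (v $ i) *\<^sub>R axis i 1) = (v :: real^'d)"
  by (simp add: basis_expansion[of v, unfolded scalar_mult_eq_scaleR])

text \<open>The linear map \<open>A\<close> embeds directions, so that one expansion in coordinates
  covers v, (v, 0) and (0, v).\<close>

lemma dderiv_linear_axis:
  fixes A :: "real^'d \<Rightarrow> 'a::real_normed_vector"
  assumes F: "smooth_fun F" and A: "linear A"
  shows "dderiv F (A v) z = (\<Sum>i\<in>UNIV. v $ i * dderiv F (A (axis i 1)) z)"
proof -
  have L: "linear (\<lambda>v. dderiv F (A v) z)" using linear_compose[OF A linear_dderiv[OF F]] by (simp add: o_def)
  show ?thesis
    using linear_sum[OF L, of "\<lambda>i. (v $ i) *\<^sub>R axis i 1" UNIV] linear_scale[OF L] by (simp add: axis_basis_sum)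
qed

definition grad_sq :: "(real^'d \<Rightarrow> real) \<Rightarrow> real^'d \<Rightarrow> real" where
  "grad_sq f x = (\<Sum>i\<in>UNIV. (dderiv f (axis i 1) x)\<^sup>2)"

lemma grad_sq_nonneg: "grad_sq f x \<ge> 0"
  by (simp add: grad_sq_def sum_nonneg)

lemma grad_sq_continuous: "smooth_fun f \<Longrightarrow> continuous_on S (grad_sq f)"
  unfolding grad_sq_def
  by (intro continuous_intros smooth_continuous_on smooth_fun_dderiv)

lemma dderiv_power2_le:
  fixes f :: "real^'d \<Rightarrow> real"
  assumes "smooth_fun f"
  shows "(dderiv f v x)\<^sup>2 \<le> (norm v)\<^sup>2 * grad_sq f x"
proof -
  have "dderiv f v x = v \<bullet> (\<chi> i. dderiv f (axis i 1) x)"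
    using dderiv_linear_axis[OF assms linear_ident, of v x] by (simp add: inner_vec_def)
  then have "(dderiv f v x)\<^sup>2 \<le> (norm v)\<^sup>2 * (norm (\<chi> i. dderiv f (axis i 1) x :: real^'d))\<^sup>2"
    using Cauchy_Schwarz_ineq[of v "\<chi> i. dderiv f (axis i 1) x"] by (simp add: power2_norm_eq_inner)
  also have "(norm (\<chi> i. dderiv f (axis i 1) x :: real^'d))\<^sup>2 = grad_sq f x"
    unfolding power2_norm_eq_inner inner_vec_def by (simp add: grad_sq_def power2_eq_square)
  finally show ?thesis .
qed

text \<open>The increment is the mean over s in [0,1] of the derivative along v at x + s v. Jensen's
  inequality puts the square inside, and after swapping the integrals each s contributes the same
  amount by translation invariance.\<close>

lemma torus_integral_difference_power2_le:
  fixes w :: "real^'d \<Rightarrow> real"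
  assumes w: "smooth_fun w" "Zd_periodic w"
  shows "torus_integral (\<lambda>x. (w (x + v) - w x)\<^sup>2) \<le> (norm v)\<^sup>2 * torus_integral (grad_sq w)"
proof -
  let ?D = "dderiv w v"
  have D: "continuous_on UNIV ?D" by (intro smooth_continuous_on smooth_fun_dderiv w)
  have cD: "continuous_on S (\<lambda>s. ?D (x + s *\<^sub>R v))" for S x
    by (intro continuous_on_compose2[OF D] continuous_intros) auto
  have c2: "continuous_on S (\<lambda>z. (?D (fst z + snd z *\<^sub>R v))\<^sup>2)" for S
    by (intro continuous_intros continuous_on_compose2[OF D]) auto
  have c3: "continuous_on UNIV (\<lambda>x. (w (x + v) - w x)\<^sup>2)"
    by (intro continuous_intros continuous_on_compose2[OF smooth_continuous_on[OF w(1)]]) auto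
  have pt: "(w (x + v) - w x)\<^sup>2 \<le> integral (cbox 0 1) (\<lambda>s. (?D (x + s *\<^sub>R v))\<^sup>2)" for x
  proof -
    have "((\<lambda>s. ?D (x + s *\<^sub>R v)) has_integral (w (x + 1 *\<^sub>R v) - w (x + 0 *\<^sub>R v))) {0..1}"
      by (rule fundamental_theorem_of_calculus)
        (auto intro: has_field_derivative_at_within[OF smooth_fun_DERIV_line[OF w(1)]]
            simp: has_real_derivative_iff_has_vector_derivative[symmetric])
    then have "w (x + v) - w x = integral (cbox 0 1) (\<lambda>s. ?D (x + s *\<^sub>R v))"
      by (simp add: integral_unique)
    then show ?thesis using integral_power2_le[OF cD] by simp
  qed
  have cI: "continuous_on UNIV (\<lambda>x. integral (cbox 0 1) (\<lambda>s. (?D (x + s *\<^sub>R v))\<^sup>2))"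
    by (rule integral_continuous_on_param) (use c2 in \<open>simp add: split_def\<close>)
  have "torus_integral (\<lambda>x. (w (x + v) - w x)\<^sup>2) \<le>
    torus_integral (\<lambda>x. integral (cbox 0 1) (\<lambda>s. (?D (x + s *\<^sub>R v))\<^sup>2))"
    by (rule torus_integral_mono[OF c3 cI pt])
  also have "\<dots> = integral (cbox 0 1) (\<lambda>s. torus_integral (\<lambda>x. (?D (x + s *\<^sub>R v))\<^sup>2))"
    unfolding torus_integral_def by (rule integral_swap_continuous) (use c2 in \<open>simp add: split_def\<close>)
  also have "\<dots> = integral (cbox 0 (1::real)) (\<lambda>s. torus_integral (\<lambda>x. (?D x)\<^sup>2))"
    by (intro integral_cong torus_integral_translate[of "\<lambda>x. (?D x)\<^sup>2"] continuous_intros D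
         Zd_periodic_compose[OF Zd_periodic_dderiv[OF w(2)], of "\<lambda>z. z\<^sup>2"])
  also have "\<dots> = torus_integral (\<lambda>x. (?D x)\<^sup>2)" by simp
  also have "\<dots> \<le> torus_integral (\<lambda>x. (norm v)\<^sup>2 * grad_sq w x)"
    by (intro torus_integral_mono dderiv_power2_le continuous_intros D grad_sq_continuous w)
  finally show ?thesis by (simp add: torus_integral_cmult)
qed

text \<open>Average over the cube of side \<open>h\<close> with corner \<open>x\<close>, rescaled to
  the unit cube. Here \<open>torus_integral\<close> is just an integral over that cube, since the
  integrand is in general not periodic in y.\<close>

definition box_avg :: "real \<Rightarrow> (real^'d \<Rightarrow> real) \<Rightarrow> real^'d \<Rightarrow> real" where
  "box_avg h w x = torus_integral (\<lambda>y. w (x + h *\<^sub>R y))"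

lemma continuous_on_box_avg:
  "continuous_on UNIV w \<Longrightarrow> continuous_on S (box_avg h w)"
  unfolding box_avg_def[abs_def]
  by (intro continuous_on_torus_integral)
    (auto simp: split_def intro!: continuous_intros continuous_on_compose2[of UNIV w])

lemma norm_cbox_unit_le:
  assumes "y \<in> cbox 0 (1::real^'d)" shows "(norm y)\<^sup>2 \<le> real CARD('d)"
proof -
  have "(norm y)\<^sup>2 = (\<Sum>i\<in>UNIV. (y $ i)\<^sup>2)"
    unfolding power2_norm_eq_inner inner_vec_def by (simp add: power2_eq_square)
  also have "\<dots> \<le> (\<Sum>i\<in>(UNIV::'d set). 1)"
    using assms by (intro sum_mono) (auto simp: mem_box_cart power_le_one)
  finally show ?thesis by simp
qed

text \<open>A Poincare inequality at scale \<open>h\<close>: by Jensen the error is at most an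
  average over y of squared increments along h y, and |h y|^2 \<le> d h^2 on the unit cube.\<close>

lemma box_avg_L2_error:
  fixes w :: "real^'d \<Rightarrow> real"
  assumes w: "smooth_fun w" "Zd_periodic w"
  shows "torus_integral (\<lambda>x. (w x - box_avg h w x)\<^sup>2) \<le> real CARD('d) * h\<^sup>2 * torus_integral (grad_sq w)"
proof -
  have wc: "continuous_on UNIV w" by (intro smooth_continuous_on w)
  have sh: "continuous_on UNIV (\<lambda>y. w (x + h *\<^sub>R y))" for x
    by (intro continuous_on_compose2[OF wc] continuous_intros) auto
  have c2: "continuous_on UNIV (\<lambda>(x, y). (w (x + h *\<^sub>R y) - w x)\<^sup>2)"
    unfolding split_def by (intro continuous_intros continuous_on_compose2[OF wc]) auto
  then have c3: "continuous_on UNIV (\<lambda>x. torus_integral (\<lambda>y. (w (x + h *\<^sub>R y) - w x)\<^sup>2))"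
    by (intro continuous_on_torus_integral) simp
  from c2 have "continuous_on UNIV (\<lambda>y. torus_integral (\<lambda>x. (w (x + h *\<^sub>R y) - w x)\<^sup>2))"
    by (intro continuous_on_torus_integral) (auto simp: split_def intro!: continuous_intros continuous_on_compose2[OF wc])
  then have int: "(\<lambda>y. torus_integral (\<lambda>x. (w (x + h *\<^sub>R y) - w x)\<^sup>2)) integrable_on cbox 0 1"
    by (rule torus_integrable)
  have D0: "torus_integral (grad_sq w) \<ge> 0"
    by (intro torus_integral_nonneg grad_sq_continuous w grad_sq_nonneg)
  have "(w x - box_avg h w x)\<^sup>2 \<le> torus_integral (\<lambda>y. (w (x + h *\<^sub>R y) - w x)\<^sup>2)" for x
  proof -
    have "box_avg h w x - w x = torus_integral (\<lambda>y. w (x + h *\<^sub>R y) - w x)"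
      unfolding box_avg_def by (subst torus_integral_diff[OF sh continuous_on_const]) (simp add: torus_integral_const)
    then have "(w x - box_avg h w x)\<^sup>2 = (torus_integral (\<lambda>y. w (x + h *\<^sub>R y) - w x))\<^sup>2"
      by (metis power2_commute)
    also have "\<dots> \<le> torus_integral (\<lambda>y. (w (x + h *\<^sub>R y) - w x)\<^sup>2)"
      by (intro torus_integral_power2_le continuous_intros sh)
    finally show ?thesis .
  qed
  then have "torus_integral (\<lambda>x. (w x - box_avg h w x)\<^sup>2) \<le>
     torus_integral (\<lambda>x. torus_integral (\<lambda>y. (w (x + h *\<^sub>R y) - w x)\<^sup>2))"
    by (intro torus_integral_mono c3 continuous_intros wc continuous_on_box_avg)
  also have "\<dots> = torus_integral (\<lambda>y. torus_integral (\<lambda>x. (w (x + h *\<^sub>R y) - w x)\<^sup>2))"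
    by (rule torus_integral_swap[OF c2])
  also have "\<dots> \<le> integral (cbox 0 (1::real^'d)) (\<lambda>y. real CARD('d) * h\<^sup>2 * torus_integral (grad_sq w))"
    unfolding torus_integral_def[of "\<lambda>y. torus_integral (f y)" for f]
  proof (rule integral_le[OF int])
    fix y assume y: "y \<in> cbox 0 (1::real^'d)"
    have "torus_integral (\<lambda>x. (w (x + h *\<^sub>R y) - w x)\<^sup>2) \<le> (norm (h *\<^sub>R y))\<^sup>2 * torus_integral (grad_sq w)"
      by (rule torus_integral_difference_power2_le[OF w])
    also have "(norm (h *\<^sub>R y))\<^sup>2 \<le> real CARD('d) * h\<^sup>2"
      using mult_left_mono[OF norm_cbox_unit_le[OF y], of "h\<^sup>2"] by (simp add: power_mult_distrib mult.commute)
    finally show "torus_integral (\<lambda>x. (w (x + h *\<^sub>R y) - w x)\<^sup>2) \<le> real CARD('d) * h\<^sup>2 * torus_integral (grad_sq w)"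
      using D0 by (simp add: mult_right_mono)
  qed auto
  also have "\<dots> = real CARD('d) * h\<^sup>2 * torus_integral (grad_sq w)"
    using torus_integral_const[where 'd='d] by (simp add: torus_integral_def)
  finally show ?thesis .
qed

text \<open>After Jensen and rescaling, the cube of side \<open>h\<close> is enlarged to a full
  period cell, which is where h \<le> 1 enters.\<close>

lemma box_avg_power2_le:
  fixes w :: "real^'d \<Rightarrow> real"
  assumes w: "continuous_on UNIV w" "Zd_periodic w" and h: "0 < h" "h \<le> 1"
  shows "(box_avg h w x)\<^sup>2 \<le> torus_integral (\<lambda>y. (w y)\<^sup>2) / h ^ CARD('d)"
proof -
  have wc: "continuous_on S (\<lambda>y. (w y)\<^sup>2)" for S by (intro continuous_intros continuous_on_subset[OF w(1)]) auto
  have sh: "continuous_on UNIV (\<lambda>y. w (x + h *\<^sub>R y))"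
    by (intro continuous_on_compose2[OF w(1)] continuous_intros) auto
  have "(box_avg h w x)\<^sup>2 \<le> torus_integral (\<lambda>y. (w (x + h *\<^sub>R y))\<^sup>2)"
    unfolding box_avg_def by (rule torus_integral_power2_le[OF sh])
  also have "\<dots> = integral (cbox x (x + h *\<^sub>R 1)) (\<lambda>y. (w y)\<^sup>2) / h ^ CARD('d)"
  proof -
    have "((\<lambda>y. (w y)\<^sup>2) has_integral integral (cbox x (x + h *\<^sub>R 1)) (\<lambda>y. (w y)\<^sup>2)) (cbox x (x + h *\<^sub>R 1))"
      by (intro integrable_integral integrable_continuous wc)
    from has_integral_affinity'[OF this h(1), of x] h(1) show ?thesis
      unfolding torus_integral_def by (simp add: integral_unique add.commute divide_inverse mult.commute)
  qed
  also have "integral (cbox x (x + h *\<^sub>R 1)) (\<lambda>y. (w y)\<^sup>2) \<le> integral (cbox x (x + 1)) (\<lambda>y. (w y)\<^sup>2)"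
    using h by (intro integral_subset_le integrable_continuous wc subset_box_imp)
      (auto simp: inner_axis Basis_vec_def inner_add_left intro!: mult_left_le_one_le)
  also have "\<dots> = torus_integral (\<lambda>y. (w y)\<^sup>2)"
    using integral_shift_cbox_plus[of 0 1 "\<lambda>y. (w y)\<^sup>2" x]
      torus_integral_translate[OF Zd_periodic_compose[OF w(2), of "\<lambda>z. z\<^sup>2"] wc, of x]
    by (simp add: torus_integral_def o_def add.commute)
  finally show ?thesis using h by (simp add: divide_right_mono)
qed

text \<open>For the largest \<open>J\<close> with \<open>2 \<surd>A 2^(J d/2) \<le> w x\<close> the average of \<open>w\<close> over a cube of side
  \<open>2^(-J)\<close> is at most \<open>w x / 2\<close>, so \<open>w x\<close> is controlled by its distance to that average.\<close>

lemma gagliardo_nirenberg_pointwise: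
  fixes w :: "real^'d \<Rightarrow> real"
  assumes w: "continuous_on UNIV w" "Zd_periodic w" "w x > 0"
    and A: "A > 0" "torus_integral (\<lambda>y. (w y)\<^sup>2) \<le> A" and \<kappa>: "\<kappa> > 0"
    and n: "w x < 2 * sqrt A * 2 powr (real n * real CARD('d) / 2)"
  shows "(w x)\<^sup>2 * (w x / (2 * sqrt A)) powr (2 * \<kappa> / real CARD('d)) \<le>
    (w x)\<^sup>2 + 4 * 2 powr \<kappa> * (\<Sum>j<n. 2 powr (real j * \<kappa>) * (w x - box_avg ((1/2) ^ j) w x)\<^sup>2)"
proof (cases "w x < 2 * sqrt A")
  case True
  have "(w x / (2 * sqrt A)) powr (2 * \<kappa> / real CARD('d)) \<le> 1"
    using True w A \<kappa> by (intro powr_le1) auto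
  then have "(w x)\<^sup>2 * (w x / (2 * sqrt A)) powr (2 * \<kappa> / real CARD('d)) \<le> (w x)\<^sup>2 * 1"
    by (intro mult_left_mono) auto
  also have "\<dots> \<le> (w x)\<^sup>2 + 4 * 2 powr \<kappa> * (\<Sum>j<n. 2 powr (real j * \<kappa>) * (w x - box_avg ((1/2) ^ j) w x)\<^sup>2)"
    by (auto intro!: sum_nonneg mult_nonneg_nonneg)
  finally show ?thesis .
next
  case False
  let ?d = "real CARD('d)"
  let ?P = "\<lambda>j. w x < 2 * sqrt A * 2 powr (real j * ?d / 2)"
  define k where "k = (LEAST j. ?P j)"
  have k: "?P k" "k \<le> n" unfolding k_def using n by (auto intro: LeastI Least_le)
  have "k \<noteq> 0" using k(1) False by (intro notI) simp
  then obtain J where J: "k = Suc J" using not0_implies_Suc by blast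
  have notJ: "\<not> ?P J" using not_less_Least[of J ?P] J unfolding k_def by simp
  have "J < n" using k J by simp
  have d: "?d > 0" by simp
  let ?a = "box_avg ((1/2) ^ J) w x" and ?W = "(w x / (2 * sqrt A)) powr (2 * \<kappa> / ?d)"
  \<comment> \<open>\<open>?P k\<close> bounds w(x) / (2 sqrt A) by 2^(k d/2); the exponent
    2\<kappa>/d turns this into 2^(k\<kappa>), the weight of scale J up to the factor
    2^\<kappa>.\<close>
  have "?W \<le> (2 powr (real k * ?d / 2)) powr (2 * \<kappa> / ?d)"
    using k(1) w A \<kappa> by (intro powr_mono2) (auto simp: field_simps)
  also have "\<dots> = 2 powr (real k * \<kappa>)" using d by (simp add: powr_powr)
  also have "\<dots> = 2 powr \<kappa> * 2 powr (real J * \<kappa>)" unfolding J by (simp add: powr_add[symmetric] algebra_simps)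
  finally have 1: "?W \<le> 2 powr \<kappa> * 2 powr (real J * \<kappa>)" .
  have "(?a)\<^sup>2 \<le> torus_integral (\<lambda>y. (w y)\<^sup>2) / ((1/2) ^ J) ^ CARD('d)"
    by (rule box_avg_power2_le[OF w(1,2)]) (auto simp: power_le_one)
  also have "\<dots> \<le> A / ((1/2) ^ J) ^ CARD('d)" by (intro divide_right_mono A) auto
  also have "\<dots> = (sqrt A * 2 powr (real J * ?d / 2))\<^sup>2"
  proof -
    have "(2 powr (real J * ?d / 2))\<^sup>2 = 2 powr (real J * ?d)"
      by (simp add: power2_eq_square powr_add[symmetric])
    also have "\<dots> = 2 ^ (J * CARD('d))" by (simp add: powr_realpow[symmetric])
    finally show ?thesis using A by (simp add: power_mult_distrib power_mult[symmetric] power_one_over)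
  qed
  finally have "\<bar>?a\<bar> \<le> sqrt A * 2 powr (real J * ?d / 2)"
    using A by (simp add: abs_le_square_iff[symmetric])
  also have "\<dots> \<le> w x / 2" using notJ by simp
  finally have "w x / 2 \<le> w x - ?a" by simp
  then have "(w x / 2)\<^sup>2 \<le> (w x - ?a)\<^sup>2"
    using w(3) by (intro power_mono) auto
  then have 2: "(w x)\<^sup>2 \<le> 4 * (w x - ?a)\<^sup>2" by (simp add: power_divide)
  have "(w x)\<^sup>2 * ?W \<le>
     (4 * (w x - ?a)\<^sup>2) * (2 powr \<kappa> * 2 powr (real J * \<kappa>))"
    by (rule mult_mono[OF 2 1]) auto
  also have "\<dots> = 4 * 2 powr \<kappa> * (2 powr (real J * \<kappa>) * (w x - ?a)\<^sup>2)" by simp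
  \<comment> \<open>J depends on x. Bounding its term by the sum over all scales gives something
    that can be integrated in x.\<close>
  also have "\<dots> \<le> 4 * 2 powr \<kappa> * (\<Sum>j<n. 2 powr (real j * \<kappa>) * (w x - box_avg ((1/2) ^ j) w x)\<^sup>2)"
    using \<open>J < n\<close> by (intro mult_left_mono member_le_sum) auto
  finally show ?thesis by (smt (verit) zero_le_power2)
qed

text \<open>After integration of the pointwise bound, scale j contributes 2^(j\<kappa>) d 4^(-j)
  times the Dirichlet integral, and \<kappa> < 2 makes this series geometric. \<open>A\<close> is
  kept apart from the L^2 norm so that one \<open>A\<close> can serve all times at once.\<close>

lemma gagliardo_nirenberg:
  assumes \<kappa>: "0 < \<kappa>" "\<kappa> < 2"
  obtains C where "C > 0" "\<And>w A. \<lbrakk>smooth_fun w; Zd_periodic w; \<And>x::real^'d. w x > 0; A > 0;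
     torus_integral (\<lambda>x. (w x)\<^sup>2) \<le> A\<rbrakk> \<Longrightarrow>
     torus_integral (\<lambda>x. w x powr (2 + 2 * \<kappa> / real CARD('d))) \<le>
       C * A powr (\<kappa> / real CARD('d)) * (A + torus_integral (grad_sq w))"
proof -
  let ?d = "real CARD('d)"
  define q where "q = 2 powr (\<kappa> - 2)"
  have q: "0 < q" "q < 1" using powr_less_mono[of "\<kappa> - 2" 0 2] \<kappa> unfolding q_def by auto
  define K where "K = 4 * 2 powr \<kappa> * ?d / (1 - q)"
  define C where "C = (1 + K) * 2 powr (2 * \<kappa> / ?d)"
  have K: "K > 0" unfolding K_def using q by (simp add: zero_less_mult_iff)
  then have "C > 0" unfolding C_def by simp
  moreover have "torus_integral (\<lambda>x. w x powr (2 + 2 * \<kappa> / ?d)) \<le>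
       C * A powr (\<kappa> / ?d) * (A + torus_integral (grad_sq w))"
    if w: "smooth_fun w" "Zd_periodic w" "\<And>x::real^'d. w x > 0" and A: "A > 0" "torus_integral (\<lambda>x. (w x)\<^sup>2) \<le> A"
    for w A
  proof -
    let ?D = "torus_integral (grad_sq w)"
    let ?c = "(2 * sqrt A) powr (2 * \<kappa> / ?d)" and ?k = "4 * 2 powr \<kappa>"
    let ?a = "\<lambda>j x. (w x - box_avg ((1/2) ^ j) w x)\<^sup>2"
    have wc: "continuous_on UNIV w" by (intro smooth_continuous_on w)
    have ac: "continuous_on UNIV (?a j)" for j
      by (intro continuous_intros wc continuous_on_box_avg)
    have D0: "?D \<ge> 0"
      by (intro torus_integral_nonneg grad_sq_continuous w grad_sq_nonneg)
    obtain B where B: "B > 0" "\<And>x. \<bar>w x\<bar> \<le> B" using Zd_periodic_bounded[OF w(2) wc] by blast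
    \<comment> \<open>\<open>n\<close> depends on \<open>w\<close>, but the constant does not,
      because the sum over scales is bounded by the full geometric series. There are 2n scales
      because 2n d/2 \<ge> n for every d \<ge> 1.\<close>
    obtain n where n: "B / (2 * sqrt A) < 2 ^ n" using real_arch_pow[of 2] by auto
    have nB: "B < 2 * sqrt A * 2 powr (real (2 * n) * ?d / 2)"
    proof -
      have "(2::real) ^ n = 2 powr real n" by (simp add: powr_realpow)
      also have "\<dots> \<le> 2 powr (real (2 * n) * ?d / 2)"
        by (intro powr_mono) (auto simp: mult_le_cancel_left1 Suc_leI)
      finally have "B / (2 * sqrt A) < 2 powr (real (2 * n) * ?d / 2)" using n by linarith
      then show ?thesis using A by (simp add: field_simps)
    qed
    have pt: "(w x)\<^sup>2 * (w x / (2 * sqrt A)) powr (2 * \<kappa> / ?d) \<le>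
       (w x)\<^sup>2 + ?k * (\<Sum>j<2*n. 2 powr (real j * \<kappa>) * ?a j x)" for x
      by (rule gagliardo_nirenberg_pointwise[OF wc w(2,3) A \<kappa>(1)]) (use B(2)[of x] nB in linarith)
    have split: "w x powr (2 + 2 * \<kappa> / ?d) = ?c *
      ((w x)\<^sup>2 * (w x / (2 * sqrt A)) powr (2 * \<kappa> / ?d))" for x
      using w(3)[of x] A by (simp add: powr_add powr_divide powr_numeral)
    have sumle: "(\<Sum>j<2*n. 2 powr (real j * \<kappa>) * torus_integral (?a j)) \<le> ?d / (1 - q) * ?D"
    proof -
      have "2 powr (real j * \<kappa>) * torus_integral (?a j) \<le> q ^ j * (?d * ?D)" for j
      proof -
        have "2 powr (real j * \<kappa>) * torus_integral (?a j) \<le> 2 powr (real j * \<kappa>) * (?d * ((1/2)^j)\<^sup>2 * ?D)"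
          by (intro mult_left_mono box_avg_L2_error w) auto
        also have "2 powr (real j * \<kappa>) * (?d * ((1/2)^j)\<^sup>2 * ?D) = (2 powr (real j * \<kappa>) * ((1/2)^j)\<^sup>2) * (?d * ?D)"
          by simp
        also have "2 powr (real j * \<kappa>) * ((1/2)^j)\<^sup>2 = q ^ j"
        proof -
          have "((1/2::real)^j)\<^sup>2 = (1/4)^j"
            by (simp add: power2_eq_square power_mult_distrib[symmetric])
          moreover have "2 powr (real j * \<kappa>) = (2 powr \<kappa>) ^ j"
            by (simp add: powr_power mult.commute)
          moreover have "q = 2 powr \<kappa> * (1/4)" unfolding q_def by (simp add: powr_diff)
          ultimately show ?thesis by (simp only: power_mult_distrib)
        qed
        finally show ?thesis .
      qed
      then have "(\<Sum>j<2*n. 2 powr (real j * \<kappa>) * torus_integral (?a j)) \<le> (\<Sum>j<2*n. q ^ j * (?d * ?D))"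
        by (rule sum_mono)
      also have "\<dots> = (\<Sum>j<2*n. q ^ j) * (?d * ?D)" by (simp add: sum_distrib_right)
      also have "(\<Sum>j<2*n. q ^ j) \<le> 1 / (1 - q)"
        using q by (subst sum_gp_strict) (auto intro!: divide_right_mono)
      finally show ?thesis using D0 by (simp add: mult_right_mono)
    qed
    let ?S = "\<lambda>x. \<Sum>j<2*n. 2 powr (real j * \<kappa>) * ?a j x"
    have Sc: "continuous_on UNIV ?S"
      by (intro continuous_on_sum continuous_on_mult continuous_on_const ac)
    have w2: "continuous_on UNIV (\<lambda>x. (w x)\<^sup>2)" by (intro continuous_intros wc)
    have "torus_integral (\<lambda>x. w x powr (2 + 2 * \<kappa> / ?d)) \<le>
      torus_integral (\<lambda>x. ?c * ((w x)\<^sup>2 + ?k * ?S x))"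
    proof (rule torus_integral_mono)
      show "w x powr (2 + 2 * \<kappa> / ?d) \<le> ?c * ((w x)\<^sup>2 + ?k * ?S x)" for x
        unfolding split by (rule mult_left_mono[OF pt]) simp
      show "continuous_on UNIV (\<lambda>x. w x powr (2 + 2 * \<kappa> / ?d))"
        by (rule smooth_continuous_on[OF smooth_fun_powr[OF w(1,3)]])
      show "continuous_on UNIV (\<lambda>x. ?c * ((w x)\<^sup>2 + ?k * ?S x))"
        by (intro continuous_on_add continuous_on_mult continuous_on_const w2 Sc)
    qed
    also have "\<dots> = ?c * (torus_integral (\<lambda>x. (w x)\<^sup>2) + ?k * torus_integral ?S)"
      by (subst torus_integral_cmult, subst torus_integral_add[OF w2 continuous_on_mult[OF continuous_on_const Sc]],
          subst torus_integral_cmult, rule refl)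
    also have "\<dots> = ?c * (torus_integral (\<lambda>x. (w x)\<^sup>2)
        + ?k * (\<Sum>j<2*n. 2 powr (real j * \<kappa>) * torus_integral (?a j)))"
      by (subst torus_integral_sum[OF continuous_on_mult[OF continuous_on_const ac]], subst torus_integral_cmult, rule refl)
    also have "\<dots> \<le> ?c * (A + ?k * (?d / (1 - q) * ?D))"
      by (intro mult_left_mono add_mono A sumle) auto
    also have "\<dots> = ?c * (A + K * ?D)" unfolding K_def by simp
    also have "\<dots> \<le> ?c * ((1 + K) * (A + ?D))"
      using K A D0 by (intro mult_left_mono) (auto simp: algebra_simps)
    also have "?c = 2 powr (2 * \<kappa> / ?d) * A powr (\<kappa> / ?d)"
    proof -
      have "sqrt A powr (2 * \<kappa> / ?d) = A powr (\<kappa> / ?d)"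
        using A by (simp add: powr_half_sqrt[symmetric] powr_powr)
      then show ?thesis using A by (simp add: powr_mult)
    qed
    finally show ?thesis unfolding C_def by (simp add: mult_ac)
  qed
  ultimately show thesis by (rule that)
qed

section \<open>Functions of space and time\<close>

text \<open>Smoothness and periodicity are required at all real times, as in the notion of solution,
  whereas the equations and positivity are available on {0..T} only.\<close>

definition torus_smooth :: "((real^'d) \<times> real \<Rightarrow> real) \<Rightarrow> bool" where
  "torus_smooth f \<longleftrightarrow> smooth_fun f \<and> (\<forall>t. Zd_periodic (\<lambda>x. f (x, t)))"

lemma torus_smooth_smooth: "torus_smooth f \<Longrightarrow> smooth_fun f"
  and torus_smooth_periodic: "torus_smooth f \<Longrightarrow> Zd_periodic (\<lambda>x. f (x, t))"
  by (auto simp: torus_smooth_def)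

lemma torus_smooth_const: "torus_smooth (\<lambda>z. c)"
  and torus_smooth_add: "torus_smooth f \<Longrightarrow> torus_smooth g \<Longrightarrow> torus_smooth (\<lambda>z. f z + g z)"
  and torus_smooth_diff: "torus_smooth f \<Longrightarrow> torus_smooth g \<Longrightarrow> torus_smooth (\<lambda>z. f z - g z)"
  and torus_smooth_mult: "torus_smooth f \<Longrightarrow> torus_smooth g \<Longrightarrow> torus_smooth (\<lambda>z. f z * g z)"
  and torus_smooth_minus: "torus_smooth f \<Longrightarrow> torus_smooth (\<lambda>z. - f z)"
  by (auto simp: torus_smooth_def Zd_periodic_def smooth_fun_const smooth_fun_add smooth_fun_diff
      smooth_fun_mult smooth_fun_minus)

lemma torus_smooth_sum: "(\<And>i. i \<in> A \<Longrightarrow> torus_smooth (f i)) \<Longrightarrow> torus_smooth (\<lambda>z. \<Sum>i\<in>A. f i z)"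
  by (auto simp: torus_smooth_def Zd_periodic_def smooth_fun_sum)

lemma torus_smooth_dderiv:
  assumes "torus_smooth f" shows "torus_smooth (dderiv f v)"
proof -
  have "f ((x + k, t) + s *\<^sub>R v) = f ((x, t) + s *\<^sub>R v)" if "\<forall>i. k $ i \<in> \<int>" for x k t s
    using Zd_periodic_add[OF torus_smooth_periodic[OF assms], of k "x + s *\<^sub>R fst v" "t + s *\<^sub>R snd v"] that
    by (cases v) (simp add: algebra_simps)
  then show ?thesis
    using assms by (simp add: torus_smooth_def smooth_fun_dderiv Zd_periodic_def dderiv_def)
qed

lemmas torus_smooth_intros = torus_smooth_const torus_smooth_add torus_smooth_diff torus_smooth_mult
  torus_smooth_minus torus_smooth_sum torus_smooth_dderiv

lemma smooth_fun_slice: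
  assumes "smooth_fun f" shows "smooth_fun (\<lambda>x::real^'d. f (x, t::real))"
proof (rule smooth_fun_compose[OF assms])
  fix b :: "(real^'d) \<times> real"
  have "smooth_fun (\<lambda>x::real^'d. x \<bullet> fst b + t * snd b)"
    by (intro smooth_fun_add smooth_fun_const smooth_fun_linear bounded_linear_inner_left)
  then show "smooth_fun (\<lambda>x. (x, t) \<bullet> b)" by (simp add: inner_prod_def)
qed

lemma torus_smooth_slice:
  "torus_smooth f \<Longrightarrow> smooth_fun (\<lambda>x. f (x, t))" "torus_smooth f \<Longrightarrow> Zd_periodic (\<lambda>x. f (x, t))"
  by (auto simp: torus_smooth_def smooth_fun_slice)

lemma slice_continuous: "torus_smooth f \<Longrightarrow> continuous_on S (\<lambda>x. f (x, t))"
  by (intro smooth_continuous_on torus_smooth_slice)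

lemma dderiv_slice: "dderiv (\<lambda>x. f (x, t)) v x = dderiv f (v, 0) (x, t)"
  by (simp add: dderiv_def)

lemma torus_smooth_lift:
  fixes f :: "real^'d \<Rightarrow> real"
  assumes "smooth_fun f" "Zd_periodic f"
  shows "torus_smooth (\<lambda>z. f (fst z))"
  unfolding torus_smooth_def
proof (intro conjI allI)
  show "smooth_fun (\<lambda>z :: (real^'d) \<times> real. f (fst z))"
  proof (rule smooth_fun_compose[OF assms(1)])
    show "smooth_fun (\<lambda>z :: (real^'d) \<times> real. fst z \<bullet> b)" for b
      by (intro smooth_fun_linear bounded_linear_compose[OF bounded_linear_inner_left bounded_linear_fst])
  qed
qed (use assms in auto)

lemma torus_smooth_by_parts:
  assumes "torus_smooth f" "torus_smooth g"
  shows "torus_integral (\<lambda>x. f (x, t) * dderiv g (v, 0) (x, t)) =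
    - torus_integral (\<lambda>x. dderiv f (v, 0) (x, t) * g (x, t))"
  using torus_integral_by_parts[OF torus_smooth_slice[OF assms(1), of t] torus_smooth_slice[OF assms(2), of t], of v]
  by (simp add: dderiv_slice)

lemma torus_smooth_DERIV:
  assumes "torus_smooth f"
  shows "((\<lambda>s. torus_integral (\<lambda>x. f (x, s))) has_real_derivative
    torus_integral (\<lambda>x. dderiv f (0, 1) (x, t))) (at t)"
proof (rule DERIV_torus_integral[where U=UNIV])
  show "((\<lambda>s. f (x, s)) has_real_derivative dderiv f (0, 1) (x, t)) (at t within UNIV)" for x t
    using smooth_fun_DERIV_line[OF torus_smooth_smooth[OF assms], of "(x, 0)" "(0, 1)" t] by simp
  have "continuous_on UNIV (dderiv f (0, 1))"
    by (intro smooth_continuous_on torus_smooth_smooth torus_smooth_dderiv assms)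
  then show "continuous_on (UNIV \<times> UNIV) (\<lambda>(s, x). dderiv f (0, 1) (x, s))"
    unfolding split_def by (rule continuous_on_compose2) (auto intro!: continuous_intros)
qed (auto intro: slice_continuous assms)

lemma torus_smooth_integral_continuous:
  assumes "torus_smooth f"
  shows "continuous_on S (\<lambda>t. torus_integral (\<lambda>x. f (x, t)))"
proof (rule continuous_on_torus_integral)
  show "continuous_on (S \<times> UNIV) (\<lambda>(t, x). f (x, t))"
    unfolding split_def
    by (rule continuous_on_compose2[OF smooth_continuous_on[OF torus_smooth_smooth[OF assms], of UNIV]])
      (auto intro!: continuous_intros)
qed

lemma torus_smooth_bounded:
  assumes "torus_smooth (f :: (real^'d) \<times> real \<Rightarrow> real)"
  obtains B where "B > 0" "\<And>x t. t \<in> {0..T} \<Longrightarrow> \<bar>f (x, t)\<bar> \<le> B"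
proof -
  have "bounded (f ` (cbox 0 1 \<times> {0..T}))"
    by (intro compact_imp_bounded compact_continuous_image smooth_continuous_on
        torus_smooth_smooth assms compact_Times) auto
  then obtain B where B: "B > 0" "\<And>z. z \<in> cbox 0 1 \<times> {0..T} \<Longrightarrow> \<bar>f z\<bar> \<le> B"
    unfolding bounded_pos by fastforce
  have "\<bar>f (x, t)\<bar> \<le> B" if t: "t \<in> {0..T}" for x t
  proof -
    obtain y k where yk: "y \<in> cbox 0 1" "\<And>i. k $ i \<in> \<int>" "x = y + k" by (rule fundamental_domain[of x]) blast
    show ?thesis using B(2)[of "(y, t)"] t yk Zd_periodic_add[OF torus_smooth_periodic[OF assms], of k y t] by simp
  qed
  with B(1) that show thesis by blast
qed

section \<open>The Fokker--Planck equation\<close>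

abbreviation dx :: "'d \<Rightarrow> ((real^'d) \<times> real \<Rightarrow> real) \<Rightarrow> (real^'d) \<times> real \<Rightarrow> real" where
  "dx i f \<equiv> dderiv f (axis i 1, 0)"

text \<open>For a solution of the system the drift D_pH(x, Du) counts as a given smooth field, so
  positivity, mass conservation and the evolution of the integral of m^r concern a linear
  equation.\<close>

locale fokker_planck =
  fixes b :: "'d::finite \<Rightarrow> (real^'d) \<times> real \<Rightarrow> real" and m :: "(real^'d) \<times> real \<Rightarrow> real" and T :: real
  assumes T: "T > 0"
    and b: "\<And>i. torus_smooth (b i)" and m: "torus_smooth m"
    and eq: "\<And>x t. t \<in> {0..T} \<Longrightarrow>
       dderiv m (0, 1) (x, t) = (\<Sum>i\<in>UNIV. dx i (dx i m) (x, t)) + (\<Sum>i\<in>UNIV. dx i (\<lambda>z. m z * b i z) (x, t))"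
begin

definition divb :: "(real^'d) \<times> real \<Rightarrow> real" where
  "divb z = (\<Sum>i\<in>UNIV. dx i (b i) z)"

lemma divb: "torus_smooth divb"
  unfolding divb_def[abs_def] by (intro torus_smooth_intros b)

lemma mb: "torus_smooth (\<lambda>z. m z * b i z)"
  by (intro torus_smooth_intros m b)

lemma dx_mb: "dx i (\<lambda>z. m z * b i z) z = m z * dx i (b i) z + dx i m z * b i z"
  using m b by (intro dderiv_mult smooth_fun_differentiable torus_smooth_smooth)

lemma weak_form:
  assumes t: "t \<in> {0..T}" and \<phi>: "torus_smooth \<phi>"
  shows "torus_integral (\<lambda>x. dderiv m (0, 1) (x, t) * \<phi> (x, t)) =
    - (\<Sum>i\<in>UNIV. torus_integral (\<lambda>x. dx i m (x, t) * dx i \<phi> (x, t)))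
    - (\<Sum>i\<in>UNIV. torus_integral (\<lambda>x. m (x, t) * b i (x, t) * dx i \<phi> (x, t)))"
proof -
  note c = slice_continuous
  note I = torus_smooth_intros m b \<phi>
  have "torus_integral (\<lambda>x. dderiv m (0, 1) (x, t) * \<phi> (x, t)) =
    torus_integral (\<lambda>x. (\<Sum>i\<in>UNIV. \<phi> (x, t) * dx i (dx i m) (x, t)) + (\<Sum>i\<in>UNIV. \<phi> (x, t) * dx i (\<lambda>z. m z * b i z) (x, t)))"
    using eq[OF t] by (simp add: algebra_simps sum_distrib_right sum_distrib_left)
  also have "\<dots> = (\<Sum>i\<in>UNIV. torus_integral (\<lambda>x. \<phi> (x, t) * dx i (dx i m) (x, t)))
      + (\<Sum>i\<in>UNIV. torus_integral (\<lambda>x. \<phi> (x, t) * dx i (\<lambda>z. m z * b i z) (x, t)))"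
    by (subst torus_integral_add, (intro continuous_on_sum continuous_on_mult c I)+,
        (subst torus_integral_sum, intro continuous_on_mult c I)+, rule refl)
  also have "\<dots> = - (\<Sum>i\<in>UNIV. torus_integral (\<lambda>x. dx i \<phi> (x, t) * dx i m (x, t)))
      - (\<Sum>i\<in>UNIV. torus_integral (\<lambda>x. dx i \<phi> (x, t) * (m (x, t) * b i (x, t))))"
    using torus_smooth_by_parts[OF \<phi> torus_smooth_dderiv[OF m]] torus_smooth_by_parts[OF \<phi> mb]
    by (simp add: sum_negf)
  finally show ?thesis by (simp add: mult_ac)
qed

text \<open>If \<open>v = e^(-\<lambda>t) m - \<kappa> e^(-2\<lambda>t)\<close> had a nonpositive minimum, then \<open>v\<^sub>t > 0\<close> there
  as soon as \<open>\<lambda> > |div b|\<close>.\<close>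

lemma density_positive:
  assumes m0: "\<And>x. m (x, 0) > \<kappa>" "\<kappa> > 0"
  shows "t \<in> {0..T} \<Longrightarrow> m (x, t) > 0"
proof -
  obtain K where K: "K > 0" "\<And>x t. t \<in> {0..T} \<Longrightarrow> \<bar>divb (x, t)\<bar> \<le> K"
    using torus_smooth_bounded[OF divb] by metis
  define l where "l = K + 1"
  define v where "v x t = exp (- l * t) * m (x, t) - \<kappa> * exp (- 2 * l * t)" for x t
  let ?Q = "cbox 0 1 \<times> {0..T} :: ((real^'d) \<times> real) set"
  have "continuous_on ?Q (\<lambda>z. v (fst z) (snd z))"
    unfolding v_def prod.collapse
    by (intro continuous_intros smooth_continuous_on[OF torus_smooth_smooth[OF m]])
  moreover have "compact ?Q" by (intro compact_Times) auto
  moreover have "(0, 0) \<in> ?Q" using T by (auto simp: mem_box_cart)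
  ultimately obtain z where z: "z \<in> ?Q" "\<And>y. y \<in> ?Q \<Longrightarrow> v (fst z) (snd z) \<le> v (fst y) (snd y)"
    using continuous_attains_inf[of ?Q "\<lambda>z. v (fst z) (snd z)"] by blast
  obtain x0 t0 where z0: "z = (x0, t0)" by (cases z)
  have t0: "t0 \<in> {0..T}" using z z0 by auto
  have min: "v x0 t0 \<le> v x t" if "t \<in> {0..T}" for x t
  proof -
    obtain y k where yk: "y \<in> cbox 0 1" "\<And>i. k $ i \<in> \<int>" "x = y + k" by (rule fundamental_domain[of x]) blast
    show ?thesis
      using z(2)[of "(y, t)"] that yk Zd_periodic_add[OF torus_smooth_periodic[OF m], of k y t] z0
      by (simp add: v_def)
  qed
  have "v x0 t0 > 0"
  proof (rule ccontr)
    assume "\<not> v x0 t0 > 0"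
    then have v0: "v x0 t0 \<le> 0" by simp
    have "t0 \<noteq> 0" using v0 m0(1)[of x0] by (auto simp: v_def)
    then have tp: "t0 > 0" using t0 by simp
    have mmin: "m (x0, t0) \<le> m (x, t0)" for x
      using min[OF t0, of x] by (simp add: v_def)
    have ax: "dx i (dx i m) (x0, t0) \<ge> 0 \<and> dx i m (x0, t0) = 0" for i
    proof -
      have 1: "((\<lambda>s. f ((x0, t0) + s *\<^sub>R (axis i 1, 0))) has_real_derivative
           dx i f ((x0, t0) + s *\<^sub>R (axis i 1, 0))) (at s)" if "torus_smooth f" for f s
        by (rule smooth_fun_DERIV_line[OF torus_smooth_smooth[OF that]])
      have 2: "m ((x0, t0) + 0 *\<^sub>R (axis i 1, 0)) \<le> m ((x0, t0) + s *\<^sub>R (axis i 1, 0))" for s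
        using mmin by simp
      show ?thesis
        using second_derivative_at_min_nonneg[OF 1[OF m] 1[OF torus_smooth_dderiv[OF m]] 2]
          derivative_at_min_eq_0[OF 1[OF m] 1[OF torus_smooth_dderiv[OF m]] 2] by simp
    qed
    have mt: "dderiv m (0, 1) (x0, t0) \<ge> divb (x0, t0) * m (x0, t0)"
      unfolding eq[OF t0] dx_mb divb_def sum_distrib_right using ax
      by (simp add: sum_nonneg mult.commute)
    let ?e = "exp (- l * t0)"
    have e2: "exp (- 2 * l * t0) = ?e * ?e" by (simp add: exp_add[symmetric])
    have D: "((\<lambda>s. v x0 s) has_real_derivative
       ?e * dderiv m (0, 1) (x0, t0) - l * ?e * m (x0, t0) + 2 * l * \<kappa> * (?e * ?e)) (at t0)"
    proof -
      have "((\<lambda>s. m (x0, s)) has_real_derivative dderiv m (0, 1) (x0, t0)) (at t0)"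
        using smooth_fun_DERIV_line[OF torus_smooth_smooth[OF m], of "(x0, 0)" "(0, 1)" t0] by simp
      then show ?thesis
        unfolding v_def e2[symmetric] by (auto intro!: derivative_eq_intros simp: algebra_simps)
    qed
    have dl: "l + divb (x0, t0) > 0" "l - divb (x0, t0) > 0" using K(2)[OF t0, of x0] by (auto simp: l_def)
    \<comment> \<open>Write e for exp(-l t0). Since v \<le> 0 means e m \<le> \<kappa> e^2, the time
      derivative of v is at least -(l - div b) e m + 2 l \<kappa> e^2 \<ge> (l + div b) \<kappa> e^2
      > 0. So v is smaller slightly before t0, against minimality.\<close>
    have "?e * m (x0, t0) \<le> \<kappa> * (?e * ?e)" using v0 unfolding v_def e2 by simp
    then have "(l - divb (x0, t0)) * (?e * m (x0, t0)) \<le> (l - divb (x0, t0)) * (\<kappa> * (?e * ?e))"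
      using dl by (intro mult_left_mono) auto
    moreover have "?e * (divb (x0, t0) * m (x0, t0)) \<le> ?e * dderiv m (0, 1) (x0, t0)"
      using mt by (intro mult_left_mono) auto
    moreover have "(l + divb (x0, t0)) * (\<kappa> * (?e * ?e)) > 0" using dl m0 by simp
    moreover have "e * m' - l * e * y + 2 * l * \<kappa> * (e * e) > 0"
      if "(l - c) * (e * y) \<le> (l - c) * (\<kappa> * (e * e))" "e * (c * y) \<le> e * m'" "(l + c) * (\<kappa> * (e * e)) > 0"
      for c e y m' :: real
      using that by (simp add: algebra_simps)
    ultimately have "?e * dderiv m (0, 1) (x0, t0) - l * ?e * m (x0, t0) + 2 * l * \<kappa> * (?e * ?e) > 0"
      by blast
    from DERIV_pos_inc_left[OF D this] obtain d where d: "d > 0" "\<And>h. 0 < h \<Longrightarrow> h < d \<Longrightarrow> v x0 (t0 - h) < v x0 t0"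
      by blast
    define h where "h = min (d / 2) t0"
    have "v x0 (t0 - h) < v x0 t0" using d tp by (intro d(2)) (auto simp: h_def)
    moreover have "t0 - h \<in> {0..T}" using t0 tp d by (auto simp: h_def)
    ultimately show False using min[of "t0 - h" x0] by simp
  qed
  then have pos: "v x t > 0" if "t \<in> {0..T}" for x t using min[OF that, of x] by linarith
  then show "m (x, t) > 0" if "t \<in> {0..T}"
  proof -
    have "exp (- l * t) * m (x, t) > 0"
      using pos[OF that, of x] m0(2) by (smt (verit) v_def exp_gt_zero mult_pos_pos)
    then show ?thesis by (simp add: zero_less_mult_iff)
  qed
qed

lemma mass_conservation:
  assumes "t \<in> {0..T}"
  shows "torus_integral (\<lambda>x. m (x, t)) = torus_integral (\<lambda>x. m (x, 0))"
proof -
  have "((\<lambda>t. torus_integral (\<lambda>x. m (x, t))) has_real_derivative 0) (at s within {0..T})" if "s \<in> {0..T}" for s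
  proof -
    have "dx i (\<lambda>z. 1) z = 0" for i :: 'd and z by (intro dderiv_eqI[THEN trans]) auto
    then have "torus_integral (\<lambda>x. dderiv m (0, 1) (x, s)) = 0"
      using weak_form[OF that torus_smooth_const[of 1]] by (simp add: torus_integral_const)
    with torus_smooth_DERIV[OF m, of s] show ?thesis by (metis has_field_derivative_at_within)
  qed
  from has_field_derivative_zero_constant[OF _ this]
  obtain c where "\<And>s. s \<in> {0..T} \<Longrightarrow> torus_integral (\<lambda>x. m (x, s)) = c" by auto
  then show ?thesis using assms T by simp
qed

text \<open>Test with m^(r-1). The diffusion gives Dm . D m^(r-1) = 4(r-1)/r^2 |D m^(r/2)|^2, and
  the transport gives m b . D m^(r-1) = (r-1)/r b . D m^r. A further integration by parts makes the
  drift enter only through its divergence.\<close>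

lemma density_power_derivative:
  assumes pos: "\<And>x t. t \<in> {0..T} \<Longrightarrow> m (x, t) > 0" and r: "r > 0" and t: "t \<in> {0..T}"
  shows "((\<lambda>t. torus_integral (\<lambda>x. m (x, t) powr r)) has_real_derivative
     (- (4 * (r - 1) / r) * torus_integral (grad_sq (\<lambda>x. m (x, t) powr (r / 2)))
      + (r - 1) * torus_integral (\<lambda>x. m (x, t) powr r * divb (x, t)))) (at t within {0..T})"
proof -
  let ?m = "\<lambda>x. m (x, t)"
  let ?w = "\<lambda>x. ?m x powr (r / 2)"
  let ?\<phi> = "\<lambda>x. ?m x powr (r - 1)"
  let ?D = "\<lambda>i x. dx i m (x, t)"
  let ?A = "\<Sum>i\<in>UNIV. torus_integral (\<lambda>x. ?D i x * dderiv ?\<phi> (axis i 1) x)"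
  let ?B = "\<Sum>i\<in>UNIV. torus_integral (\<lambda>x. m (x, t) * b i (x, t) * dderiv ?\<phi> (axis i 1) x)"
  let ?C = "\<Sum>i\<in>UNIV. torus_integral (\<lambda>x. b i (x, t) * dderiv (\<lambda>x. ?m x powr r) (axis i 1) x)"
  let ?E = "\<Sum>i\<in>UNIV. torus_integral (\<lambda>x. ?m x powr r * dx i (b i) (x, t))"
  let ?F = "\<Sum>i\<in>UNIV. torus_integral (\<lambda>x. (dderiv ?w (axis i 1) x)\<^sup>2)"
  let ?R = "torus_integral (\<lambda>x. r * m (x, t) powr (r - 1) * dderiv m (0, 1) (x, t))"
  have mt: "?m x > 0" for x using pos[OF t] .
  have sm: "smooth_fun ?m" "Zd_periodic ?m" by (intro torus_smooth_slice m)+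
  have sp: "smooth_fun (\<lambda>x. ?m x powr a)" "Zd_periodic (\<lambda>x. ?m x powr a)" for a
    by (intro smooth_fun_powr sm mt) (rule Zd_periodic_compose[OF sm(2)])
  have dpow: "dderiv (\<lambda>x. ?m x powr a) (axis i 1) x = a * (?m x powr (a - 1) * ?D i x)" for a i x
    using dderiv_powr(1)[OF smooth_fun_differentiable[OF sm(1)] mt, of a "axis i 1" x] by (simp add: dderiv_slice)
  have cm: "continuous_on ({0..T} \<times> UNIV) (\<lambda>z. f (snd z, fst z))" if "torus_smooth f" for f
    by (rule continuous_on_compose2[OF smooth_continuous_on[OF torus_smooth_smooth[OF that], of UNIV]])
      (auto intro!: continuous_intros)
  have der: "((\<lambda>t. torus_integral (\<lambda>x. m (x, t) powr r)) has_real_derivative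
     ?R) (at t within {0..T})"
  proof (rule DERIV_torus_integral)
    show "((\<lambda>s. m (x, s) powr r) has_real_derivative r * m (x, s) powr (r - 1) * dderiv m (0, 1) (x, s)) (at s within {0..T})"
      if "s \<in> {0..T}" for s x
    proof -
      have "((\<lambda>s. m (x, s)) has_real_derivative dderiv m (0, 1) (x, s)) (at s)"
        using smooth_fun_DERIV_line[OF torus_smooth_smooth[OF m], of "(x, 0)" "(0, 1)" s] by simp
      from DERIV_chain2[OF has_real_derivative_powr[OF pos[OF that]] this, of r]
      show ?thesis by (rule has_field_derivative_at_within)
    qed
    show "continuous_on UNIV (\<lambda>x. m (x, s) powr r)" if "s \<in> {0..T}" for s
      using pos[OF that] by (intro smooth_continuous_on smooth_fun_powr torus_smooth_slice m)
    show "continuous_on ({0..T} \<times> UNIV) (\<lambda>(s, x). r * m (x, s) powr (r - 1) * dderiv m (0, 1) (x, s))"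
      unfolding split_def
      by (intro continuous_on_mult continuous_on_const continuous_on_powr cm m torus_smooth_dderiv)
        (use pos in \<open>auto simp: less_imp_neq[symmetric]\<close>)
  qed (use t in auto)
  have "?R =
     r * torus_integral (\<lambda>x. dderiv m (0, 1) (x, t) * ?\<phi> x)"
    by (subst torus_integral_cmult[symmetric]) (simp add: mult_ac)
  also have "torus_integral (\<lambda>x. dderiv m (0, 1) (x, t) * ?\<phi> x) =
      - ?A
      - ?B"
  proof -
    \<comment> \<open>The test function is the slice at time t, extended constantly in time: outside
      {0..T} positivity of \<open>m\<close> is unknown, so m^(r-1) need not be smooth in
      space-time.\<close>
    have "dx i (\<lambda>z. ?\<phi> (fst z)) (x, t) = dderiv ?\<phi> (axis i 1) x" for i x
      by (simp add: dderiv_def)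
    then show ?thesis using weak_form[OF t torus_smooth_lift[OF sp, of "r - 1"]] by simp
  qed
  also have "?A =
     (4 * (r - 1) / r\<^sup>2) * torus_integral (grad_sq ?w)"
  proof -
    have "?D i x * dderiv ?\<phi> (axis i 1) x = (4 * (r - 1) / r\<^sup>2) * (dderiv ?w (axis i 1) x)\<^sup>2" for i x
    proof -
      have "(?m x powr (r / 2 - 1))\<^sup>2 = ?m x powr (r - 1 - 1)"
        by (simp add: power2_eq_square powr_add[symmetric])
      then show ?thesis
        unfolding dpow power_mult_distrib using r by (simp add: field_simps power2_eq_square)
    qed
    then have "?A =
      (\<Sum>i\<in>UNIV. torus_integral (\<lambda>x. (4 * (r - 1) / r\<^sup>2) * (dderiv ?w (axis i 1) x)\<^sup>2))"
      by simp
    also have "\<dots> = (4 * (r - 1) / r\<^sup>2) * ?F"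
      unfolding torus_integral_cmult sum_distrib_left ..
    also have "?F =
      torus_integral (grad_sq ?w)"
      unfolding grad_sq_def[abs_def]
      by (rule torus_integral_sum[symmetric]) (intro continuous_intros smooth_continuous_on smooth_fun_dderiv sp)
    finally show ?thesis .
  qed
  also have "?B =
     - ((r - 1) / r) * torus_integral (\<lambda>x. m (x, t) powr r * divb (x, t))"
  proof -
    have "m (x, t) * b i (x, t) * dderiv ?\<phi> (axis i 1) x =
       ((r - 1) / r) * (b i (x, t) * dderiv (\<lambda>x. ?m x powr r) (axis i 1) x)" for i x
    proof -
      have "?m x * ?m x powr (r - 1 - 1) = ?m x powr (r - 1)"
        using mt[of x] by (simp add: powr_mult_base)
      moreover have "y * c * ((r - 1) * (p * e)) = ((r - 1) / r) * (c * (r * (q * e)))" if "y * p = q" for y c p q e :: real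
        using r unfolding that[symmetric] by simp
      ultimately show ?thesis unfolding dpow by blast
    qed
    then have "?B =
      ((r - 1) / r) * ?C"
      unfolding sum_distrib_left torus_integral_cmult[symmetric] by (simp only:)
    also have "?C =
      - ?E"
      unfolding sum_negf[symmetric]
      by (rule sum.cong[OF refl], subst torus_integral_by_parts[OF torus_smooth_slice[OF b] sp])
        (simp add: dderiv_slice mult.commute)
    also have "?E =
      torus_integral (\<lambda>x. m (x, t) powr r * divb (x, t))"
      unfolding divb_def sum_distrib_left
      by (rule torus_integral_sum[symmetric])
        (intro continuous_on_mult smooth_continuous_on sp torus_smooth_slice torus_smooth_dderiv b)
    finally show ?thesis by simp
  qed
  finally have eq_t: "?R =
    r * (- (4 * (r - 1) / r\<^sup>2 * torus_integral (grad_sq ?w))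
      - - ((r - 1) / r) * torus_integral (\<lambda>x. m (x, t) powr r * divb (x, t)))" .
  have alg: "r * (- (4 * (r - 1) / r\<^sup>2 * P) - - ((r - 1) / r) * Q) = - (4 * (r - 1) / r) * P + (r - 1) * Q" for P Q :: real
    using r by (simp add: field_simps power2_eq_square)
  show ?thesis using der unfolding eq_t alg .
qed

end

section \<open>Composition of the Hamiltonian with the gradient\<close>

text \<open>The argument at which \<open>H\<close> is evaluated along a solution, (x, Du). Functions
  such as H(x, Du) become composites with \<open>jet u\<close>, and a single chain rule handles them
  all.\<close>

definition jet :: "((real^'d) \<times> real \<Rightarrow> real) \<Rightarrow> (real^'d) \<times> real \<Rightarrow> (real^'d) \<times> (real^'d)" where
  "jet u z = (fst z, \<chi> i. dx i u z)"

lemma has_derivative_vec_lambda: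
  fixes f :: "'n::finite \<Rightarrow> 'a::real_normed_vector \<Rightarrow> real"
  assumes "\<And>i. (f i has_derivative f' i) F"
  shows "((\<lambda>z. \<chi> i. f i z) has_derivative (\<lambda>v. \<chi> i. f' i v)) F"
proof -
  have *: "(\<chi> i. c i) = (\<Sum>i\<in>UNIV. c i *\<^sub>R axis i 1)" for c :: "'n \<Rightarrow> real"
    using axis_basis_sum[of "\<chi> i. c i"] by simp
  show ?thesis unfolding * by (auto intro!: derivative_eq_intros assms)
qed

lemma has_derivative_jet:
  assumes "torus_smooth u"
  shows "(jet u has_derivative (\<lambda>v. (fst v, \<chi> i. dderiv (dx i u) v z))) (at z)"
  unfolding jet_def[abs_def]
  by (intro has_derivative_Pair has_derivative_vec_lambda smooth_fun_has_derivative torus_smooth_smooth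
      torus_smooth_dderiv assms bounded_linear_imp_has_derivative bounded_linear_fst)

lemma dderiv_jet:
  assumes "torus_smooth u" "smooth_fun F"
  shows "dderiv (\<lambda>z. F (jet u z)) v z = dderiv F (fst v, \<chi> i. dderiv (dx i u) v z) (jet u z)"
  by (rule dderiv_eqI[OF has_derivative_compose[OF has_derivative_jet[OF assms(1)] smooth_fun_has_derivative[OF assms(2)]]])

lemma torus_smooth_jet:
  fixes F :: "(real^'d) \<times> (real^'d) \<Rightarrow> real"
  assumes u: "torus_smooth u" and F: "smooth_fun F" "\<And>p. Zd_periodic (\<lambda>x. F (x, p))"
  shows "torus_smooth (\<lambda>z. F (jet u z))"
  unfolding torus_smooth_def
proof
  show "smooth_fun (\<lambda>z. F (jet u z))"
  proof (rule smooth_fun_compose[OF F(1)])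
    fix b :: "(real^'d) \<times> (real^'d)"
    have "smooth_fun (\<lambda>z::(real^'d) \<times> real. fst z \<bullet> fst b + (\<Sum>i\<in>UNIV. dx i u z * snd b $ i))"
      by (intro smooth_fun_add smooth_fun_sum smooth_fun_mult smooth_fun_const torus_smooth_smooth
          torus_smooth_dderiv u smooth_fun_linear bounded_linear_compose[OF bounded_linear_inner_left bounded_linear_fst])
    then show "smooth_fun (\<lambda>z. jet u z \<bullet> b)"
      by (simp add: jet_def inner_prod_def inner_vec_def[of "\<chi> i. _ i"])
  qed
  show "\<forall>t. Zd_periodic (\<lambda>x. F (jet u (x, t)))"
    unfolding Zd_periodic_def
  proof (intro allI impI)
    fix t x and k :: "real^'d" assume k: "\<forall>i. k $ i \<in> \<int>"
    have "dx i u (x + k, t) = dx i u (x, t)" for i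
      using Zd_periodic_add[OF torus_smooth_periodic[OF torus_smooth_dderiv[OF u]], of k] k by simp
    then show "F (jet u (x + k, t)) = F (jet u (x, t))"
      using Zd_periodic_add[OF F(2), of k] k by (simp add: jet_def)
  qed
qed

lemma Zd_periodic_dderiv_Pair:
  assumes "\<And>p. Zd_periodic (\<lambda>x. F (x, p))"
  shows "Zd_periodic (\<lambda>x. dderiv F v (x, p))"
proof -
  have "F ((x + k, p) + s *\<^sub>R v) = F ((x, p) + s *\<^sub>R v)" if "\<forall>i. k $ i \<in> \<int>" for x k s
    using Zd_periodic_add[OF assms, of k "x + s *\<^sub>R fst v" "p + s *\<^sub>R snd v"] that
    by (cases v) (simp add: algebra_simps)
  then show ?thesis by (simp add: Zd_periodic_def dderiv_def)
qed

lemma dderiv_Pair_axis: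
  fixes F :: "(real^'d) \<times> (real^'d) \<Rightarrow> real"
  assumes "smooth_fun F"
  shows "dderiv F (a, c) z = dderiv F (a, 0) z + (\<Sum>j\<in>UNIV. c $ j * dderiv F (0, axis j 1) z)"
proof -
  have "linear (Pair 0 :: real^'d \<Rightarrow> (real^'d) \<times> (real^'d))" by (intro linearI) auto
  from dderiv_linear_axis[OF assms this, of c z] show ?thesis
    using linear_add[OF linear_dderiv[OF assms, of z], of "(a, 0)" "(0, c)"] by simp
qed

lemma dx_jet:
  fixes F :: "(real^'d) \<times> (real^'d) \<Rightarrow> real"
  assumes "torus_smooth u" "smooth_fun F"
  shows "dx k (\<lambda>z. F (jet u z)) z =
     dderiv F (axis k 1, 0) (jet u z) + (\<Sum>j\<in>UNIV. dx k (dx j u) z * dderiv F (0, axis j 1) (jet u z))"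
  unfolding dderiv_jet[OF assms] by (subst dderiv_Pair_axis[OF assms(2)]) simp

definition lap :: "((real^'d) \<times> real \<Rightarrow> real) \<Rightarrow> (real^'d) \<times> real \<Rightarrow> real" where
  "lap f z = (\<Sum>i\<in>UNIV. dx i (dx i f) z)"

lemma torus_smooth_lap: "torus_smooth f \<Longrightarrow> torus_smooth (lap f)"
  unfolding lap_def[abs_def] by (intro torus_smooth_intros)

lemma dderiv_sum:
  "(\<And>i. i \<in> A \<Longrightarrow> smooth_fun (f i)) \<Longrightarrow> dderiv (\<lambda>z. \<Sum>i\<in>A. f i z) v z = (\<Sum>i\<in>A. dderiv (f i) v z)"
  by (rule dderiv_eqI) (intro has_derivative_sum smooth_fun_has_derivative)

lemma dderiv_diff:
  "smooth_fun f \<Longrightarrow> smooth_fun g \<Longrightarrow> dderiv (\<lambda>z. f z - g z) v z = dderiv f v z - dderiv g v z"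
  by (rule dderiv_eqI) (intro has_derivative_diff smooth_fun_has_derivative)

lemma dderiv_lap:
  assumes "torus_smooth f"
  shows "dderiv (lap f) v z = lap (dderiv f v) z"
proof -
  have sm: "smooth_fun f" using assms by (rule torus_smooth_smooth)
  have "dderiv (lap f) v z = (\<Sum>i\<in>UNIV. dderiv (dx i (dx i f)) v z)"
    unfolding lap_def[abs_def] by (intro dderiv_sum smooth_fun_dderiv sm)
  also have "\<dots> = (\<Sum>i\<in>UNIV. dx i (dx i (dderiv f v)) z)"
  proof (rule sum.cong[OF refl])
    fix i
    have "dderiv (dx i f) v = dx i (dderiv f v)" using dderiv_commute[OF sm] by blast
    then show "dderiv (dx i (dx i f)) v z = dx i (dx i (dderiv f v)) z"
      using dderiv_commute[OF smooth_fun_dderiv[OF sm]] by metis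
  qed
  finally show ?thesis by (simp add: lap_def)
qed

lemma lap_diff:
  assumes "torus_smooth f" "torus_smooth g"
  shows "lap (\<lambda>z. f z - g z) z = lap f z - lap g z"
proof -
  have sm: "smooth_fun f" "smooth_fun g" using assms by (auto intro: torus_smooth_smooth)
  have "dx i (\<lambda>z. f z - g z) = (\<lambda>z. dx i f z - dx i g z)" for i
    using dderiv_diff[OF sm] by blast
  then have "dx i (dx i (\<lambda>z. f z - g z)) z = dx i (dx i f) z - dx i (dx i g) z" for i
    by (simp add: dderiv_diff smooth_fun_dderiv sm)
  then show ?thesis by (simp add: lap_def sum_subtractf)
qed

lemma torus_integral_lap:
  assumes "torus_smooth f" "torus_smooth g"
  shows "torus_integral (\<lambda>x. f (x, t) * lap g (x, t)) = torus_integral (\<lambda>x. g (x, t) * lap f (x, t))"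
proof -
  note c = slice_continuous torus_smooth_intros assms
  have "torus_integral (\<lambda>x. p (x, t) * lap q (x, t)) =
     - (\<Sum>i\<in>UNIV. torus_integral (\<lambda>x. dx i p (x, t) * dx i q (x, t)))"
    if "torus_smooth p" "torus_smooth q" for p q
    unfolding lap_def sum_distrib_left
    by (subst torus_integral_sum, intro continuous_on_mult c that)
      (simp add: torus_smooth_by_parts that torus_smooth_dderiv sum_negf)
  from this[OF assms] this[OF assms(2,1)] show ?thesis by (simp add: mult.commute)
qed

section \<open>Space-time integrals\<close>

definition spacetime_integral :: "real \<Rightarrow> ((real^'d) \<times> real \<Rightarrow> real) \<Rightarrow> real" where
  "spacetime_integral T f = integral {0..T} (\<lambda>t. torus_integral (\<lambda>x. f (x, t)))"

lemma spacetime_integrable: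
  "torus_smooth f \<Longrightarrow> (\<lambda>t. torus_integral (\<lambda>x. f (x, t))) integrable_on {0..T}"
  using integrable_continuous_interval torus_smooth_integral_continuous by blast

lemma spacetime_integral_add: "torus_smooth f \<Longrightarrow> torus_smooth g \<Longrightarrow>
    spacetime_integral T (\<lambda>z. f z + g z) = spacetime_integral T f + spacetime_integral T g"
  unfolding spacetime_integral_def
  by (subst torus_integral_add, (intro slice_continuous; assumption)+, rule integral_add)
    (intro spacetime_integrable; assumption)+

lemma spacetime_integral_cmult: "spacetime_integral T (\<lambda>z. c * f z) = c * spacetime_integral T f"
  unfolding spacetime_integral_def by (simp add: torus_integral_cmult)

lemma spacetime_integral_diff: "torus_smooth f \<Longrightarrow> torus_smooth g \<Longrightarrow>
    spacetime_integral T (\<lambda>z. f z - g z) = spacetime_integral T f - spacetime_integral T g"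
  using spacetime_integral_add[of f "\<lambda>z. - 1 * g z" T] spacetime_integral_cmult[of T "-1" g]
  by (simp add: torus_smooth_minus)

lemma spacetime_integral_const: "T \<ge> 0 \<Longrightarrow> spacetime_integral T (\<lambda>z. c) = T * c"
  unfolding spacetime_integral_def by (simp add: torus_integral_const)

text \<open>Integration by parts in space compares integrals over a time slice and not integrands,
  so a pointwise hypothesis would be too strong for the uses below.\<close>

lemma spacetime_integral_mono_slices:
  assumes "torus_smooth f" "torus_smooth g"
    "\<And>t. t \<in> {0..T} \<Longrightarrow> torus_integral (\<lambda>x. f (x, t)) \<le> torus_integral (\<lambda>x. g (x, t))"
  shows "spacetime_integral T f \<le> spacetime_integral T g"
  unfolding spacetime_integral_def
  by (intro integral_le spacetime_integrable assms)

lemma spacetime_integral_mono: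
  assumes "torus_smooth f" "torus_smooth g" "\<And>t x. t \<in> {0..T} \<Longrightarrow> f (x, t) \<le> g (x, t)"
  shows "spacetime_integral T f \<le> spacetime_integral T g"
  by (intro spacetime_integral_mono_slices torus_integral_mono slice_continuous assms)

lemma spacetime_integral_nonneg:
  assumes "torus_smooth f" "\<And>t x. t \<in> {0..T} \<Longrightarrow> f (x, t) \<ge> 0" "T \<ge> 0"
  shows "spacetime_integral T f \<ge> 0"
  using spacetime_integral_mono[OF torus_smooth_const assms(1), of T 0] assms(2,3)
  by (simp add: spacetime_integral_const)

lemma spacetime_integral_cong_slices:
  assumes "\<And>t. t \<in> {0..T} \<Longrightarrow> torus_integral (\<lambda>x. f (x, t)) = torus_integral (\<lambda>x. g (x, t))"
  shows "spacetime_integral T f = spacetime_integral T g"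
  unfolding spacetime_integral_def using assms by (intro integral_cong) auto

lemma spacetime_integral_dt:
  assumes "torus_smooth f" "T \<ge> 0"
  shows "spacetime_integral T (dderiv f (0, 1)) = torus_integral (\<lambda>x. f (x, T)) - torus_integral (\<lambda>x. f (x, 0))"
proof -
  have "((\<lambda>t. torus_integral (\<lambda>x. dderiv f (0, 1) (x, t))) has_integral
     (torus_integral (\<lambda>x. f (x, T)) - torus_integral (\<lambda>x. f (x, 0)))) {0..T}"
    by (rule fundamental_theorem_of_calculus[OF assms(2)])
      (use has_field_derivative_at_within[OF torus_smooth_DERIV[OF assms(1)]] in
        \<open>simp add: has_real_derivative_iff_has_vector_derivative[symmetric]\<close>)
  then show ?thesis unfolding spacetime_integral_def by (rule integral_unique)
qed

section \<open>Duality between the Fokker-Planck equation and test functions\<close>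

context fokker_planck
begin

lemma weak_form_lap:
  assumes t: "t \<in> {0..T}" and \<phi>: "torus_smooth \<phi>"
  shows "torus_integral (\<lambda>x. dderiv m (0, 1) (x, t) * \<phi> (x, t)) =
    torus_integral (\<lambda>x. m (x, t) * (lap \<phi> (x, t) - (\<Sum>i\<in>UNIV. b i (x, t) * dx i \<phi> (x, t))))"
proof -
  note c = slice_continuous torus_smooth_intros m b \<phi> torus_smooth_lap
  have "torus_integral (\<lambda>x. m (x, t) * (lap \<phi> (x, t) - (\<Sum>i\<in>UNIV. b i (x, t) * dx i \<phi> (x, t)))) =
    torus_integral (\<lambda>x. m (x, t) * lap \<phi> (x, t) - (\<Sum>i\<in>UNIV. m (x, t) * b i (x, t) * dx i \<phi> (x, t)))"
    by (simp add: right_diff_distrib sum_distrib_left mult.assoc)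
  also have "\<dots> = torus_integral (\<lambda>x. m (x, t) * lap \<phi> (x, t))
      - (\<Sum>i\<in>UNIV. torus_integral (\<lambda>x. m (x, t) * b i (x, t) * dx i \<phi> (x, t)))"
    by (subst torus_integral_diff, (intro continuous_on_mult continuous_on_sum c)+,
        subst torus_integral_sum, (intro continuous_on_mult c)+, rule refl)
  also have "torus_integral (\<lambda>x. m (x, t) * lap \<phi> (x, t)) = - (\<Sum>i\<in>UNIV. torus_integral (\<lambda>x. dx i m (x, t) * dx i \<phi> (x, t)))"
    unfolding lap_def sum_distrib_left
    by (subst torus_integral_sum, intro continuous_on_mult c)
      (simp add: torus_smooth_by_parts m \<phi> torus_smooth_dderiv sum_negf)
  finally show ?thesis using weak_form[OF t \<phi>] by simp
qed

text \<open>All space derivatives are moved onto the test function, leaving the adjoint operator.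
  Along a solution it linearizes the Hamilton-Jacobi operator, so \<phi> = u and \<phi> = \<Delta>u
  both simplify.\<close>

lemma dt_duality:
  assumes t: "t \<in> {0..T}" and \<phi>: "torus_smooth \<phi>"
  shows "torus_integral (\<lambda>x. dderiv (\<lambda>z. m z * \<phi> z) (0, 1) (x, t)) =
    torus_integral (\<lambda>x. m (x, t) * (dderiv \<phi> (0, 1) (x, t) + lap \<phi> (x, t) - (\<Sum>i\<in>UNIV. b i (x, t) * dx i \<phi> (x, t))))"
proof -
  note c = slice_continuous torus_smooth_intros m b \<phi> torus_smooth_lap
  have "dderiv (\<lambda>z. m z * \<phi> z) (0, 1) (x, t) = m (x, t) * dderiv \<phi> (0, 1) (x, t) + dderiv m (0, 1) (x, t) * \<phi> (x, t)" for x
    using m \<phi> by (intro dderiv_mult smooth_fun_differentiable torus_smooth_smooth)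
  then have "torus_integral (\<lambda>x. dderiv (\<lambda>z. m z * \<phi> z) (0, 1) (x, t)) =
     torus_integral (\<lambda>x. m (x, t) * dderiv \<phi> (0, 1) (x, t)) + torus_integral (\<lambda>x. dderiv m (0, 1) (x, t) * \<phi> (x, t))"
    by (simp only:) (rule torus_integral_add; intro continuous_on_mult c)
  also have "\<dots> = torus_integral (\<lambda>x. m (x, t) * dderiv \<phi> (0, 1) (x, t) +
     m (x, t) * (lap \<phi> (x, t) - (\<Sum>i\<in>UNIV. b i (x, t) * dx i \<phi> (x, t))))"
    unfolding weak_form_lap[OF t \<phi>]
    by (rule torus_integral_add[symmetric]; intro continuous_on_mult continuous_on_diff continuous_on_sum c)
  finally show ?thesis by (simp add: algebra_simps)
qed

end

section \<open>Derivatives of the Hamiltonian along a solution\<close>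

lemma dderiv_cmult: "smooth_fun f \<Longrightarrow> dderiv (\<lambda>z. c * f z) v z = c * dderiv f v z"
  by (rule dderiv_eqI) (intro has_derivative_mult_right smooth_fun_has_derivative)

lemma dderiv_dderiv_Pair_axis:
  fixes F :: "(real^'d) \<times> (real^'d) \<Rightarrow> real"
  assumes F: "smooth_fun F"
  shows "dderiv (dderiv F (0, c)) (0, c) z =
    (\<Sum>i\<in>UNIV. \<Sum>j\<in>UNIV. c $ i * c $ j * dderiv (dderiv F (0, axis j 1)) (0, axis i 1) z)"
proof -
  have 1: "dderiv G (0, c) z = (\<Sum>j\<in>UNIV. c $ j * dderiv G (0, axis j 1) z)"
    if "smooth_fun G" for G :: "(real^'d) \<times> (real^'d) \<Rightarrow> real" and z
    using dderiv_Pair_axis[OF that, of 0 c z] linear_0[OF linear_dderiv[OF that, of z]] by (simp add: zero_prod_def)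
  have sm: "smooth_fun (dderiv F v)" for v using F by (rule smooth_fun_dderiv)
  have "dderiv F (0, c) = (\<lambda>z. \<Sum>j\<in>UNIV. c $ j * dderiv F (0, axis j 1) z)" using 1[OF F] by blast
  then have 2: "dderiv (dderiv F (0, c)) v z = (\<Sum>j\<in>UNIV. c $ j * dderiv (dderiv F (0, axis j 1)) v z)" for v
    by (simp add: dderiv_sum dderiv_cmult sm smooth_fun_mult smooth_fun_const)
  have "dderiv (dderiv F (0, c)) (0, c) z = (\<Sum>j\<in>UNIV. c $ j * (\<Sum>i\<in>UNIV. c $ i * dderiv (dderiv F (0, axis j 1)) (0, axis i 1) z))"
    by (simp only: 2[of "(0, c)"] 1[OF sm, of "(0, axis j 1)" z for j])
  also have "\<dots> = (\<Sum>i\<in>UNIV. \<Sum>j\<in>UNIV. c $ i * c $ j * dderiv (dderiv F (0, axis j 1)) (0, axis i 1) z)"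
    unfolding sum_distrib_left by (subst sum.swap) (simp add: mult_ac)
  finally show ?thesis .
qed

locale hamiltonian =
  fixes H :: "real^'d \<Rightarrow> real^'d \<Rightarrow> real"
  assumes H_smooth: "smooth_fun (\<lambda>(x, p). H x p)"
    and H_periodic: "\<And>p. Zd_periodic (\<lambda>x. H x p)"
begin

text \<open>Uncurried Hamiltonian: all its partial derivatives, mixed ones included, are directional
  derivatives of one smooth function, so that symmetry of second derivatives applies to
  them.\<close>

definition HH :: "(real^'d) \<times> (real^'d) \<Rightarrow> real" where
  "HH z = H (fst z) (snd z)"

lemma HH_smooth: "smooth_fun HH"
  using H_smooth by (simp add: HH_def[abs_def] split_def)

lemma HH_periodic: "Zd_periodic (\<lambda>x. HH (x, p))"
  using H_periodic by (simp add: HH_def)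

lemma dderiv_H: "dderiv (H x) v p = dderiv HH (0, v) (x, p)" "dderiv (\<lambda>y. H y p) v x = dderiv HH (v, 0) (x, p)"
  by (simp_all add: dderiv_def HH_def)

lemma dderiv_dderiv_HH:
  "dderiv (\<lambda>y. dderiv HH w (y, p)) v x = dderiv (dderiv HH w) (v, 0) (x, p)"
  "dderiv (\<lambda>q. dderiv HH w (x, q)) v p = dderiv (dderiv HH w) (0, v) (x, p)"
  by (simp_all add: dderiv_def[of _ v] dderiv_def[of _ "(v, 0)"] dderiv_def[of _ "(0, v)"])

lemma DpH_nth: "DpH H x p $ i = dderiv HH (0, axis i 1) (x, p)"
  and DxH_nth: "DxH H x p $ i = dderiv HH (axis i 1, 0) (x, p)"
  and DppH_nth: "DppH H x p $ i $ j = dderiv (dderiv HH (0, axis j 1)) (0, axis i 1) (x, p)"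
  and DxxH_nth: "DxxH H x p $ i $ j = dderiv (dderiv HH (axis j 1, 0)) (axis i 1, 0) (x, p)"
  and DpxH_nth: "DpxH H x p $ i $ j = dderiv (dderiv HH (axis j 1, 0)) (0, axis i 1) (x, p)"
  and DxpH_nth: "DxpH H x p $ i $ j = dderiv (dderiv HH (0, axis j 1)) (axis i 1, 0) (x, p)"
  unfolding DpH_def DxH_def DppH_def DxxH_def DpxH_def DxpH_def dderiv_H dderiv_dderiv_HH
  by simp_all

text \<open>Reconciles the two mixed Hessians: D^2_px occurs in the hypothesis behind the
  second-order estimate, D^2_xp in the divergence of the drift.\<close>

lemma DpxH_transpose: "DpxH H x p $ i $ j = DxpH H x p $ j $ i"
  unfolding DpxH_nth DxpH_nth by (rule dderiv_commute[OF HH_smooth])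

definition ham :: "((real^'d) \<times> real \<Rightarrow> real) \<Rightarrow> (real^'d) \<times> real \<Rightarrow> real" where
  "ham u z = HH (jet u z)"

definition drift :: "((real^'d) \<times> real \<Rightarrow> real) \<Rightarrow> 'd \<Rightarrow> (real^'d) \<times> real \<Rightarrow> real" where
  "drift u i z = dderiv HH (0, axis i 1) (jet u z)"

definition hess :: "((real^'d) \<times> real \<Rightarrow> real) \<Rightarrow> (real^'d) \<times> real \<Rightarrow> real^'d^'d" where
  "hess u z = (\<chi> i j. dx i (dx j u) z)"

abbreviation grad :: "((real^'d) \<times> real \<Rightarrow> real) \<Rightarrow> (real^'d) \<times> real \<Rightarrow> real^'d" where
  "grad u z \<equiv> snd (jet u z)"

lemma jet_eq: "jet u z = (fst z, grad u z)"
  by (simp add: jet_def)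

lemma ham_eq: "ham u z = H (fst z) (grad u z)"
  by (simp add: ham_def HH_def jet_def)

lemma torus_smooth_ham: "torus_smooth u \<Longrightarrow> torus_smooth (ham u)"
  unfolding ham_def[abs_def] by (rule torus_smooth_jet[OF _ HH_smooth HH_periodic])

lemma torus_smooth_jet_dderiv:
  assumes "torus_smooth u"
  shows "torus_smooth (\<lambda>z. dderiv HH v (jet u z))"
    "torus_smooth (\<lambda>z. dderiv (dderiv HH v) w (jet u z))"
  by (intro torus_smooth_jet assms smooth_fun_dderiv HH_smooth Zd_periodic_dderiv_Pair HH_periodic)+

lemma torus_smooth_drift: "torus_smooth u \<Longrightarrow> torus_smooth (drift u i)"
  unfolding drift_def[abs_def] by (rule torus_smooth_jet_dderiv)

lemma hess_nth: "hess u z $ i $ j = dx i (dx j u) z"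
  by (simp add: hess_def)

lemma hess_sym: "torus_smooth u \<Longrightarrow> hess u z $ i $ j = hess u z $ j $ i"
  unfolding hess_nth by (rule dderiv_commute) (rule torus_smooth_smooth)

lemma transpose_hess: "torus_smooth u \<Longrightarrow> transpose (hess u z) = hess u z"
  by (simp add: transpose_def vec_eq_iff hess_sym)

lemma torus_smooth_hess: "torus_smooth u \<Longrightarrow> torus_smooth (\<lambda>z. hess u z $ i $ j)"
  unfolding hess_nth by (intro torus_smooth_dderiv)

lemma trace_mult: "trace (A ** B) = (\<Sum>i\<in>UNIV. \<Sum>k\<in>UNIV. A $ i $ k * B $ k $ i)" for A B :: "real^'d^'d"
  by (simp add: trace_def matrix_matrix_mult_def)

lemma torus_smooth_trace:
  assumes u: "torus_smooth u"
  shows "torus_smooth (\<lambda>z. trace (DxxH H (fst z) (grad u z)))"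
    "torus_smooth (\<lambda>z. trace (DpxH H (fst z) (grad u z) ** hess u z))"
    "torus_smooth (\<lambda>z. trace (DppH H (fst z) (grad u z) ** (hess u z ** hess u z)))"
  unfolding trace_mult trace_def DxxH_nth DpxH_nth DppH_nth matrix_matrix_mult_def vec_lambda_beta jet_eq[symmetric]
  by (intro torus_smooth_sum torus_smooth_mult torus_smooth_hess u torus_smooth_jet_dderiv(2))+

lemma dx_drift:
  assumes u: "torus_smooth u"
  shows "dx k (drift u j) z = DxpH H (fst z) (grad u z) $ k $ j
     + (\<Sum>i\<in>UNIV. hess u z $ k $ i * DppH H (fst z) (grad u z) $ i $ j)"
  unfolding drift_def[abs_def] dx_jet[OF u smooth_fun_dderiv[OF HH_smooth]] DxpH_nth DppH_nth hess_nth
    jet_eq[symmetric] ..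

lemma div_drift:
  assumes u: "torus_smooth u"
  shows "(\<Sum>i\<in>UNIV. dx i (drift u i) z) =
    trace (DxpH H (fst z) (grad u z)) + trace (DppH H (fst z) (grad u z) ** hess u z)"
proof -
  have "(\<Sum>i\<in>UNIV. \<Sum>k\<in>UNIV. hess u z $ i $ k * DppH H (fst z) (grad u z) $ k $ i) =
    trace (DppH H (fst z) (grad u z) ** hess u z)"
    unfolding trace_mult by (subst sum.swap) (simp add: mult.commute)
  then show ?thesis unfolding dx_drift[OF u] by (simp add: sum.distrib trace_def)
qed

text \<open>A Bochner-type computation. Third derivatives of \<open>u\<close> appear only in the
  last sum, the transport of \<Delta>u along the drift, which is what the adjoint Fokker-Planck
  operator cancels.\<close>

lemma lap_ham:
  assumes u: "torus_smooth u"
  shows "lap (ham u) z = trace (DxxH H (fst z) (grad u z)) + 2 * trace (DpxH H (fst z) (grad u z) ** hess u z)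
    + trace (DppH H (fst z) (grad u z) ** (hess u z ** hess u z))
    + (\<Sum>i\<in>UNIV. drift u i z * dx i (lap u) z)"
proof -
  let ?x = "fst z" and ?p = "grad u z" and ?M = "hess u z"
  let ?X = "DxxH H ?x ?p" and ?P = "DpxH H ?x ?p" and ?Q = "DppH H ?x ?p"
  let ?S2 = "\<Sum>k\<in>UNIV. \<Sum>j\<in>UNIV. ?M $ k $ j * ?P $ j $ k"
    and ?S3 = "\<Sum>k\<in>UNIV. \<Sum>j\<in>UNIV. \<Sum>i\<in>UNIV. ?M $ k $ j * (?M $ k $ i * ?Q $ i $ j)"
    and ?S4 = "\<Sum>k\<in>UNIV. \<Sum>j\<in>UNIV. dx k (dx k (dx j u)) z * drift u j z"
  have sm: "smooth_fun (\<lambda>z. dderiv HH v (jet u z))" "smooth_fun (dx i (dx j u))" "smooth_fun (drift u j)" for v i j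
    by (intro torus_smooth_smooth torus_smooth_jet_dderiv torus_smooth_dderiv torus_smooth_drift u)+
  have 1: "dx k (ham u) = (\<lambda>z. dderiv HH (axis k 1, 0) (jet u z) + (\<Sum>j\<in>UNIV. dx k (dx j u) z * drift u j z))" for k
    unfolding ham_def[abs_def] drift_def using dx_jet[OF u HH_smooth] by blast
  have 2: "dx k (\<lambda>z. dderiv HH (axis k 1, 0) (jet u z)) z =
     ?X $ k $ k + (\<Sum>j\<in>UNIV. ?M $ k $ j * ?P $ j $ k)" for k
    unfolding dx_jet[OF u smooth_fun_dderiv[OF HH_smooth]] DxxH_nth DpxH_nth hess_nth jet_eq[symmetric] ..
  have 3: "dx k (\<lambda>z. dx k (dx j u) z * drift u j z) z =
     ?M $ k $ j * ?P $ j $ k + (\<Sum>i\<in>UNIV. ?M $ k $ j * (?M $ k $ i * ?Q $ i $ j))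
      + dx k (dx k (dx j u)) z * drift u j z" for k j
    by (subst dderiv_mult) (auto intro!: smooth_fun_differentiable sm
        simp: dx_drift[OF u] DpxH_transpose[of _ _ j k] hess_nth distrib_left sum_distrib_left)
  have "dx k (dx k (ham u)) z = dx k (\<lambda>z. dderiv HH (axis k 1, 0) (jet u z)) z +
     (\<Sum>j\<in>UNIV. dx k (\<lambda>z. dx k (dx j u) z * drift u j z) z)" for k
    unfolding 1
    by (subst dderiv_add, (intro smooth_fun_differentiable smooth_fun_sum smooth_fun_mult sm)+,
        subst dderiv_sum, (intro smooth_fun_mult sm)+, rule refl)
  then have "lap (ham u) z = (\<Sum>k\<in>UNIV. ?X $ k $ k)
     + 2 * ?S2
     + ?S3
     + ?S4"
    unfolding lap_def by (simp add: 2 3 sum.distrib sum_distrib_left)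
  also have "(\<Sum>k\<in>UNIV. ?X $ k $ k) = trace (?X)" by (simp add: trace_def)
  also have "?S2 = trace (?P ** ?M)"
    unfolding trace_mult by (subst sum.swap) (simp add: mult.commute)
  also have "?S3 =
     trace (?Q ** (?M ** ?M))"
  proof -
    have "?S3 =
      (\<Sum>i\<in>UNIV. \<Sum>j\<in>UNIV. \<Sum>k\<in>UNIV. ?M $ k $ j * (?M $ k $ i * ?Q $ i $ j))"
      by (subst sum.swap, subst sum.swap[of _ UNIV "UNIV :: 'd set"], subst (2) sum.swap) (rule refl)
    also have "\<dots> = (\<Sum>i\<in>UNIV. \<Sum>j\<in>UNIV. ?Q $ i $ j * (\<Sum>k\<in>UNIV. ?M $ j $ k * ?M $ k $ i))"
      unfolding sum_distrib_left by (intro sum.cong refl) (simp add: hess_sym[OF u, of z j for j] mult_ac)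
    finally show ?thesis unfolding trace_mult by (simp add: matrix_matrix_mult_def)
  qed
  also have "?S4 = (\<Sum>j\<in>UNIV. drift u j z * dx j (lap u) z)"
    unfolding dderiv_lap[OF u] lap_def sum_distrib_left by (subst sum.swap) (simp add: mult.commute)
  finally show ?thesis .
qed

text \<open>By midpoint convexity H(x, p + s v) + H(x, p - s v) is minimal at s = 0, and its second
  derivative there is twice the quadratic form.\<close>

lemma DppH_nonneg:
  assumes "strictly_convex (H x)"
  shows "(\<Sum>i\<in>UNIV. \<Sum>j\<in>UNIV. v $ i * v $ j * DppH H x p $ i $ j) \<ge> 0"
proof -
  let ?v = "(0, v) :: (real^'d) \<times> (real^'d)"
  have mid: "2 * H x p \<le> H x (p + s *\<^sub>R v) + H x (p - s *\<^sub>R v)" for s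
  proof (cases "s *\<^sub>R v = 0")
    case False
    have "p + s *\<^sub>R v \<noteq> p - s *\<^sub>R v"
    proof
      assume "p + s *\<^sub>R v = p - s *\<^sub>R v"
      then have "2 *\<^sub>R (s *\<^sub>R v) = 0" unfolding scaleR_2 by (simp add: algebra_simps eq_neg_iff_add_eq_0)
      with False show False by simp
    qed
    from assms[unfolded strictly_convex_def, rule_format, OF this, of "1/2"]
    have "H x ((1/2) *\<^sub>R (p + s *\<^sub>R v) + (1/2) *\<^sub>R (p - s *\<^sub>R v)) <
       (1/2) * H x (p + s *\<^sub>R v) + (1/2) * H x (p - s *\<^sub>R v)"
      by simp
    moreover have "(1/2) *\<^sub>R (p + s *\<^sub>R v) + (1/2) *\<^sub>R (p - s *\<^sub>R v) = p"
      by (simp add: scaleR_add_right scaleR_diff_right scaleR_left_distrib[symmetric])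
    ultimately show ?thesis by simp
  qed auto
  define f where "f s = HH ((x, p) + s *\<^sub>R ?v) + HH ((x, p) + s *\<^sub>R (- ?v))" for s
  define f' where "f' s = dderiv HH ?v ((x, p) + s *\<^sub>R ?v) + dderiv HH (- ?v) ((x, p) + s *\<^sub>R (- ?v))" for s
  have "(f has_real_derivative f' s) (at s)" for s
    unfolding f_def f'_def by (intro DERIV_add smooth_fun_DERIV_line HH_smooth)
  moreover have "(f' has_real_derivative dderiv (dderiv HH ?v) ?v (x, p) + dderiv (dderiv HH (- ?v)) (- ?v) (x, p)) (at 0)"
    using DERIV_add[OF smooth_fun_DERIV_line[OF smooth_fun_dderiv[OF HH_smooth, of ?v], of "(x, p)" ?v 0]
       smooth_fun_DERIV_line[OF smooth_fun_dderiv[OF HH_smooth, of "- ?v"], of "(x, p)" "- ?v" 0]]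
    unfolding f'_def by simp
  moreover have "f 0 \<le> f s" for s using mid[of s] by (simp add: f_def HH_def)
  ultimately have "dderiv (dderiv HH ?v) ?v (x, p) + dderiv (dderiv HH (- ?v)) (- ?v) (x, p) \<ge> 0"
    by (rule second_derivative_at_min_nonneg)
  moreover have "dderiv (dderiv HH (- ?v)) (- ?v) (x, p) = dderiv (dderiv HH ?v) ?v (x, p)"
    using dderiv_dderiv_Pair_axis[OF HH_smooth, of "- v"] dderiv_dderiv_Pair_axis[OF HH_smooth, of v] by simp
  ultimately show ?thesis
    using dderiv_dderiv_Pair_axis[OF HH_smooth, of v "(x, p)"] by (simp add: DppH_nth)
qed

text \<open>For symmetric \<open>M\<close> the trace is the sum of the quadratic form of D^2_pp H
  over the rows of \<open>M\<close>.\<close>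

lemma trace_DppH_square_nonneg:
  assumes "strictly_convex (H x)" "transpose M = M"
  shows "trace (DppH H x p ** (M ** M)) \<ge> 0"
proof -
  have M: "M $ k $ i = M $ i $ k" for i k using assms(2) by (metis transpose_def vec_lambda_beta)
  have "trace (DppH H x p ** (M ** M)) =
     (\<Sum>i\<in>UNIV. \<Sum>j\<in>UNIV. \<Sum>k\<in>UNIV. (M $ k) $ i * (M $ k) $ j * DppH H x p $ i $ j)"
    unfolding trace_mult by (simp add: matrix_matrix_mult_def sum_distrib_left M[of _ j for j] mult_ac)
  also have "\<dots> = (\<Sum>k\<in>UNIV. \<Sum>i\<in>UNIV. \<Sum>j\<in>UNIV. (M $ k) $ i * (M $ k) $ j * DppH H x p $ i $ j)"
    by (subst (2) sum.swap, subst sum.swap) (rule refl)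
  also have "\<dots> \<ge> 0" by (intro sum_nonneg DppH_nonneg assms(1))
  finally show ?thesis .
qed

end

section \<open>Energy estimates\<close>

lemma torus_integral_lap_parts:
  assumes "torus_smooth f" "torus_smooth g"
  shows "torus_integral (\<lambda>x. f (x, t) * lap g (x, t)) = - torus_integral (\<lambda>x. \<Sum>i\<in>UNIV. dx i f (x, t) * dx i g (x, t))"
proof -
  note c = slice_continuous torus_smooth_dderiv assms
  show ?thesis
    unfolding lap_def sum_distrib_left
    by (subst torus_integral_sum, intro continuous_on_mult c, subst torus_integral_sum, intro continuous_on_mult c)
      (simp add: torus_smooth_by_parts assms torus_smooth_dderiv sum_negf)
qed

text \<open>The kernel is abstract and \<epsilon> has disappeared. The estimates proved here have
  constants built from \<open>H\<close>, the data, T, \<alpha>, c and C, and this is how bounds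
  uniform in \<epsilon> arise.\<close>

locale mfg_solution = hamiltonian H + even_kernel k a
  for H :: "real^'d \<Rightarrow> real^'d \<Rightarrow> real" and k :: "real^'d \<Rightarrow> real" and a :: "real^'d" +
  fixes u m :: "(real^'d) \<times> real \<Rightarrow> real" and T \<alpha> c C :: real
  assumes T: "T > 0" and alpha: "\<alpha> > 0"
    and u: "torus_smooth u" and m: "torus_smooth m"
    and HJ: "\<And>x t. t \<in> {0..T} \<Longrightarrow> - dderiv u (0, 1) (x, t) + ham u (x, t) =
        lap u (x, t) + conv k (\<lambda>y. (conv k (\<lambda>y. m (y, t)) y) powr \<alpha>) x"
    and FP: "\<And>x t. t \<in> {0..T} \<Longrightarrow> dderiv m (0, 1) (x, t) =
        lap m (x, t) + (\<Sum>i\<in>UNIV. dx i (\<lambda>z. m z * drift u i z) (x, t))"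
    and m0: "\<exists>\<kappa>>0. \<forall>x. m (x, 0) > \<kappa>" and mass0: "torus_integral (\<lambda>x. m (x, 0)) = 1"
    and H_ge_1: "\<And>x p. H x p \<ge> 1" and H_convex: "\<And>x. strictly_convex (H x)"
    and c: "c > 0" and lagrangian: "\<And>x p. DpH H x p \<bullet> p - H x p \<ge> c * H x p - C"
begin

sublocale fp: fokker_planck "drift u" m T
  by unfold_locales (auto simp: T torus_smooth_drift u m FP lap_def)

lemma m_pos: "t \<in> {0..T} \<Longrightarrow> m (x, t) > 0"
  using m0 fp.density_positive by metis

lemma mass: "t \<in> {0..T} \<Longrightarrow> torus_integral (\<lambda>x. m (x, t)) = 1"
  using fp.mass_conservation mass0 by simp

text \<open>The coupling, but defined through the Hamilton-Jacobi equation. In this form it is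
  smooth at all times, without any differentiation of z^\<alpha> or of a convolution; on {0..T} the
  two agree.\<close>

definition G :: "(real^'d) \<times> real \<Rightarrow> real" where
  "G z = ham u z - lap u z - dderiv u (0, 1) z"

definition X :: "(real^'d) \<times> real \<Rightarrow> real" where
  "X z = trace (DppH H (fst z) (grad u z) ** (hess u z ** hess u z))"

lemmas smooths = torus_smooth_intros u m torus_smooth_ham torus_smooth_lap torus_smooth_drift

lemma torus_smooth_G: "torus_smooth G"
  unfolding G_def[abs_def] by (intro smooths)

lemma torus_smooth_X: "torus_smooth X"
  unfolding X_def[abs_def] by (rule torus_smooth_trace[OF u])

lemmas all_smooths = smooths torus_smooth_G torus_smooth_X

lemma X_nonneg: "X z \<ge> 0"
  unfolding X_def by (rule trace_DppH_square_nonneg[OF H_convex transpose_hess[OF u]])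

lemma ham_ge_1: "ham u z \<ge> 1"
  unfolding ham_eq by (rule H_ge_1)

lemma m_G_continuous:
  "continuous_on UNIV (\<lambda>x. m (x, t))" "continuous_on UNIV (\<lambda>x. G (x, t))"
  by (intro slice_continuous m torus_smooth_G)+

lemma conv_m_nonneg: "t \<in> {0..T} \<Longrightarrow> conv k (\<lambda>y. m (y, t)) x \<ge> 0"
  by (intro conv_nonneg m_G_continuous less_imp_le m_pos)

lemma source_continuous:
  assumes "t \<in> {0..T}"
  shows "continuous_on UNIV (\<lambda>y. (conv k (\<lambda>y. m (y, t)) y) powr \<alpha>)"
  using alpha conv_m_nonneg[OF assms]
  by (intro continuous_on_powr' continuous_on_conv m_G_continuous continuous_on_const) auto

lemma G_eq: "t \<in> {0..T} \<Longrightarrow> G (x, t) = conv k (\<lambda>y. (conv k (\<lambda>y. m (y, t)) y) powr \<alpha>) x"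
  using HJ[of t x] by (simp add: G_def)

lemma G_nonneg: "t \<in> {0..T} \<Longrightarrow> G (x, t) \<ge> 0"
  unfolding G_eq by (rule conv_nonneg[OF source_continuous]) auto

text \<open>M - z/2 changes sign at z = 2M: below, z^\<alpha> \<le> (2M)^\<alpha>, and above, the
  product is nonpositive. Only half of the integral of m G is spent, because the duality estimate
  supplies it once in full.\<close>

lemma integral_G_le:
  assumes t: "t \<in> {0..T}" and M: "M > 0"
  shows "M * torus_integral (\<lambda>x. G (x, t)) \<le> torus_integral (\<lambda>x. m (x, t) * G (x, t)) / 2 + (2 * M) powr \<alpha> * M"
proof -
  let ?z = "conv k (\<lambda>y. m (y, t))"
  let ?f = "\<lambda>y. ?z y powr \<alpha>"
  let ?\<psi> = "\<lambda>x. M - 1/2 * m (x, t)"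
  have zp: "Zd_periodic ?z" by (intro Zd_periodic_conv torus_smooth_periodic m)
  have fp: "Zd_periodic ?f" by (rule Zd_periodic_compose[OF zp])
  have \<psi>: "Zd_periodic ?\<psi>" by (rule Zd_periodic_compose[OF torus_smooth_periodic[OF m]])
  have \<psi>c: "continuous_on UNIV ?\<psi>" by (intro continuous_intros m_G_continuous)
  have "torus_integral (\<lambda>x. G (x, t) * ?\<psi> x) = torus_integral (\<lambda>x. ?f x * conv k ?\<psi> x)"
    unfolding G_eq[OF t] by (rule torus_integral_conv_adjoint[OF fp source_continuous[OF t] \<psi> \<psi>c])
  also have "\<dots> \<le> torus_integral (\<lambda>x::real^'d. (2 * M) powr \<alpha> * M)"
  proof (rule torus_integral_mono)
    show "continuous_on UNIV (\<lambda>x. ?f x * conv k ?\<psi> x)"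
      by (intro continuous_on_mult source_continuous t continuous_on_conv \<psi>c)
    show "?f x * conv k ?\<psi> x \<le> (2 * M) powr \<alpha> * M" for x
    proof -
      have "conv k ?\<psi> x = M - 1/2 * ?z x"
        using conv_linear[OF continuous_on_const m_G_continuous(1), of M "1/2" t x] by (simp add: conv_const)
      moreover have "?z x powr \<alpha> * (M - 1/2 * ?z x) \<le> (2 * M) powr \<alpha> * M"
      proof (cases "?z x \<le> 2 * M")
        case True
        then have "?z x powr \<alpha> \<le> (2 * M) powr \<alpha>" using conv_m_nonneg[OF t] alpha by (intro powr_mono2) auto
        then show ?thesis using True conv_m_nonneg[OF t, of x] by (intro mult_mono) auto
      next
        case False
        then have "?z x powr \<alpha> * (M - 1/2 * ?z x) \<le> 0" by (intro mult_nonneg_nonpos) auto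
        also have "0 \<le> (2 * M) powr \<alpha> * M" using M by simp
        finally show ?thesis .
      qed
      ultimately show ?thesis by simp
    qed
  qed (rule continuous_on_const)
  also have "\<dots> = (2 * M) powr \<alpha> * M" by (rule torus_integral_const)
  also have "torus_integral (\<lambda>x. G (x, t) * ?\<psi> x) = torus_integral (\<lambda>x. M * G (x, t) - 1/2 * (m (x, t) * G (x, t)))"
    by (simp add: algebra_simps)
  also have "\<dots> = M * torus_integral (\<lambda>x. G (x, t)) - 1/2 * torus_integral (\<lambda>x. m (x, t) * G (x, t))"
    by (subst torus_integral_diff, (intro continuous_intros m_G_continuous)+,
        subst torus_integral_cmult, subst torus_integral_cmult, rule refl)
  finally show ?thesis by simp
qed

lemma integral_m_lap_G_nonpos:
  assumes t: "t \<in> {0..T}"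
  shows "torus_integral (\<lambda>x. m (x, t) * lap G (x, t)) \<le> 0"
proof -
  have cont: "continuous_on {0..} (\<lambda>z::real. z powr \<alpha>)"
    using alpha by (intro continuous_on_powr' continuous_on_id continuous_on_const) auto
  have mono: "mono_on {0..} (\<lambda>z::real. z powr \<alpha>)"
    using alpha by (intro mono_onI powr_mono2) auto
  have "torus_integral (\<lambda>x. G (x, t) * dx i (dx i m) (x, t)) \<le> 0" for i
  proof -
    have "torus_integral (\<lambda>x. conv k (\<lambda>x. (conv k (\<lambda>y. m (y, t)) x) powr \<alpha>) x *
        dderiv (dderiv (\<lambda>y. m (y, t)) (axis i 1)) (axis i 1) x) \<le> 0"
      by (rule torus_integral_conv_second_derivative_nonpos[OF torus_smooth_slice[OF m] less_imp_le[OF m_pos[OF t]] cont mono])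
    moreover have "dderiv (dderiv (\<lambda>y. m (y, t)) (axis i 1)) (axis i 1) x = dx i (dx i m) (x, t)" for x
      by (simp add: dderiv_slice[abs_def])
    ultimately show ?thesis by (simp add: G_eq[OF t])
  qed
  then have "(\<Sum>i\<in>UNIV. torus_integral (\<lambda>x. G (x, t) * dx i (dx i m) (x, t))) \<le> 0"
    by (intro sum_nonpos)
  also have "(\<Sum>i\<in>UNIV. torus_integral (\<lambda>x. G (x, t) * dx i (dx i m) (x, t))) = torus_integral (\<lambda>x. G (x, t) * lap m (x, t))"
    unfolding lap_def sum_distrib_left
    by (rule torus_integral_sum[symmetric])
      (intro continuous_on_mult slice_continuous all_smooths)
  finally show ?thesis using torus_integral_lap[OF m torus_smooth_G, of t] by simp
qed

abbreviation "\<J> \<equiv> spacetime_integral T"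

lemma mass_spacetime: "\<J> m = T"
  using spacetime_integral_cong_slices[of T m "\<lambda>z. 1"] T mass
  by (simp add: torus_integral_const spacetime_integral_const)

text \<open>Duality with \<phi> = u. As u_t + \<Delta>u = H - G, the integrand is m (H - G - D_pH .
  Du), and the lower bound on the Lagrangian makes it at most m (C - c H - G). At time T the mass
  one of \<open>m\<close> turns the bound on \<open>u\<close> into -U.\<close>

lemma duality_lower_bound:
  assumes U: "\<And>x. \<bar>u (x, T)\<bar> \<le> U"
  shows "torus_integral (\<lambda>x. m (x, 0) * u (x, 0)) \<ge>
     - U + c * \<J> (\<lambda>z. m z * ham u z) - C * T + \<J> (\<lambda>z. m z * G z)"
proof -
  let ?S = "\<lambda>z. \<Sum>i\<in>UNIV. drift u i z * dx i u z"
  let ?h = "\<lambda>z. m z * ham u z" and ?g = "\<lambda>z. m z * G z"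
  have "torus_integral (\<lambda>x. m (x, T) * u (x, T)) - torus_integral (\<lambda>x. m (x, 0) * u (x, 0)) =
     \<J> (dderiv (\<lambda>z. m z * u z) (0, 1))"
    using T by (subst spacetime_integral_dt) (auto intro!: smooths)
  also have "\<dots> = \<J> (\<lambda>z. m z * (dderiv u (0, 1) z + lap u z - ?S z))"
    by (rule spacetime_integral_cong_slices) (rule fp.dt_duality[OF _ u])
  also have "\<dots> \<le> \<J> (\<lambda>z. C * m z - c * (m z * ham u z) - m z * G z)"
  proof (rule spacetime_integral_mono)
    show "m (x, t) * (dderiv u (0, 1) (x, t) + lap u (x, t) - ?S (x, t))
      \<le> C * m (x, t) - c * (m (x, t) * ham u (x, t)) - m (x, t) * G (x, t)" if t: "t \<in> {0..T}" for t x
    proof -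
      let ?z = "(x, t)"
      have "?S ?z = DpH H x (grad u ?z) \<bullet> grad u ?z"
        by (simp add: inner_vec_def DpH_nth drift_def jet_def)
      then have "?S ?z \<ge> ham u ?z + c * ham u ?z - C"
        using lagrangian[of x "grad u ?z"] by (simp add: ham_eq)
      then have "dderiv u (0, 1) ?z + lap u ?z - ?S ?z \<le> C - c * ham u ?z - G ?z"
        unfolding G_def by simp
      from mult_left_mono[OF this less_imp_le[OF m_pos[OF t]], of x] show ?thesis by (simp add: algebra_simps)
    qed
  qed (intro all_smooths)+
  also have "\<dots> = C * \<J> m - c * \<J> ?h - \<J> ?g"
    by (subst spacetime_integral_diff, (intro all_smooths)+, subst spacetime_integral_diff,
        (intro all_smooths)+, subst spacetime_integral_cmult, subst spacetime_integral_cmult, rule refl)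
  finally have 1: "torus_integral (\<lambda>x. m (x, T) * u (x, T)) - torus_integral (\<lambda>x. m (x, 0) * u (x, 0)) \<le>
     C * T - c * \<J> ?h - \<J> ?g" unfolding mass_spacetime .
  have TT: "T \<in> {0..T}" using T by simp
  have "torus_integral (\<lambda>x. - U * m (x, T)) \<le> torus_integral (\<lambda>x. m (x, T) * u (x, T))"
  proof (rule torus_integral_mono)
    show "- U * m (x, T) \<le> m (x, T) * u (x, T)" for x
      using mult_left_mono[of "- U" "u (x, T)" "m (x, T)"] U[of x] m_pos[OF TT, of x] by (simp add: mult.commute)
  qed (intro continuous_intros slice_continuous m u)+
  then have "- U \<le> torus_integral (\<lambda>x. m (x, T) * u (x, T))"
    by (simp add: torus_integral_cmult torus_integral_minus mass[OF TT])
  with 1 show ?thesis by linarith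
qed

text \<open>The Hamilton-Jacobi equation is tested with a positive function of x alone. The function
  is arbitrary because the estimate is used both for the initial density and for a perturbation of
  it by its Laplacian.\<close>

lemma test_function_upper_bound:
  assumes \<phi>: "smooth_fun \<phi>" "Zd_periodic \<phi>" and \<kappa>: "\<kappa> > 0" "\<And>x. \<kappa> \<le> \<phi> x" "\<And>x. \<phi> x \<le> M"
    and L: "\<And>x. norm (\<chi> i. dderiv \<phi> (axis i 1) x) \<le> L"
    and K: "\<And>x p. L / \<kappa> * norm p \<le> H x p + K"
    and U: "\<And>x. \<bar>u (x, T)\<bar> \<le> U"
  shows "torus_integral (\<lambda>x. u (x, 0) * \<phi> x) \<le>
     U * M + T * (\<kappa> * K + (2 * M) powr \<alpha> * M) + \<J> (\<lambda>z. m z * G z) / 2"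
proof -
  let ?\<phi> = "\<lambda>z :: (real^'d) \<times> real. \<phi> (fst z)"
  let ?S = "\<lambda>z. \<Sum>i\<in>UNIV. dx i ?\<phi> z * dx i u z"
    and ?V = "\<lambda>z. ham u z * ?\<phi> z - G z * ?\<phi> z"
  have ts: "torus_smooth ?\<phi>" by (rule torus_smooth_lift[OF \<phi>])
  have M: "M > 0" using \<kappa>(1) \<kappa>(2,3)[of 0] by linarith
  have dphi: "dx i ?\<phi> (x, t) = dderiv \<phi> (axis i 1) x" for i x t by (simp add: dderiv_def)
  have dt0: "dderiv ?\<phi> (0, 1) z = 0" for z by (simp add: dderiv_def)
  have dt: "dderiv (\<lambda>z. u z * ?\<phi> z) (0, 1) z = ham u z * ?\<phi> z - ?\<phi> z * lap u z - G z * ?\<phi> z" for z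
    using dderiv_mult[OF smooth_fun_differentiable[OF torus_smooth_smooth[OF u]]
        smooth_fun_differentiable[OF torus_smooth_smooth[OF ts]], of "(0, 1)" z]
    by (simp add: dt0 G_def algebra_simps)
  let ?P = "\<lambda>z. ham u z * ?\<phi> z + (\<Sum>i\<in>UNIV. dx i ?\<phi> z * dx i u z) - G z * ?\<phi> z"
  have sm: "torus_smooth ?P" by (intro all_smooths ts)
  have "\<J> (\<lambda>z. - (\<kappa> * K) - M * G z) \<le> \<J> ?P"
  proof (rule spacetime_integral_mono[OF _ sm])
    show "- (\<kappa> * K) - M * G (x, t) \<le> ?P (x, t)" if t: "t \<in> {0..T}" for t x
    proof -
      let ?p = "grad u (x, t)" and ?q = "\<chi> i. dderiv \<phi> (axis i 1) x"
      have "?S (x, t) = ?q \<bullet> ?p"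
        by (simp add: inner_vec_def dphi jet_def)
      moreover have "\<bar>?q \<bullet> ?p\<bar> \<le> L * norm ?p"
        using Cauchy_Schwarz_ineq2[of ?q ?p] mult_right_mono[OF L[of x] norm_ge_zero[of ?p]] by linarith
      moreover have "L * norm ?p \<le> \<kappa> * (ham u (x, t) + K)"
        using mult_left_mono[OF K[of "?p" x], of \<kappa>] \<kappa>(1) by (simp add: ham_eq)
      moreover have "\<kappa> * ham u (x, t) \<le> ham u (x, t) * ?\<phi> (x, t)"
        using mult_right_mono[OF \<kappa>(2)[of x], of "ham u (x, t)"] ham_ge_1[of "(x, t)"] by (simp add: mult.commute)
      moreover have "G (x, t) * ?\<phi> (x, t) \<le> M * G (x, t)"
        using mult_right_mono[OF \<kappa>(3)[of x] G_nonneg[OF t, of x]] by (simp add: mult.commute)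
      ultimately show ?thesis by (simp add: distrib_left)
    qed
  qed (intro all_smooths)
  also have "\<J> ?P = \<J> (dderiv (\<lambda>z. u z * ?\<phi> z) (0, 1))"
  proof (rule spacetime_integral_cong_slices)
    fix t
    have "torus_integral (\<lambda>x. dderiv (\<lambda>z. u z * ?\<phi> z) (0, 1) (x, t)) =
       torus_integral (\<lambda>x. ?V (x, t) - ?\<phi> (x, t) * lap u (x, t))"
      unfolding dt by (simp add: algebra_simps)
    also have "\<dots> = torus_integral (\<lambda>x. ?V (x, t)) - torus_integral (\<lambda>x. ?\<phi> (x, t) * lap u (x, t))"
      by (rule torus_integral_diff; intro continuous_on_diff continuous_on_mult slice_continuous ts all_smooths)
    also have "torus_integral (\<lambda>x. ?\<phi> (x, t) * lap u (x, t)) = - torus_integral (\<lambda>x. ?S (x, t))"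
      by (rule torus_integral_lap_parts[OF ts u])
    also have "torus_integral (\<lambda>x. ?V (x, t)) - \<dots> =
      torus_integral (\<lambda>x. (?V (x, t)) + ?S (x, t))"
      by (subst torus_integral_add; (intro continuous_on_sum continuous_on_diff continuous_on_mult slice_continuous ts all_smooths)?) simp
    finally show "torus_integral (\<lambda>x. ?P (x, t)) = torus_integral (\<lambda>x. dderiv (\<lambda>z. u z * ?\<phi> z) (0, 1) (x, t))"
      by (simp add: algebra_simps)
  qed
  also have "\<dots> = torus_integral (\<lambda>x. u (x, T) * \<phi> x) - torus_integral (\<lambda>x. u (x, 0) * \<phi> x)"
    using T by (subst spacetime_integral_dt) (auto intro!: smooths ts)
  also have "torus_integral (\<lambda>x. u (x, T) * \<phi> x) \<le> torus_integral (\<lambda>x::real^'d. U * M)"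
  proof (rule torus_integral_mono)
    show "u (x, T) * \<phi> x \<le> U * M" for x
      using U[of x] \<kappa>(1) \<kappa>(2,3)[of x] by (intro mult_mono) auto
  qed (intro continuous_intros slice_continuous u smooth_continuous_on \<phi>)+
  also have "\<dots> = U * M" by (rule torus_integral_const)
  also have "\<J> (\<lambda>z. - (\<kappa> * K) - M * G z) = - (T * (\<kappa> * K)) - M * \<J> G"
    by (subst spacetime_integral_diff, (intro all_smooths)+, subst spacetime_integral_cmult)
      (use T in \<open>simp add: spacetime_integral_const\<close>)
  finally have 1: "torus_integral (\<lambda>x. u (x, 0) * \<phi> x) \<le> U * M + T * (\<kappa> * K) + M * \<J> G" by linarith
  have "\<J> (\<lambda>z. M * G z) \<le> \<J> (\<lambda>z. 1/2 * (m z * G z) + (2 * M) powr \<alpha> * M)"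
  proof (rule spacetime_integral_mono_slices)
    fix t assume t: "t \<in> {0..T}"
    have "torus_integral (\<lambda>x. 1/2 * (m (x, t) * G (x, t)) + (2 * M) powr \<alpha> * M) =
      1/2 * torus_integral (\<lambda>x. m (x, t) * G (x, t)) + (2 * M) powr \<alpha> * M"
      by (subst torus_integral_add, (intro continuous_intros m_G_continuous)+, subst torus_integral_cmult)
        (simp add: torus_integral_const)
    then show "torus_integral (\<lambda>x. M * G (x, t)) \<le> torus_integral (\<lambda>x. 1/2 * (m (x, t) * G (x, t)) + (2 * M) powr \<alpha> * M)"
      using integral_G_le[OF t M] unfolding torus_integral_cmult by simp
  qed (intro all_smooths)+
  also have "\<dots> = 1/2 * \<J> (\<lambda>z. m z * G z) + T * ((2 * M) powr \<alpha> * M)"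
    by (subst spacetime_integral_add, (intro all_smooths)+, subst spacetime_integral_cmult)
      (use T in \<open>simp add: spacetime_integral_const\<close>)
  finally have "M * \<J> G \<le> \<J> (\<lambda>z. m z * G z) / 2 + T * ((2 * M) powr \<alpha> * M)"
    unfolding spacetime_integral_cmult by simp
  with 1 show ?thesis by (simp add: distrib_left)
qed

text \<open>Duality with \<phi> = \<Delta>u, in which the transport terms cancel. The factor 1/4 is
  chosen so that the mixed term, which occurs twice, costs half of \<open>X\<close>. At time 0 the
  Laplacian is moved onto \<open>m\<close>, since nothing bounds \<Delta>u there.\<close>

lemma second_order_identity:
  assumes Ca: "\<And>x p. \<bar>trace (DxxH H x p)\<bar> \<le> Ca * H x p"
    and Cd: "\<And>M x p. transpose M = M \<Longrightarrow>
        trace (DpxH H x p ** M) \<le> 1/4 * trace (DppH H x p ** (M ** M)) + Cd * H x p"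
    and U: "\<And>x. \<bar>lap u (x, T)\<bar> \<le> U"
  shows "\<J> (\<lambda>z. m z * X z) \<le> 2 * (U - torus_integral (\<lambda>x. u (x, 0) * lap m (x, 0)) + (Ca + 2 * Cd) * \<J> (\<lambda>z. m z * ham u z))"
proof -
  let ?W = "lap u"
  have W: "torus_smooth ?W" by (intro smooths)
  let ?V = "\<lambda>z. m z * (1/2 * X z - (Ca + 2 * Cd) * ham u z)"
  have W_eq: "dderiv ?W (0, 1) z + lap ?W z - (\<Sum>i\<in>UNIV. drift u i z * dx i ?W z) =
     trace (DxxH H (fst z) (grad u z)) + 2 * trace (DpxH H (fst z) (grad u z) ** hess u z) + X z - lap G z" for z
  proof -
    \<comment> \<open>By definition of \<open>G\<close> this holds at all times, hence is an
      identity of functions that may be differentiated.\<close>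
    have "dderiv u (0, 1) = (\<lambda>z. (ham u z - lap u z) - G z)" by (auto simp: G_def)
    then have "dderiv ?W (0, 1) z = lap (\<lambda>z. (ham u z - lap u z) - G z) z" using dderiv_lap[OF u] by simp
    also have "\<dots> = lap (ham u) z - lap ?W z - lap G z"
      by (subst lap_diff, (intro all_smooths)+, subst lap_diff, (intro all_smooths)+, rule refl)
    finally show ?thesis unfolding lap_ham[OF u] X_def by simp
  qed
  have sX: "torus_smooth ?V"
    by (intro all_smooths)
  have "\<J> ?V \<le> \<J> (dderiv (\<lambda>z. m z * ?W z) (0, 1))"
  proof (rule spacetime_integral_mono_slices[OF sX])
    fix t assume t: "t \<in> {0..T}"
    let ?Q = "\<lambda>z. trace (DxxH H (fst z) (grad u z)) + 2 * trace (DpxH H (fst z) (grad u z) ** hess u z) + X z"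
    have sQ: "torus_smooth ?Q" by (intro torus_smooth_X torus_smooth_trace smooths)
    have "torus_integral (\<lambda>x. ?V (x, t)) \<le> torus_integral (\<lambda>x. m (x, t) * ?Q (x, t))"
    proof (rule torus_integral_mono)
      show "?V (x, t) \<le> m (x, t) * ?Q (x, t)" for x
      proof (rule mult_left_mono[OF _ less_imp_le[OF m_pos[OF t]]])
        let ?p = "grad u (x, t)" and ?M = "hess u (x, t)"
        have M: "transpose ?M = ?M" by (rule transpose_hess[OF u])
        \<comment> \<open>The hypothesis bounds the mixed trace from above only; applied to the
          negative Hessian it gives the lower bound required, and the square is unchanged.\<close>
        have neg: "transpose (- ?M) = - ?M" using M by (simp add: transpose_def vec_eq_iff)
        have "- ?M ** - ?M = ?M ** ?M" "DpxH H x ?p ** - ?M = - (DpxH H x ?p ** ?M)"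
          by (simp_all add: matrix_matrix_mult_def vec_eq_iff sum_negf)
        moreover have "trace (- (DpxH H x ?p ** ?M)) = - trace (DpxH H x ?p ** ?M)"
          by (simp add: trace_def sum_negf)
        ultimately have "- trace (DpxH H x ?p ** ?M) \<le> 1/4 * trace (DppH H x ?p ** (?M ** ?M)) + Cd * H x ?p"
          using Cd[OF neg, of x ?p] by simp
        then show "1/2 * X (x, t) - (Ca + 2 * Cd) * ham u (x, t) \<le> ?Q (x, t)"
          using Ca[of x ?p] by (simp add: X_def ham_eq algebra_simps)
      qed
    qed (intro slice_continuous sX torus_smooth_mult[OF m sQ])+
    also have "\<dots> \<le> torus_integral (\<lambda>x. m (x, t) * ?Q (x, t)) - torus_integral (\<lambda>x. m (x, t) * lap G (x, t))"
      using integral_m_lap_G_nonpos[OF t] by simp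
    also have "\<dots> = torus_integral (\<lambda>x. m (x, t) * (?Q (x, t) - lap G (x, t)))"
      unfolding right_diff_distrib
      by (rule torus_integral_diff[symmetric]; intro slice_continuous[of "\<lambda>z. m z * f z" for f]
          torus_smooth_mult[OF m] sQ torus_smooth_lap torus_smooth_G)
    also have "\<dots> = torus_integral (\<lambda>x. dderiv (\<lambda>z. m z * ?W z) (0, 1) (x, t))"
      unfolding fp.dt_duality[OF t W] W_eq ..
    finally show "torus_integral (\<lambda>x. ?V (x, t)) \<le>
      torus_integral (\<lambda>x. dderiv (\<lambda>z. m z * ?W z) (0, 1) (x, t))" .
  qed (intro smooths)
  also have "\<dots> = torus_integral (\<lambda>x. m (x, T) * ?W (x, T)) - torus_integral (\<lambda>x. m (x, 0) * ?W (x, 0))"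
    using T by (subst spacetime_integral_dt) (auto intro!: smooths)
  also have "torus_integral (\<lambda>x. m (x, 0) * ?W (x, 0)) = torus_integral (\<lambda>x. u (x, 0) * lap m (x, 0))"
    by (rule torus_integral_lap[OF m u])
  also have "torus_integral (\<lambda>x. m (x, T) * ?W (x, T)) \<le> torus_integral (\<lambda>x. U * m (x, T))"
  proof (rule torus_integral_mono)
    show "m (x, T) * ?W (x, T) \<le> U * m (x, T)" for x
      using mult_right_mono[of "?W (x, T)" U "m (x, T)"] U[of x] m_pos[of T x] T by (simp add: mult.commute)
  qed (intro continuous_intros slice_continuous m W)+
  also have "\<dots> = U" using mass[of T] T by (simp add: torus_integral_cmult)
  also have "\<J> ?V =
     1/2 * \<J> (\<lambda>z. m z * X z) - (Ca + 2 * Cd) * \<J> (\<lambda>z. m z * ham u z)"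
  proof -
    have "?V =
      (\<lambda>z. 1/2 * (m z * X z) - (Ca + 2 * Cd) * (m z * ham u z))" by (simp add: algebra_simps)
    then show ?thesis
      by (simp only:) (subst spacetime_integral_diff, (intro all_smooths)+,
          subst spacetime_integral_cmult, subst spacetime_integral_cmult, rule refl)
  qed
  finally show ?thesis by (simp add: algebra_simps)
qed

end

section \<open>Structure conditions on the Hamiltonian\<close>

context hamiltonian
begin

text \<open>The bound on \<open>D\<^sub>x H\<close> makes \<open>ln (H + 1)\<close> Lipschitz in \<open>x\<close>, which turns growth at
  \<open>x = 0\<close> into growth uniform in \<open>x\<close>.\<close>

lemma uniformly_superlinear:
  assumes DxH: "\<And>x p. norm (DxH H x p) \<le> C * H x p + C" and H1: "\<And>x p. H x p \<ge> 1"
    and lim: "filterlim (\<lambda>p. H 0 p / norm p) at_top at_infinity" and K: "K \<ge> 0"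
  obtains C' where "\<And>x p. K * norm p \<le> H x p + C'"
proof -
  let ?n = "real CARD('d)"
  have "0 \<le> C * H 0 0 + C" using norm_ge_zero DxH by (rule order.trans)
  then have "0 \<le> C * (H 0 0 + 1)" by (simp add: algebra_simps)
  then have C: "C \<ge> 0" using H1[of 0 0] by (simp add: zero_le_mult_iff)
  \<comment> \<open>The segment from 0 to a point of the unit cell has length at most d, so ln (H +
    1) drops by at most C d along it.\<close>
  define E where "E = exp (- (C * ?n))"
  have E: "E > 0" "E \<le> 1" using C by (auto simp: E_def)
  have lip: "E * (H 0 p + 1) \<le> H x p + 1" if x: "x \<in> cbox 0 1" for x p
  proof -
    define f where "f s = ln (HH ((0, p) + s *\<^sub>R (x, 0)) + 1)" for s
    have HHp: "HH z + 1 > 0" for z using H1[of "fst z" "snd z"] by (simp add: HH_def)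
    have "(f has_real_derivative inverse (HH ((0, p) + s *\<^sub>R (x, 0)) + 1) * dderiv HH (x, 0) ((0, p) + s *\<^sub>R (x, 0))) (at s)" for s
    proof -
      have "((\<lambda>s. HH ((0, p) + s *\<^sub>R (x, 0)) + 1) has_real_derivative dderiv HH (x, 0) ((0, p) + s *\<^sub>R (x, 0)) + 0) (at s)"
        by (intro DERIV_add DERIV_const smooth_fun_DERIV_line HH_smooth)
      from DERIV_chain2[OF DERIV_ln[OF HHp] this] show ?thesis unfolding f_def by simp
    qed
    then have "\<exists>z. 0 < z \<and> z < 1 \<and> f 1 - f 0 = (1 - 0) * (inverse (HH ((0, p) + z *\<^sub>R (x, 0)) + 1) * dderiv HH (x, 0) ((0, p) + z *\<^sub>R (x, 0)))"
      by (intro MVT2) auto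
    then obtain z where z: "f 1 - f 0 = inverse (HH ((0, p) + z *\<^sub>R (x, 0)) + 1) * dderiv HH (x, 0) ((0, p) + z *\<^sub>R (x, 0))"
      by auto
    have "dderiv HH (x, 0) (y, p) = (\<Sum>i\<in>UNIV. x $ i * dderiv HH (axis i 1, 0) (y, p))" for y
      by (rule dderiv_linear_axis[OF HH_smooth, of "\<lambda>v. (v, 0)"]) (intro linearI; simp)
    then have D: "dderiv HH (x, 0) (y, p) = x \<bullet> DxH H y p" for y by (simp add: inner_vec_def DxH_nth)
    have nx: "norm x \<le> ?n"
    proof -
      have "norm x \<le> sqrt ?n" using norm_cbox_unit_le[OF x] real_le_rsqrt by blast
      also have "\<dots> \<le> sqrt (?n * ?n)"
        by (intro real_sqrt_le_mono) (simp add: mult_le_cancel_left1 Suc_leI)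
      also have "\<dots> = ?n" by simp
      finally show ?thesis .
    qed
    let ?y = "z *\<^sub>R x"
    have "\<bar>x \<bullet> DxH H ?y p\<bar> \<le> norm x * norm (DxH H ?y p)" by (rule Cauchy_Schwarz_ineq2)
    also have "\<dots> \<le> ?n * (C * (H ?y p + 1))"
      using nx DxH[of ?y p] by (intro mult_mono) (auto simp: algebra_simps)
    finally have "- (C * ?n) * (H ?y p + 1) \<le> x \<bullet> DxH H ?y p" by (simp add: algebra_simps abs_le_iff)
    then have "- (C * ?n) \<le> f 1 - f 0"
      using H1[of ?y p] unfolding z by (simp add: D HH_def field_simps)
    moreover have "f 1 = ln (H x p + 1)" "f 0 = ln (H 0 p + 1)" by (simp_all add: f_def HH_def)
    ultimately have "ln (H 0 p + 1) - C * ?n \<le> ln (H x p + 1)" by simp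
    then have "exp (ln (H 0 p + 1) - C * ?n) \<le> exp (ln (H x p + 1))" by simp
    then show ?thesis using H1[of 0 p] H1[of x p] by (simp add: E_def exp_diff exp_minus field_simps)
  qed
  from lim have "\<forall>\<^sub>F p in at_infinity. H 0 p / norm p \<ge> K / E" by (simp add: filterlim_at_top)
  then obtain R where R: "\<And>p. norm p \<ge> R \<Longrightarrow> H 0 p / norm p \<ge> K / E" unfolding eventually_at_infinity by blast
  define R' where "R' = max R 1"
  have "K * norm p \<le> E * H 0 p + K * R'" for p
  proof (cases "norm p \<ge> R'")
    case True
    then have "norm p \<ge> R" "norm p > 0" by (auto simp: R'_def)
    then have "K * norm p \<le> E * H 0 p" using R[of p] E by (simp add: field_simps)
    moreover have "K * R' \<ge> 0" using K by (simp add: R'_def)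
    ultimately show ?thesis by linarith
  next
    case False
    then have "K * norm p \<le> K * R'" using K by (intro mult_left_mono) auto
    moreover have "E * H 0 p \<ge> 0" using E H1[of 0 p] by simp
    ultimately show ?thesis by linarith
  qed
  moreover have "E * H 0 p \<le> H x p + 1" for x p
  proof -
    obtain y l where yl: "y \<in> cbox 0 1" "\<And>i. l $ i \<in> \<int>" "x = y + l" by (rule fundamental_domain[of x]) blast
    have "E * H 0 p \<le> E * (H 0 p + 1)" using E by simp
    also have "\<dots> \<le> H y p + 1" by (rule lip[OF yl(1)])
    also have "H y p = H x p" using Zd_periodic_add[OF H_periodic yl(2)] yl(3) by simp
    finally show ?thesis .
  qed
  ultimately have "K * norm p \<le> H x p + (1 + K * R')" for x p by (smt (verit))
  then show thesis by (rule that)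
qed

end

section \<open>Scalar and matrix inequalities for closing the estimate\<close>

lemma abs_trace_le: "\<bar>trace A\<bar> \<le> real CARD('d) * norm A" for A :: "real^'d^'d"
proof -
  have "\<bar>trace A\<bar> \<le> (\<Sum>i\<in>UNIV. \<bar>A $ i $ i\<bar>)" unfolding trace_def by (rule sum_abs)
  also have "\<dots> \<le> (\<Sum>i\<in>(UNIV::'d set). norm A)"
  proof (rule sum_mono)
    fix i
    have "\<bar>A $ i $ i\<bar> \<le> norm (A $ i)" by (rule component_le_norm_cart)
    also have "\<dots> \<le> norm A" by (rule Finite_Cartesian_Product.norm_nth_le)
    finally show "\<bar>A $ i $ i\<bar> \<le> norm A" .
  qed
  finally show ?thesis by simp
qed

text \<open>With \<theta> = (1+\<mu>)/(2+\<mu>) the left side equals P^\<theta> Q^(1-\<theta>) for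
  the two summands P and Q on the right: the powers of \<open>l\<close> cancel and those of
  \<open>m\<close> add up to r. Each factor is then enlarged to a power of P + Q.\<close>

lemma young_powr:
  fixes \<mu> :: real
  assumes "m > 0" "Y > 0" "l > 0" "\<mu> > 0"
  shows "m powr r * Y powr ((1 + \<mu>) / (2 + \<mu>)) \<le>
    l * (m * Y) + l powr (- (1 + \<mu>)) * m powr (1 + (r - 1) * (2 + \<mu>))"
proof -
  let ?\<theta> = "(1 + \<mu>) / (2 + \<mu>)" and ?s = "1 + (r - 1) * (2 + \<mu>)"
  let ?p = "l * (m * Y)" and ?q = "l powr (- (1 + \<mu>)) * m powr ?s"
  have pq: "?p > 0" "?q > 0" using assms by auto
  have \<theta>: "1 - ?\<theta> = 1 / (2 + \<mu>)" using assms by (simp add: field_simps)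
  have split: "(l * (m * Y)) powr h * (l powr e * m powr s) powr g = l powr (h + e * g) * m powr (h + s * g) * Y powr h"
    for h e g s using assms by (simp add: powr_mult powr_powr powr_add)
  have "?p powr ?\<theta> * ?q powr (1 - ?\<theta>) =
    l powr (?\<theta> + (- (1 + \<mu>)) * (1 - ?\<theta>)) * m powr (?\<theta> + ?s * (1 - ?\<theta>)) * Y powr ?\<theta>"
    by (rule split)
  also have "?\<theta> + (- (1 + \<mu>)) * (1 - ?\<theta>) = 0" unfolding \<theta> using assms by (simp add: field_simps)
  also have "?\<theta> + ?s * (1 - ?\<theta>) = r"
  proof -
    have "?\<theta> + ?s * (1 - ?\<theta>) = ((1 + \<mu>) + ?s) / (2 + \<mu>)" unfolding \<theta> by (simp add: add_divide_distrib)
    also have "(1 + \<mu>) + ?s = r * (2 + \<mu>)" by (simp add: algebra_simps)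
    finally show ?thesis using assms by simp
  qed
  finally have "m powr r * Y powr ?\<theta> = ?p powr ?\<theta> * ?q powr (1 - ?\<theta>)" using assms by simp
  also have "\<dots> \<le> (?p + ?q) powr ?\<theta> * (?p + ?q) powr (1 - ?\<theta>)"
    using pq assms unfolding \<theta> by (intro mult_mono powr_mono2) auto
  also have "\<dots> = ?p + ?q" using pq by (simp add: powr_add[symmetric])
  finally show ?thesis .
qed

text \<open>Take l = Z / (2(b+1)). The linear term is then at most Z/2, and the quadratic one
  becomes c' Z^(1-\<mu>), which is at most Z/4 once Z^\<mu> \<ge> 4c'; what remains is Z \<le> 4a.
  The 1 added to \<open>b\<close> keeps \<open>l\<close> defined when b = 0.\<close>

lemma absorption:
  fixes \<mu> :: real
  assumes \<mu>: "0 < \<mu>" "\<mu> < 1" and abc: "a \<ge> 0" "b \<ge> 0" "c \<ge> 0"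
  obtains B where "\<And>Z. Z \<ge> 1 \<Longrightarrow> (\<And>l. l > 0 \<Longrightarrow> Z \<le> a + b * l + c * l powr (- (1 + \<mu>)) * Z\<^sup>2) \<Longrightarrow> Z \<le> B"
proof -
  define c' where "c' = c * (2 * (b + 1)) powr (1 + \<mu>)"
  have c': "c' \<ge> 0" using abc by (simp add: c'_def)
  define B where "B = max (4 * a) ((4 * c' + 1) powr (1 / \<mu>))"
  have "Z \<le> B" if Z: "Z \<ge> 1" and le: "\<And>l. l > 0 \<Longrightarrow> Z \<le> a + b * l + c * l powr (- (1 + \<mu>)) * Z\<^sup>2" for Z
  proof (cases "Z powr \<mu> \<le> 4 * c' + 1")
    case True
    then have "(Z powr \<mu>) powr (1 / \<mu>) \<le> (4 * c' + 1) powr (1 / \<mu>)" using \<mu> by (intro powr_mono2) auto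
    then show ?thesis using Z \<mu> by (simp add: B_def powr_powr)
  next
    case False
    let ?l = "Z / (2 * (b + 1))"
    have "Z \<le> a + b * ?l + c * ?l powr (- (1 + \<mu>)) * Z\<^sup>2" using Z abc by (intro le) simp
    also have "c * ?l powr (- (1 + \<mu>)) * Z\<^sup>2 = c' * (Z / Z powr \<mu>)"
    proof -
      have "?l powr (- (1 + \<mu>)) = (2 * (b + 1)) powr (1 + \<mu>) / Z powr (1 + \<mu>)"
        using Z abc by (simp only: powr_minus_divide powr_divide) (simp add: field_simps)
      moreover have "Z powr (1 + \<mu>) = Z * Z powr \<mu>" using Z by (simp add: powr_add)
      ultimately show ?thesis using Z by (simp add: c'_def power2_eq_square)
    qed
    also have "c' * (Z / Z powr \<mu>) \<le> Z / 4"
    proof -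
      have "c' * 4 \<le> Z powr \<mu>" using False by simp
      then show ?thesis using Z by (simp add: field_simps)
    qed
    also have "b * ?l \<le> Z / 2" using Z abc by (simp add: field_simps)
    finally show ?thesis by (simp add: B_def)
  qed
  then show thesis by (rule that)
qed

section \<open>The integrability bound\<close>

context mfg_solution
begin

text \<open>Both bounds of the hypothesis have the same homogeneity in Y = H + X: the square of each
  matrix norm is at most |K| Y^((2+2\<mu>)/(2+\<mu>)), for the second one because \<mu>/(2+\<mu>) +
  1 is that exponent. The absolute value is there because \<open>K\<close> comes without a
  sign.\<close>

lemma divb_bound:
  assumes \<mu>: "\<mu> > 0"
    and A9a: "\<And>x p. (norm (DxpH H x p))\<^sup>2 \<le> K * H x p powr ((2 + 2 * \<mu>) / (2 + \<mu>))"
    and A9b: "\<And>x p M. transpose M = M \<Longrightarrow>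
          (norm (DppH H x p ** M))\<^sup>2 \<le> K * H x p powr (\<mu> / (2 + \<mu>)) * trace (DppH H x p ** (M ** M))"
  shows "\<bar>fp.divb z\<bar> \<le> 2 * real CARD('d) * sqrt \<bar>K\<bar> * (ham u z + X z) powr ((1 + \<mu>) / (2 + \<mu>))"
proof -
  let ?x = "fst z" and ?p = "grad u z" and ?\<theta> = "(1 + \<mu>) / (2 + \<mu>)" and ?Y = "ham u z + X z"
  let ?n1 = "norm (DxpH H ?x ?p)" and ?n2 = "norm (DppH H ?x ?p ** hess u z)"
    and ?e = "(2 + 2 * \<mu>) / (2 + \<mu>)" and ?b = "sqrt \<bar>K\<bar> * ?Y powr ?\<theta>"
  have h: "ham u z > 0" "X z \<ge> 0" using ham_ge_1[of z] X_nonneg[of z] by auto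
  have sq: "(?Y powr ?\<theta>)\<^sup>2 = ?Y powr ?e"
    by (simp add: power2_eq_square powr_add[symmetric] add_divide_distrib[symmetric])
  have root: "y \<le> ?b" if "y\<^sup>2 \<le> \<bar>K\<bar> * ?Y powr ?e" for y
    by (rule power2_le_imp_le) (use that in \<open>auto simp: power_mult_distrib sq\<close>)
  have "?n1 \<le> ?b"
  proof (rule root)
    have "(?n1)\<^sup>2 \<le> K * ham u z powr ?e"
      using A9a[of ?x ?p] by (simp add: ham_eq)
    also have "\<dots> \<le> \<bar>K\<bar> * ?Y powr ?e"
      using h \<mu> by (intro mult_mono powr_mono2) auto
    finally show "(?n1)\<^sup>2 \<le> \<bar>K\<bar> * ?Y powr ?e" .
  qed
  moreover have "?n2 \<le> ?b"
  proof (rule root)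
    have "(?n2)\<^sup>2 \<le> K * ham u z powr (\<mu> / (2 + \<mu>)) * X z"
      using A9b[OF transpose_hess[OF u], of ?x ?p z] by (simp add: ham_eq X_def)
    also have "\<dots> \<le> \<bar>K\<bar> * ?Y powr (\<mu> / (2 + \<mu>)) * ?Y"
      using h \<mu> by (intro mult_mono powr_mono2) auto
    also have "\<dots> = \<bar>K\<bar> * ?Y powr (\<mu> / (2 + \<mu>) + 1)"
      using h by (simp add: powr_add)
    also have "\<mu> / (2 + \<mu>) + 1 = (2 + 2 * \<mu>) / (2 + \<mu>)" using \<mu> by (simp add: field_simps)
    finally show "(?n2)\<^sup>2 \<le> \<bar>K\<bar> * ?Y powr ?e" .
  qed
  moreover have "\<bar>fp.divb z\<bar> \<le> real CARD('d) * ?n1 + real CARD('d) * ?n2"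
    unfolding fp.divb_def div_drift[OF u]
    using abs_trace_le[of "DxpH H ?x ?p"] abs_trace_le[of "DppH H ?x ?p ** hess u z"] by linarith
  ultimately have "\<bar>fp.divb z\<bar> \<le> real CARD('d) * (?b) + real CARD('d) * (?b)"
    by (smt (verit) mult_left_mono of_nat_0_le_iff)
  then show ?thesis by simp
qed

lemma m_powr_slice:
  assumes "t \<in> {0..T}"
  shows "smooth_fun (\<lambda>x. m (x, t) powr r)" "Zd_periodic (\<lambda>x. m (x, t) powr r)"
  by (intro smooth_fun_powr torus_smooth_slice m m_pos assms)
    (rule Zd_periodic_compose[OF torus_smooth_periodic[OF m]])

lemma m_powr_divb_continuous: "continuous_on ({0..T} \<times> UNIV) (\<lambda>(t, x). m (x, t) powr r * fp.divb (x, t))"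
proof -
  have c: "continuous_on ({0..T} \<times> UNIV) (\<lambda>z. f (snd z, fst z))" if "torus_smooth f" for f :: "(real^'d) \<times> real \<Rightarrow> real"
    by (rule continuous_on_compose2[OF smooth_continuous_on[OF torus_smooth_smooth[OF that], of UNIV]])
      (auto intro!: continuous_intros)
  show ?thesis unfolding split_def
    by (intro continuous_on_mult continuous_on_powr continuous_on_const c m fp.divb)
      (use m_pos in \<open>auto simp: less_imp_neq[symmetric]\<close>)
qed

text \<open>With \<open>Z = 1 + max\<^sub>t \<integral> m\<^sup>r + \<integral>\<integral> |D m^(r/2)|\<^sup>2\<close>, the drift term is bounded by
  \<open>b \<lambda> + c \<lambda>^(-(1+\<mu>)) Z\<^sup>2\<close> for every \<open>\<lambda> > 0\<close>; taking \<open>\<lambda>\<close> proportional to \<open>Z\<close> closes the estimate.\<close>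

lemma power_integral_inequality:
  fixes \<mu> r \<kappa> D Cg S y0 :: real
  defines "q \<equiv> 1 + r / (4 * (r - 1))"
  assumes \<mu>: "\<mu> > 0" and r: "r > 1" and \<kappa>: "0 < \<kappa>" "\<kappa> < 2" and d: "CARD('d) \<ge> 2"
    and s: "1 + (r - 1) * (2 + \<mu>) \<le> r + r * \<kappa> / real CARD('d)"
    and D: "D \<ge> 0" "\<And>z. \<bar>fp.divb z\<bar> \<le> D * (ham u z + X z) powr ((1 + \<mu>) / (2 + \<mu>))"
    and Cg: "Cg > 0" "\<And>w A. \<lbrakk>smooth_fun w; Zd_periodic w; \<And>x::real^'d. w x > 0; A > 0;
     torus_integral (\<lambda>x. (w x)\<^sup>2) \<le> A\<rbrakk> \<Longrightarrow>
     torus_integral (\<lambda>x. w x powr (2 + 2 * \<kappa> / real CARD('d))) \<le>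
       Cg * A powr (\<kappa> / real CARD('d)) * (A + torus_integral (grad_sq w))"
    and S: "\<J> (\<lambda>z. m z * (ham u z + X z)) \<le> S"
    and y0: "torus_integral (\<lambda>x. m (x, 0) powr r) \<le> y0"
  obtains Z where "Z \<ge> 1" "\<And>t. t \<in> {0..T} \<Longrightarrow> torus_integral (\<lambda>x. m (x, t) powr r) \<le> Z"
    "\<And>l. l > 0 \<Longrightarrow> Z \<le> (1 + q * y0)
       + q * ((r - 1) * D * S) * l
       + q * ((r - 1) * D * (T + Cg * (T + 1))) * l powr (- (1 + \<mu>)) * Z\<^sup>2"
proof -
  let ?d = "real CARD('d)"
  let ?s = "1 + (r - 1) * (2 + \<mu>)" and ?L = "\<lambda>l. l powr (- (1 + \<mu>))"
  define y where "y t = torus_integral (\<lambda>x. m (x, t) powr r)" for t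
  define E where "E t = torus_integral (grad_sq (\<lambda>x. m (x, t) powr (r / 2)))" for t
  define I where "I t = torus_integral (\<lambda>x. m (x, t) powr r * fp.divb (x, t))" for t
  define f where "f t = torus_integral (\<lambda>x. m (x, t) * (ham u (x, t) + X (x, t)))" for t
  \<comment> \<open>The dissipation constant; \<open>q\<close> in the statement is 1 + 1/c1.\<close>
  define c1 where "c1 = 4 * (r - 1) / r"
  have c1: "c1 > 0" using r by (simp add: c1_def)
  have smf: "torus_smooth (\<lambda>z. m z * (ham u z + X z))" by (intro all_smooths)
  have dy: "(y has_real_derivative (- c1 * E t + (r - 1) * I t)) (at t within {0..T})" if "t \<in> {0..T}" for t
    using fp.density_power_derivative[of r, OF m_pos _ that] r unfolding y_def[abs_def] E_def I_def c1_def by simp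
  have yc: "continuous_on {0..T} y"
    using dy by (intro DERIV_continuous_on)
  have y_nonneg: "y t \<ge> 0" if "t \<in> {0..T}" for t
    unfolding y_def by (intro torus_integral_nonneg smooth_continuous_on m_powr_slice that) auto
  have E_nonneg: "E t \<ge> 0" if "t \<in> {0..T}" for t
    unfolding E_def by (intro torus_integral_nonneg grad_sq_continuous grad_sq_nonneg m_powr_slice that)
  have Ic: "continuous_on {0..T} I"
    unfolding I_def[abs_def] by (intro continuous_on_torus_integral m_powr_divb_continuous)
  have FTC: "((\<lambda>t. - c1 * E t + (r - 1) * I t) has_integral (y \<tau> - y 0)) {0..\<tau>}" if "\<tau> \<in> {0..T}" for \<tau>
  proof (rule fundamental_theorem_of_calculus)
    show "0 \<le> \<tau>" using that by simp
    show "(y has_vector_derivative (- c1 * E t + (r - 1) * I t)) (at t within {0..\<tau>})" if "t \<in> {0..\<tau>}" for t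
      unfolding has_real_derivative_iff_has_vector_derivative[symmetric]
      by (rule DERIV_subset[OF dy]) (use that \<open>\<tau> \<in> {0..T}\<close> in auto)
  qed
  have Iint: "I integrable_on {0..\<tau>}" if "\<tau> \<in> {0..T}" for \<tau>
    using that by (intro integrable_continuous_interval continuous_on_subset[OF Ic]) auto
  \<comment> \<open>Integrability of \<open>E\<close> is read off from the fundamental theorem of
    calculus, as a combination of the derivative of \<open>y\<close> and of \<open>I\<close>; no
    regularity of \<open>E\<close> in time has to be shown.\<close>
  have Eint: "E integrable_on {0..\<tau>}" if \<tau>: "\<tau> \<in> {0..T}" for \<tau>
  proof -
    have "(\<lambda>t. ((r - 1) * I t - (- c1 * E t + (r - 1) * I t)) / c1) integrable_on {0..\<tau>}"
      using FTC[OF \<tau>] Iint[OF \<tau>] by (intro integrable_on_divide integrable_diff integrable_on_mult_right) (auto simp: integrable_on_def)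
    then show ?thesis using c1 by simp
  qed
  obtain t1 where t1: "t1 \<in> {0..T}" "\<And>t. t \<in> {0..T} \<Longrightarrow> y t \<le> y t1"
    using continuous_attains_sup[OF _ _ yc] T by auto
  define A where "A = 1 + y t1"
  define ET where "ET = integral {0..T} E"
  define Z where "Z = A + ET"
  have A: "A \<ge> 1" using y_nonneg[OF t1(1)] by (simp add: A_def)
  have TT: "T \<in> {0..T}" using T by simp
  have ET: "ET \<ge> 0" unfolding ET_def by (rule integral_nonneg[OF Eint[OF TT] E_nonneg])
  have Z: "Z \<ge> 1" "A \<le> Z" "ET \<le> Z" using A ET by (auto simp: Z_def)
  have ms: "torus_integral (\<lambda>x. m (x, t) powr ?s) \<le> 1 + Cg * Z * (A + E t)" if t: "t \<in> {0..T}" for t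
  proof -
    let ?w = "\<lambda>x. m (x, t) powr (r / 2)" and ?e = "2 + 2 * \<kappa> / ?d"
    have w2: "(?w x)\<^sup>2 = m (x, t) powr r" for x by (simp add: power2_eq_square powr_add[symmetric])
    have we: "?w x powr ?e = m (x, t) powr (r + r * \<kappa> / ?d)" for x by (simp add: powr_powr algebra_simps)
    have "torus_integral (\<lambda>x. m (x, t) powr ?s) \<le> torus_integral (\<lambda>x. 1 + ?w x powr ?e)"
    proof (rule torus_integral_mono)
      show "m (x, t) powr ?s \<le> 1 + ?w x powr ?e" for x
      \<comment> \<open>The larger exponent dominates only where m > 1; the summand 1 takes care of
        the rest.\<close>
      proof (cases "m (x, t) \<le> 1")
        case True
        then have "m (x, t) powr ?s \<le> 1"
          using m_pos[OF t, of x] r \<mu> by (intro powr_le1) auto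
        then show ?thesis by (simp add: add_increasing2)
      next
        case False
        then have "m (x, t) powr ?s \<le> m (x, t) powr (r + r * \<kappa> / ?d)"
          using s by (intro powr_mono) auto
        then show ?thesis unfolding we by simp
      qed
      show "continuous_on UNIV (\<lambda>x. m (x, t) powr ?s)"
        by (intro smooth_continuous_on m_powr_slice t)
      show "continuous_on UNIV (\<lambda>x. 1 + ?w x powr ?e)"
        unfolding we by (intro continuous_on_add continuous_on_const smooth_continuous_on m_powr_slice t)
    qed
    also have "\<dots> = 1 + torus_integral (\<lambda>x. ?w x powr ?e)"
      unfolding we
      by (subst torus_integral_add[OF continuous_on_const smooth_continuous_on[OF m_powr_slice(1)[OF t]]])
        (simp add: torus_integral_const)
    also have "torus_integral (\<lambda>x. ?w x powr ?e) \<le> Cg * A powr (\<kappa> / ?d) * (A + E t)"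
      unfolding E_def
    proof (rule Cg(2))
      show "smooth_fun ?w" "Zd_periodic ?w" by (intro m_powr_slice t)+
      show "torus_integral (\<lambda>x. (?w x)\<^sup>2) \<le> A" using t1(2)[OF t] unfolding w2 A_def y_def by simp
      show "?w x > 0" for x using m_pos[OF t, of x] by simp
    qed (use A in simp)
    also have "\<dots> \<le> Cg * Z * (A + E t)"
    proof -
      \<comment> \<open>\<kappa> < 2 \<le> d and A \<ge> 1: the power of \<open>A\<close> costs at
        most one factor Z. The 1 added in \<open>A\<close> is there for this.\<close>
      have "A powr (\<kappa> / ?d) \<le> A powr 1" using A \<kappa> d by (intro powr_mono) (auto simp: field_simps)
      then have "A powr (\<kappa> / ?d) \<le> Z" using A Z by simp
      then show ?thesis using A E_nonneg[OF t] Cg(1) by (intro mult_right_mono mult_left_mono) auto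
    qed
    finally show ?thesis by simp
  qed
  have Ile: "I t \<le> D * (l * f t + ?L l * (1 + Cg * Z * (A + E t)))" if t: "t \<in> {0..T}" and l: "l > 0" for t l
  proof -
    have "I t \<le> torus_integral (\<lambda>x. D * (l * (m (x, t) * (ham u (x, t) + X (x, t))) + ?L l * m (x, t) powr ?s))"
      unfolding I_def
    proof (rule torus_integral_mono)
      show "m (x, t) powr r * fp.divb (x, t) \<le> D * (l * (m (x, t) * (ham u (x, t) + X (x, t))) + ?L l * m (x, t) powr ?s)" for x
      proof -
        let ?Y = "ham u (x, t) + X (x, t)"
        have Y: "?Y > 0" using ham_ge_1[of "(x, t)"] X_nonneg[of "(x, t)"] by linarith
        have "m (x, t) powr r * fp.divb (x, t) \<le> m (x, t) powr r * (D * ?Y powr ((1 + \<mu>) / (2 + \<mu>)))"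
          using D(2)[of "(x, t)"] by (intro mult_left_mono) auto
        also have "\<dots> = D * (m (x, t) powr r * ?Y powr ((1 + \<mu>) / (2 + \<mu>)))" by simp
        also have "\<dots> \<le> D * (l * (m (x, t) * ?Y) + ?L l * m (x, t) powr ?s)"
          by (intro mult_left_mono young_powr m_pos t Y l \<mu> D)
        finally show ?thesis .
      qed
    qed (intro continuous_on_mult continuous_on_add continuous_on_const slice_continuous[OF smf]
          slice_continuous[OF fp.divb] smooth_continuous_on[OF m_powr_slice(1)[OF t]])+
    also have "\<dots> = D * (l * f t + ?L l * torus_integral (\<lambda>x. m (x, t) powr ?s))"
      unfolding f_def
      by (subst torus_integral_cmult, subst torus_integral_add,
          (intro continuous_on_mult continuous_on_const slice_continuous[OF smf]
            smooth_continuous_on[OF m_powr_slice(1)[OF t]])+,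
          subst torus_integral_cmult, subst torus_integral_cmult, rule refl)
    also have "\<dots> \<le> D * (l * f t + ?L l * (1 + Cg * Z * (A + E t)))"
      using ms[OF t] D(1) by (intro mult_left_mono add_left_mono) auto
    finally show ?thesis .
  qed
  have fint: "f integrable_on {0..T}"
    unfolding f_def[abs_def] using spacetime_integrable[OF smf] .
  have f_nonneg: "f t \<ge> 0" if t: "t \<in> {0..T}" for t
    unfolding f_def by (intro torus_integral_nonneg slice_continuous[OF smf])
      (use m_pos[OF t] X_nonneg ham_ge_1 in \<open>auto intro!: mult_nonneg_nonneg add_nonneg_nonneg intro: less_imp_le order.trans[OF zero_le_one]\<close>)
  have key: "y \<tau> + c1 * integral {0..\<tau>} E \<le> y0 + (r - 1) * D * (l * S + ?L l * ((T + Cg * (T + 1)) * Z\<^sup>2))"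
    if \<tau>: "\<tau> \<in> {0..T}" and l: "l > 0" for \<tau> l
  proof -
    let ?R = "\<lambda>t. D * (l * f t + ?L l * (1 + Cg * Z * (A + E t)))"
    have Rint: "?R integrable_on {0..T}"
      using fint Eint[OF TT] by (intro integrable_on_mult_right integrable_add integrable_const_ivl)
    have R0: "?R t \<ge> 0" if "t \<in> {0..T}" for t
      using D(1) l f_nonneg[OF that] E_nonneg[OF that] A Z Cg(1) by (intro mult_nonneg_nonneg add_nonneg_nonneg) auto
    have "y \<tau> - y 0 = - c1 * integral {0..\<tau>} E + (r - 1) * integral {0..\<tau>} I"
      using integral_unique[OF FTC[OF \<tau>]] Eint[OF \<tau>] Iint[OF \<tau>]
      by (simp add: integral_diff integral_mult_right integrable_on_mult_right)
    moreover have "integral {0..\<tau>} I \<le> integral {0..T} ?R"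
    proof -
      have "integral {0..\<tau>} I \<le> integral {0..\<tau>} ?R"
        using \<tau> by (intro integral_le Iint Ile l integrable_subinterval_real[OF Rint]) auto
      also have "\<dots> \<le> integral {0..T} ?R"
        using \<tau> R0 by (intro integral_subset_le integrable_subinterval_real[OF Rint] Rint) auto
      finally show ?thesis .
    qed
    moreover have "integral {0..T} ?R \<le> D * (l * S + ?L l * ((T + Cg * (T + 1)) * Z\<^sup>2))"
    proof -
      have c: "((\<lambda>t. a) has_integral T * a) {0..T}" for a :: real
        using has_integral_const_real[of a 0 T] T by simp
      have "(?R has_integral D * (l * integral {0..T} f + ?L l * (T * 1 + Cg * Z * (T * A + ET)))) {0..T}"
        unfolding ET_def
        by (intro has_integral_mult_right has_integral_add c integrable_integral fint Eint TT)
      then have "integral {0..T} ?R = D * (l * integral {0..T} f + ?L l * (T * 1 + Cg * Z * (T * A + ET)))"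
        by (rule integral_unique)
      also have "\<dots> \<le> D * (l * S + ?L l * ((T + Cg * (T + 1)) * Z\<^sup>2))"
      proof (intro mult_left_mono add_mono D(1))
        show "integral {0..T} f \<le> S" using S unfolding spacetime_integral_def f_def .
        have "T * 1 \<le> T * Z\<^sup>2" using Z T by (intro mult_left_mono) (auto simp: one_le_power)
        moreover have "Cg * Z * (T * A + ET) \<le> Cg * Z * (T * Z + Z)"
          using Z T Cg(1) by (intro mult_left_mono add_mono) auto
        ultimately show "T * 1 + Cg * Z * (T * A + ET) \<le> (T + Cg * (T + 1)) * Z\<^sup>2"
          by (simp add: power2_eq_square algebra_simps)
      qed (use l in auto)
      finally show ?thesis .
    qed
    ultimately have "y \<tau> + c1 * integral {0..\<tau>} E \<le> y 0 + (r - 1) * (D * (l * S + ?L l * ((T + Cg * (T + 1)) * Z\<^sup>2)))"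
      using mult_left_mono[of "integral {0..\<tau>} I" "D * (l * S + ?L l * ((T + Cg * (T + 1)) * Z\<^sup>2))" "r - 1"] r
      by linarith
    then show ?thesis using y0 by (simp add: y_def mult.assoc)
  qed
  show thesis
  proof (rule that[of Z])
    show "Z \<ge> 1" by (rule Z)
    show "torus_integral (\<lambda>x. m (x, t) powr r) \<le> Z" if "t \<in> {0..T}" for t
      using t1(2)[OF that] Z(2) by (simp add: A_def y_def)
    show "Z \<le> (1 + q * y0)
       + q * ((r - 1) * D * S) * l
       + q * ((r - 1) * D * (T + Cg * (T + 1))) * ?L l * Z\<^sup>2" if l: "l > 0" for l
    proof -
      let ?K = "y0 + (r - 1) * D * (l * S + ?L l * ((T + Cg * (T + 1)) * Z\<^sup>2))"
      \<comment> \<open>The inequality \<open>key\<close> is used at the time of the maximum of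
        \<open>y\<close> and at T for the total dissipation; the weights 1 and 1/c1 add up to
        \<open>q\<close>.\<close>
      have "integral {0..t1} E \<ge> 0"
        using t1(1) by (intro integral_nonneg Eint E_nonneg) auto
      then have "y t1 \<le> ?K" using key[OF t1(1) l] c1 by (smt (verit) mult_nonneg_nonneg)
      moreover have "c1 * ET \<le> ?K" using key[OF TT l] y_nonneg[OF TT] unfolding ET_def by linarith
      then have "ET \<le> r / (4 * (r - 1)) * ?K" using r unfolding c1_def by (simp add: field_simps)
      ultimately have "Z \<le> 1 + q * ?K" unfolding Z_def A_def q_def by (simp add: distrib_right)
      moreover have "1 + q * (y0 + (r - 1) * D * (l * S + e * (h * Z\<^sup>2))) =
         (1 + q * y0) + q * ((r - 1) * D * S) * l + q * ((r - 1) * D * h) * e * Z\<^sup>2" for q e h :: real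
        by (simp add: algebra_simps)
      ultimately show ?thesis by metis
    qed
  qed
qed

end

section \<open>Combination of the first- and second-order energy estimates\<close>

context mfg_solution
begin

text \<open>\<open>\<psi> = m\<^sub>0 - s \<Delta>m\<^sub>0\<close> stays positive for small \<open>s\<close>; comparing the upper bound for
  \<open>\<integral> u(0) \<psi>\<close> with the lower bound for \<open>\<integral> u(0) m\<^sub>0\<close> controls \<open>- \<integral> u(0) \<Delta>m\<^sub>0\<close>, the
  initial term of the second-order estimate.\<close>

lemma energy_bounds:
  assumes \<phi>: "smooth_fun \<phi>" "Zd_periodic \<phi>" "\<kappa> > 0" "\<And>x. \<kappa> \<le> \<phi> x" "\<And>x. \<phi> x \<le> M"
      "\<And>x. norm (\<chi> i. dderiv \<phi> (axis i 1) x) \<le> L" "\<And>x p. L / \<kappa> * norm p \<le> H x p + K"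
      "\<And>x. m (x, 0) = \<phi> x"
    and \<psi>: "smooth_fun \<psi>" "Zd_periodic \<psi>" "\<kappa>' > 0" "\<And>x. \<kappa>' \<le> \<psi> x" "\<And>x. \<psi> x \<le> M'"
      "\<And>x. norm (\<chi> i. dderiv \<psi> (axis i 1) x) \<le> L'" "\<And>x p. L' / \<kappa>' * norm p \<le> H x p + K'"
      "\<And>x. \<psi> x = \<phi> x - s * lap m (x, 0)" "s > 0"
    and U: "\<And>x. \<bar>u (x, T)\<bar> \<le> U" "\<And>x. \<bar>lap u (x, T)\<bar> \<le> U'"
    and Ca: "\<And>x p. \<bar>trace (DxxH H x p)\<bar> \<le> Ca * H x p" "Ca \<ge> 0"
    and Cd: "\<And>M x p. transpose M = M \<Longrightarrow>
        trace (DpxH H x p ** M) \<le> 1/4 * trace (DppH H x p ** (M ** M)) + Cd * H x p" "Cd \<ge> 0"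
  defines "R \<equiv> U * M + T * (\<kappa> * K + (2 * M) powr \<alpha> * M) + U + C * T"
    and "R' \<equiv> U * M' + T * (\<kappa>' * K' + (2 * M') powr \<alpha> * M') + U + C * T"
  shows "\<J> (\<lambda>z. m z * (ham u z + X z)) \<le> R / c + 2 * (U' + (R' + R) / s + (Ca + 2 * Cd) * (R / c))"
proof -
  let ?h = "\<J> (\<lambda>z. m z * ham u z)" and ?g = "\<J> (\<lambda>z. m z * G z)"
  have h0: "?h \<ge> 0" and g0: "?g \<ge> 0"
    using T m_pos ham_ge_1 G_nonneg
    by (auto intro!: spacetime_integral_nonneg all_smooths mult_nonneg_nonneg
        intro: less_imp_le order.trans[OF zero_le_one])
  have low: "torus_integral (\<lambda>x. u (x, 0) * \<phi> x) \<ge> - U + c * ?h - C * T + ?g"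
    using duality_lower_bound[OF U(1)] \<phi>(8) by (simp add: mult.commute)
  moreover have up: "torus_integral (\<lambda>x. u (x, 0) * \<phi> x) \<le>
     U * M + T * (\<kappa> * K + (2 * M) powr \<alpha> * M) + ?g / 2"
    by (rule test_function_upper_bound[OF \<phi>(1-7) U(1)])
  ultimately have "c * ?h + ?g / 2 \<le> R" unfolding R_def by linarith
  \<comment> \<open>The coupling enters the lower bound once and the upper bound half, so half of it
    stays on the left and is bounded together with the Hamiltonian.\<close>
  then have hR: "?h \<le> R / c" and gR: "?g \<le> 2 * R"
    using c h0 g0 by (auto simp: field_simps) (smt (verit) mult_nonneg_nonneg)
  have "torus_integral (\<lambda>x. u (x, 0) * \<psi> x) \<le>
     U * M' + T * (\<kappa>' * K' + (2 * M') powr \<alpha> * M') + ?g / 2"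
    by (rule test_function_upper_bound[OF \<psi>(1-7) U(1)])
  moreover have "torus_integral (\<lambda>x. u (x, 0) * \<psi> x) =
     torus_integral (\<lambda>x. u (x, 0) * \<phi> x) - s * torus_integral (\<lambda>x. u (x, 0) * lap m (x, 0))"
  proof -
    have "torus_integral (\<lambda>x. u (x, 0) * \<psi> x) = torus_integral (\<lambda>x. u (x, 0) * \<phi> x - s * (u (x, 0) * lap m (x, 0)))"
      unfolding \<psi>(8) by (simp add: algebra_simps)
    also have "\<dots> = torus_integral (\<lambda>x. u (x, 0) * \<phi> x) - torus_integral (\<lambda>x. s * (u (x, 0) * lap m (x, 0)))"
      by (rule torus_integral_diff; intro continuous_on_mult continuous_on_const slice_continuous
          smooth_continuous_on \<phi> smooths)
    finally show ?thesis by (simp add: torus_integral_cmult)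
  qed
  moreover have "c * ?h \<ge> 0" using c h0 by simp
  ultimately have "s * (- torus_integral (\<lambda>x. u (x, 0) * lap m (x, 0))) \<le> R' + R"
    using low gR g0 unfolding R'_def by linarith
  then have lap0: "- torus_integral (\<lambda>x. u (x, 0) * lap m (x, 0)) \<le> (R' + R) / s"
    using \<psi>(9) by (simp add: field_simps)
  have "\<J> (\<lambda>z. m z * X z) \<le> 2 * (U' - torus_integral (\<lambda>x. u (x, 0) * lap m (x, 0)) + (Ca + 2 * Cd) * ?h)"
    by (rule second_order_identity[OF Ca(1) Cd(1) U(2)])
  also have "\<dots> \<le> 2 * (U' + (R' + R) / s + (Ca + 2 * Cd) * (R / c))"
  proof -
    have "(Ca + 2 * Cd) * ?h \<le> (Ca + 2 * Cd) * (R / c)"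
      using Ca(2) Cd(2) by (intro mult_left_mono[OF hR]) simp
    moreover have "U' - torus_integral (\<lambda>x. u (x, 0) * lap m (x, 0)) \<le> U' + (R' + R) / s"
      using lap0 by linarith
    ultimately show ?thesis using hR Ca(2) Cd(2) by (intro mult_left_mono add_mono) auto
  qed
  finally have "?h + \<J> (\<lambda>z. m z * X z) \<le> R / c + 2 * (U' + (R' + R) / s + (Ca + 2 * Cd) * (R / c))"
    using hR by linarith
  moreover have "\<J> (\<lambda>z. m z * (ham u z + X z)) = ?h + \<J> (\<lambda>z. m z * X z)"
    unfolding distrib_left by (rule spacetime_integral_add) (intro all_smooths)+
  ultimately show ?thesis by simp
qed

end

section \<open>Bounds on the data and the final choice of constants\<close>

lemma smooth_periodic_grad_bounded:
  fixes \<phi> :: "real^'d \<Rightarrow> real"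
  assumes "smooth_fun \<phi>" "Zd_periodic \<phi>"
  obtains L where "L \<ge> 0" "\<And>x. norm (\<chi> i. dderiv \<phi> (axis i 1) x :: real^'d) \<le> L"
proof -
  have "\<exists>B. \<forall>x. \<bar>dderiv \<phi> (axis i 1) x\<bar> \<le> B" for i :: 'd
    using Zd_periodic_bounded[OF Zd_periodic_dderiv[OF assms(2)] smooth_continuous_on[OF smooth_fun_dderiv[OF assms(1)]]]
    by metis
  then obtain B where B: "\<And>i x. \<bar>dderiv \<phi> (axis i 1) x\<bar> \<le> B i" by metis
  have "norm (\<chi> i. dderiv \<phi> (axis i 1) x :: real^'d) \<le> (\<Sum>i\<in>UNIV. B i)" for x
    using norm_le_l1_cart[of "\<chi> i. dderiv \<phi> (axis i 1) x"] sum_mono[of UNIV "\<lambda>i. \<bar>dderiv \<phi> (axis i 1) x\<bar>" B, OF B] by simp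
  then show thesis using that norm_ge_zero order.trans by metis
qed

text \<open>Counterpart of \<open>lap\<close> for functions of x alone: the constants must be fixed
  from the initial and terminal data before \<epsilon>, u and m are given.\<close>

definition laplacian :: "(real^'d \<Rightarrow> real) \<Rightarrow> real^'d \<Rightarrow> real" where
  "laplacian f x = (\<Sum>i\<in>UNIV. dderiv (dderiv f (axis i 1)) (axis i 1) x)"

lemma lap_slice: "lap f (x, t) = laplacian (\<lambda>y. f (y, t)) x"
  unfolding lap_def laplacian_def by (simp add: dderiv_slice[abs_def])

lemma laplacian_smooth: "smooth_fun f \<Longrightarrow> smooth_fun (laplacian f)"
  unfolding laplacian_def[abs_def] by (intro smooth_fun_sum smooth_fun_dderiv)

lemma laplacian_periodic: "Zd_periodic f \<Longrightarrow> Zd_periodic (laplacian f)"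
proof -
  assume f: "Zd_periodic f"
  have "dderiv (dderiv f v) v (x + k) = dderiv (dderiv f v) v x" if "\<forall>i. k $ i \<in> \<int>" for x k v
    using Zd_periodic_add[OF Zd_periodic_dderiv[OF Zd_periodic_dderiv[OF f]], of k] that by blast
  then show ?thesis by (simp add: laplacian_def Zd_periodic_def)
qed

theorem theorem5:
  fixes H :: "real^'d \<Rightarrow> real^'d \<Rightarrow> real"
    and uT m0 \<eta> :: "real^'d \<Rightarrow> real"
    and T \<alpha> \<mu> r :: real
  assumes d2: "CARD('d) \<ge> 2"
    and T: "T > 0"
    \<comment> \<open>(A1)\<close>
    and H_smooth: "smooth_fun (\<lambda>(x, p). H x p)"
    and H_per: "\<forall>p. Zd_periodic (\<lambda>x. H x p)"
    and H_conv: "\<forall>x. strictly_convex (H x)"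
    and H_superlin: "\<forall>x. filterlim (\<lambda>p. H x p / norm p) at_top at_infinity"
    and H_ge1: "\<forall>x p. H x p \<ge> 1"
    \<comment> \<open>(A2) and (A4): g(z) = z powr alpha\<close>
    and uT_smooth: "smooth_fun uT" and uT_per: "Zd_periodic uT"
    and m0_smooth: "smooth_fun m0" and m0_per: "Zd_periodic m0"
    and m0_nonneg: "\<forall>x. m0 x \<ge> 0"
    and m0_mass: "torus_integral m0 = 1"
    and alpha: "\<alpha> > 0"
    \<comment> \<open>(A3)\<close>
    and A3: "\<exists>c C. c > 0 \<and> C > 0 \<and>
               (\<forall>x p. DpH H x p \<bullet> p - H x p \<ge> c * H x p - C)"
    \<comment> \<open>(A5)\<close>
    and A5a: "\<exists>C. \<forall>x p. norm (DxH H x p) \<le> C * H x p + C \<and>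
                         norm (DxxH H x p) \<le> C * H x p + C"
    and A5b: "\<forall>\<delta>>0. \<exists>C\<delta>. \<forall>M x p. transpose M = M \<longrightarrow>
               trace (DpxH H x p ** M) \<le> \<delta> * trace (DppH H x p ** (M ** M)) + C\<delta> * H x p"
    \<comment> \<open>(A6)\<close>
    and A6: "\<exists>\<kappa>0>0. \<forall>x. m0 x \<ge> \<kappa>0"
    \<comment> \<open>(A9)\<close>
    and mu: "0 < \<mu>" "\<mu> < 1"
    and A9: "\<exists>C. \<forall>x p. (norm (DxpH H x p))\<^sup>2 \<le> C * H x p powr ((2 + 2 * \<mu>) / (2 + \<mu>)) \<and>
               (\<forall>M. transpose M = M \<longrightarrow>
                  (norm (DppH H x p ** M))\<^sup>2 \<le> C * H x p powr (\<mu> / (2 + \<mu>)) * trace (DppH H x p ** (M ** M)))"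
    \<comment> \<open>mollifier\<close>
    and eta: "mollifier_kernel \<eta>"
    \<comment> \<open>exponent range\<close>
    and r: "1 \<le> r" "r < real CARD('d) * (1 + \<mu>) / (real CARD('d) * (1 + \<mu>) - 2)"
  shows "\<exists>B. \<forall>\<epsilon> u m. \<epsilon> > 0 \<longrightarrow> reg_MFG_solution H \<eta> \<alpha> T uT m0 \<epsilon> u m \<longrightarrow>
           (\<forall>t\<in>{0..T}. torus_integral (\<lambda>x. \<bar>m (x, t)\<bar> powr r) powr (1 / r) \<le> B)"
proof -
  let ?reg = "reg_MFG_solution H \<eta> \<alpha> T uT m0"
  interpret hamiltonian H
    using H_smooth H_per by unfold_locales auto
  let ?d = "real CARD('d)"
  obtain c C where cC: "c > 0" "C > 0" "\<And>x p. DpH H x p \<bullet> p - H x p \<ge> c * H x p - C" using A3 by blast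
  obtain C5 where C5: "\<And>x p. norm (DxH H x p) \<le> C5 * H x p + C5" "\<And>x p. norm (DxxH H x p) \<le> C5 * H x p + C5"
    using A5a by blast
  \<comment> \<open>The factor 2 absorbs the additive constant of the hypothesis, using H \<ge> 1;
    the dimension comes from bounding a trace by the norm.\<close>
  define Ca where "Ca = ?d * (2 * \<bar>C5\<bar>)"
  have Ca: "\<bar>trace (DxxH H x p)\<bar> \<le> Ca * H x p" for x p
  proof -
    have "C5 * H x p + C5 \<le> \<bar>C5\<bar> * H x p + \<bar>C5\<bar> * H x p"
      using H_ge1[rule_format, of x p] mult_left_mono[of 1 "H x p" "\<bar>C5\<bar>"] mult_right_mono[of C5 "\<bar>C5\<bar>" "H x p"]
      by linarith
    then have "norm (DxxH H x p) \<le> 2 * \<bar>C5\<bar> * H x p" using C5(2)[of x p] by simp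
    then have "?d * norm (DxxH H x p) \<le> ?d * (2 * \<bar>C5\<bar> * H x p)" by (rule mult_left_mono) simp
    also have "\<dots> = Ca * H x p" by (simp add: Ca_def)
    finally show ?thesis using abs_trace_le[of "DxxH H x p"] by (rule order.trans[rotated])
  qed
  obtain C6 where C6: "\<And>M x p. transpose M = M \<Longrightarrow>
      trace (DpxH H x p ** M) \<le> 1/4 * trace (DppH H x p ** (M ** M)) + C6 * H x p"
    using A5b[rule_format, of "1/4"] by auto
  have Cd: "trace (DpxH H x p ** M) \<le> 1/4 * trace (DppH H x p ** (M ** M)) + \<bar>C6\<bar> * H x p"
    if "transpose M = M" for M x p
    using C6[OF that, of x p] mult_right_mono[of C6 "\<bar>C6\<bar>" "H x p"] H_ge1[rule_format, of x p] by linarith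
  obtain K9 where K9: "\<And>x p. (norm (DxpH H x p))\<^sup>2 \<le> K9 * H x p powr ((2 + 2 * \<mu>) / (2 + \<mu>))"
    "\<And>x p M. transpose M = M \<Longrightarrow>
      (norm (DppH H x p ** M))\<^sup>2 \<le> K9 * H x p powr (\<mu> / (2 + \<mu>)) * trace (DppH H x p ** (M ** M))"
    using A9 by blast
  obtain \<kappa>0 where \<kappa>0: "\<kappa>0 > 0" "\<And>x. m0 x \<ge> \<kappa>0" using A6 by blast
  have sup: "\<exists>C'. \<forall>x p. K * norm p \<le> H x p + C'" if "K \<ge> 0" for K
    using uniformly_superlinear[OF C5(1) H_ge1[rule_format] H_superlin[rule_format] that] by metis
  obtain M where M: "\<And>x. \<bar>m0 x\<bar> \<le> M"
    using Zd_periodic_bounded[OF m0_per smooth_continuous_on[OF m0_smooth]] by metis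
  obtain L where L: "L \<ge> 0" "\<And>x. norm (\<chi> i. dderiv m0 (axis i 1) x :: real^'d) \<le> L"
    using smooth_periodic_grad_bounded[OF m0_smooth m0_per] by metis
  obtain K where K: "\<And>x p. L / \<kappa>0 * norm p \<le> H x p + K" using sup[of "L / \<kappa>0"] L \<kappa>0 by auto
  let ?l = "laplacian m0"
  have l: "smooth_fun ?l" "Zd_periodic ?l" by (intro laplacian_smooth laplacian_periodic m0_smooth m0_per)+
  obtain N where N: "N > 0" "\<And>x. \<bar>?l x\<bar> \<le> N"
    using Zd_periodic_bounded[OF l(2) smooth_continuous_on[OF l(1)]] by metis
  \<comment> \<open>Small enough that subtracting s times the Laplacian removes at most half of the
    lower bound of the initial density.\<close>
  define s where "s = \<kappa>0 / (2 * N)"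
  have s: "s > 0" using \<kappa>0 N by (simp add: s_def)
  define \<psi> where "\<psi> x = m0 x - s * ?l x" for x
  have \<psi>s: "smooth_fun \<psi>" unfolding \<psi>_def[abs_def] by (intro smooth_fun_diff smooth_fun_mult smooth_fun_const m0_smooth l)
  have \<psi>p: "Zd_periodic \<psi>" using m0_per l(2) by (simp add: \<psi>_def Zd_periodic_def)
  have \<psi>low: "\<kappa>0 / 2 \<le> \<psi> x" for x
  proof -
    have "s * ?l x \<le> s * N" using N(2)[of x] s by (intro mult_left_mono) auto
    also have "s * N = \<kappa>0 / 2" using N by (simp add: s_def)
    finally show ?thesis using \<kappa>0(2)[of x] by (simp add: \<psi>_def)
  qed
  obtain M' where M': "\<And>x. \<bar>\<psi> x\<bar> \<le> M'"
    using Zd_periodic_bounded[OF \<psi>p smooth_continuous_on[OF \<psi>s]] by metis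
  obtain L' where L': "L' \<ge> 0" "\<And>x. norm (\<chi> i. dderiv \<psi> (axis i 1) x :: real^'d) \<le> L'"
    using smooth_periodic_grad_bounded[OF \<psi>s \<psi>p] by metis
  obtain K' where K': "\<And>x p. L' / (\<kappa>0 / 2) * norm p \<le> H x p + K'" using sup[of "L' / (\<kappa>0 / 2)"] L' \<kappa>0 by auto
  obtain U where U: "\<And>x. \<bar>uT x\<bar> \<le> U"
    using Zd_periodic_bounded[OF uT_per smooth_continuous_on[OF uT_smooth]] by metis
  obtain U' where U': "\<And>x. \<bar>laplacian uT x\<bar> \<le> U'"
    using Zd_periodic_bounded[OF laplacian_periodic[OF uT_per] smooth_continuous_on[OF laplacian_smooth[OF uT_smooth]]] by metis
  have sol: "mfg_solution H (moll \<eta> \<epsilon>) (\<epsilon> *\<^sub>R 1) u m T \<alpha> c C"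
    if e: "\<epsilon> > 0" and reg: "?reg \<epsilon> u m" for \<epsilon> u m
  proof -
    note R = reg[unfolded reg_MFG_solution_def]
    have u: "torus_smooth u" and m: "torus_smooth m" using R by (auto simp: torus_smooth_def)
    have grad: "grad_x u x t = grad u (x, t)" for x t by (simp add: grad_x_def jet_def)
    have lapx: "lap_x f x t = lap f (x, t)" for f x t by (simp add: lap_x_def lap_def)
    have F: "(case z of (y, s) \<Rightarrow> m (y, s) *\<^sub>R DpH H y (grad_x u y s)) $ i = m z * drift u i z" for i z
      by (cases z) (simp add: grad DpH_nth drift_def jet_def)
    interpret even_kernel "moll \<eta> \<epsilon>" "\<epsilon> *\<^sub>R 1" by (rule even_kernel_moll[OF eta e])
    show ?thesis
    proof
      show "- dderiv u (0, 1) (x, t) + ham u (x, t) =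
        lap u (x, t) + conv (moll \<eta> \<epsilon>) (\<lambda>y. (conv (moll \<eta> \<epsilon>) (\<lambda>y. m (y, t)) y) powr \<alpha>) x" if "t \<in> {0..T}" for x t
        using R that by (simp add: dt_def lapx g_eps_def ham_eq grad)
      show "dderiv m (0, 1) (x, t) = lap m (x, t) + (\<Sum>i\<in>UNIV. dx i (\<lambda>z. m z * drift u i z) (x, t))"
        if "t \<in> {0..T}" for x t
      proof -
        have "dt m x t - div_x (\<lambda>(y, s). m (y, s) *\<^sub>R DpH H y (grad_x u y s)) x t = lap_x m x t"
          using R that by blast
        then show ?thesis unfolding div_x_def F by (simp add: dt_def lapx)
      qed
      show "\<exists>\<kappa>>0. \<forall>x. \<kappa> < m (x, 0)"
      \<comment> \<open>The locale asks for a strict lower bound, hence half of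
        \<open>\<kappa>0\<close>.\<close>
      proof (intro exI[of _ "\<kappa>0 / 2"] conjI allI)
        have "\<kappa>0 / 2 < m0 x" for x using \<kappa>0(1) \<kappa>0(2)[of x] by linarith
        then show "\<kappa>0 / 2 < m (x, 0)" for x using R by simp
      qed (use \<kappa>0 in simp)
      show "torus_integral (\<lambda>x. m (x, 0)) = 1" using R m0_mass by simp
      show "strictly_convex (H x)" for x using H_conv by blast
      show "1 \<le> H x p" for x p using H_ge1 by blast
      show "c * H x p - C \<le> DpH H x p \<bullet> p - H x p" for x p by (rule cC)
    qed (use T alpha u m cC in auto)
  qed
  show ?thesis
  \<comment> \<open>For r = 1 mass conservation is the claim; the other case divides by r -
    1.\<close>
  proof (cases "r = 1")
    case True
    have "torus_integral (\<lambda>x. \<bar>m (x, t)\<bar> powr r) powr (1 / r) \<le> 1"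
      if "\<epsilon> > 0" "?reg \<epsilon> u m" "t \<in> {0..T}" for \<epsilon> u m t
    proof -
      interpret mfg_solution H "moll \<eta> \<epsilon>" "\<epsilon> *\<^sub>R 1" u m T \<alpha> c C by (rule sol[OF that(1,2)])
      show ?thesis using True mass[OF that(3)] m_pos[OF that(3)] by (simp add: less_imp_le)
    qed
    then show ?thesis by blast
  next
    case False
    with r have r1: "r > 1" by simp
    \<comment> \<open>The second argument is the least value for which the interpolation reaches the
      exponent from Young's inequality; the floor 1 only ensures positivity. The upper bound on r
      amounts to that argument being below 2.\<close>
    define \<kappa> where "\<kappa> = max 1 (?d * ((1 + (r - 1) * (2 + \<mu>)) / r - 1))"
    have d0: "?d * (1 + \<mu>) - 2 > 0"
    proof -
      have "2 * (1 + \<mu>) \<le> ?d * (1 + \<mu>)" using d2 mu by (intro mult_right_mono) auto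
      then show ?thesis using mu by simp
    qed
    have \<kappa>: "0 < \<kappa>" "\<kappa> < 2"
    proof -
      have "r * (?d * (1 + \<mu>) - 2) < ?d * (1 + \<mu>)" using r(2) d0 by (simp add: pos_less_divide_eq)
      then have "?d * ((1 + (r - 1) * (2 + \<mu>)) - r) < 2 * r" by (simp add: algebra_simps)
      then have "?d * ((1 + (r - 1) * (2 + \<mu>)) / r - 1) < 2" using r1 by (simp add: field_simps)
      then show "\<kappa> < 2" by (simp add: \<kappa>_def)
    qed (simp add: \<kappa>_def)
    have sk: "1 + (r - 1) * (2 + \<mu>) \<le> r + r * \<kappa> / ?d"
    proof -
      have "?d * ((1 + (r - 1) * (2 + \<mu>)) / r - 1) \<le> \<kappa>" by (simp add: \<kappa>_def)
      then show ?thesis using r1 by (simp add: field_simps)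
    qed
    obtain Cg where Cg: "Cg > 0" "\<And>w A. \<lbrakk>smooth_fun w; Zd_periodic w; \<And>x::real^'d. w x > 0; A > 0;
       torus_integral (\<lambda>x. (w x)\<^sup>2) \<le> A\<rbrakk> \<Longrightarrow>
       torus_integral (\<lambda>x. w x powr (2 + 2 * \<kappa> / ?d)) \<le>
         Cg * A powr (\<kappa> / ?d) * (A + torus_integral (grad_sq w))"
      using gagliardo_nirenberg[OF \<kappa>, where 'd='d] by metis
    define D where "D = 2 * ?d * sqrt \<bar>K9\<bar>"
    have D: "D \<ge> 0" by (simp add: D_def)
    define R where "R = U * M + T * (\<kappa>0 * K + (2 * M) powr \<alpha> * M) + U + C * T"
    define R' where "R' = U * M' + T * (\<kappa>0 / 2 * K' + (2 * M') powr \<alpha> * M') + U + C * T"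
    \<comment> \<open>The maximum with 0 makes the coefficient of \<open>l\<close> nonnegative, as
      the absorption step demands.\<close>
    define S where "S = max 0 (R / c + 2 * (U' + (R' + R) / s + (Ca + 2 * \<bar>C6\<bar>) * (R / c)))"
    define y0 where "y0 = torus_integral (\<lambda>x. m0 x powr r)"
    have "smooth_fun (\<lambda>x. m0 x powr r)" using \<kappa>0 by (intro smooth_fun_powr m0_smooth) (meson less_le_trans)
    then have y0: "y0 \<ge> 0" unfolding y0_def by (intro torus_integral_nonneg smooth_continuous_on) auto
    let ?q = "1 + r / (4 * (r - 1))"
    let ?a = "1 + ?q * y0" and ?b = "?q * ((r - 1) * D * S)" and ?c = "?q * ((r - 1) * D * (T + Cg * (T + 1)))"
    have q: "?q \<ge> 0" using r1 by simp
    \<comment> \<open>\<open>B\<close> is fixed before \<epsilon>, u and m are introduced: the three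
      coefficients depend on the data only.\<close>
    obtain B where B: "\<And>Z. Z \<ge> 1 \<Longrightarrow> (\<And>l. l > 0 \<Longrightarrow> Z \<le> ?a + ?b * l
        + ?c * l powr (- (1 + \<mu>)) * Z\<^sup>2) \<Longrightarrow> Z \<le> B"
      by (rule absorption[OF mu, of "?a" "?b" "?c"])
        (use q y0 D r1 T Cg(1) in \<open>auto simp: S_def\<close>)
    have "torus_integral (\<lambda>x. \<bar>m (x, t)\<bar> powr r) powr (1 / r) \<le> B powr (1 / r)"
      if e: "\<epsilon> > 0" and reg: "?reg \<epsilon> u m" and t: "t \<in> {0..T}" for \<epsilon> u m t
    proof -
      interpret S: mfg_solution H "moll \<eta> \<epsilon>" "\<epsilon> *\<^sub>R 1" u m T \<alpha> c C by (rule sol[OF e reg])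
      note R = reg[unfolded reg_MFG_solution_def]
      have m_init: "m (x, 0) = m0 x" and u_end: "u (x, T) = uT x" for x using R by auto
      have lap_init: "lap m (x, 0) = ?l x" for x unfolding lap_slice m_init ..
      have lap_end: "lap u (x, T) = laplacian uT x" for x unfolding lap_slice u_end ..
      have J: "spacetime_integral T (\<lambda>z. m z * (ham u z + S.X z)) \<le> S"
      proof -
        have "spacetime_integral T (\<lambda>z. m z * (ham u z + S.X z)) \<le>
          R / c + 2 * (U' + (R' + R) / s + (Ca + 2 * \<bar>C6\<bar>) * (R / c))"
          unfolding R_def R'_def
          by (rule S.energy_bounds[OF m0_smooth m0_per \<kappa>0 _ L(2) K m_init \<psi>s \<psi>p _ \<psi>low _ L'(2) K' _ s _ _ Ca _ Cd])
            (use M M' U U' \<kappa>0 in \<open>auto simp: u_end lap_end lap_init \<psi>_def Ca_def abs_le_iff\<close>)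
        then show ?thesis by (simp add: S_def)
      qed
      have db: "\<bar>S.fp.divb z\<bar> \<le> D * (ham u z + S.X z) powr ((1 + \<mu>) / (2 + \<mu>))" for z
        unfolding D_def by (rule S.divb_bound[OF mu(1) K9])
      obtain Z where Z: "Z \<ge> 1" "\<And>t. t \<in> {0..T} \<Longrightarrow> torus_integral (\<lambda>x. m (x, t) powr r) \<le> Z"
        "\<And>l. l > 0 \<Longrightarrow> Z \<le> ?a + ?b * l
           + ?c * l powr (- (1 + \<mu>)) * Z\<^sup>2"
        by (rule S.power_integral_inequality[OF mu(1) r1 \<kappa> d2 sk D db Cg J, of y0])
          (auto simp: y0_def m_init)
      have "torus_integral (\<lambda>x. m (x, t) powr r) \<le> B"
        using Z(2)[OF t] B[OF Z(1,3)] by linarith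
      moreover have "torus_integral (\<lambda>x. m (x, t) powr r) \<ge> 0"
        by (intro torus_integral_nonneg smooth_continuous_on S.m_powr_slice t) auto
      moreover have "\<bar>m (x, t)\<bar> = m (x, t)" for x using S.m_pos[OF t, of x] by simp
      ultimately show ?thesis using r1 by (simp add: powr_mono2)
    qed
    then show ?thesis by blast
  qed
qed

end
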